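(* Let $0<\gamma\le1$ and $\delta>0$ satisfy $\delta+2\gamma>2$, let $a\in(-\sqrt{4\pi},\sqrt{4\pi})$, and let $\mu=\mu^{(a)}_{\sf exp}$ or $\mu=\mu^{(a)}_{\sf cos}$ on $E=H^{-\delta}(\mathbb T^2)$. Then the pre-Dirichlet form $(\mathcal E,\mathfrak FC_b^\infty)$, $$\mathcal E(F,G)=\frac12\int_E\big(A^\gamma D_HF(z),D_HG(z)\big)_H\,\mu(dz),\qquad F,G\in\mathfrak FC_b^\infty,$$ is closable in $L^2(\mu)$.
   Context: Setting. $\mathbb T^2=(\mathbb R/2\pi\mathbb Z)^2$ with Lebesgue measure; $\lambda_k=1+|k|^2$ for $k\in\mathbb Z^2$. $\{e_k\}_{k\in\mathbb Z^2}$ is the real orthonormal basis of $H:=L^2(\mathbb T^2)$ (real-valued): $e_{(0,0)}=\frac1{2\pi}$, $e_k(x)=\frac{1}{\sqrt2\pi}\cos(k\cdot x)$ if $k\in\mathbb Z^2_+:=\{k_1>0\}\cup\{k_1=0,k_2>0\}$, $e_k(x)=\frac1{\sqrt2\pi}\sin(k\cdot x)$ if $k\in-\mathbb Z^2_+$. $H^s(\mathbb T^2)$ is the real $L^2$-Sobolev space with norm $\|u\|_{H^s}^2=\sum_k\lambda_k^{s}\langle u,e_k\rangle^2$. $E:=H^{-\delta}(\mathbb T^2)$, $E^*=H^\delta(\mathbb T^2)$ with dual pairing $\langle\cdot,\cdot\rangle$ extending the $L^2$ inner product, $K:={\rm Span}\{e_k;k\in\mathbb Z^2\}$, $A:=(1-\Delta)^{-1}$,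 so that $A^\theta e_k=\lambda_k^{-\theta}e_k$. Free field. $\mu_0$ is the centered Gaussian probability measure on $E$ with $\int_E\langle z,l_1\rangle\langle z,l_2\rangle\,\mu_0(dz)=((1-\Delta)^{-1}l_1,l_2)_H$ for $l_1,l_2\in E^*$. Wick functions. Let $\Lambda\subset\mathbb R^2$ be any compact set with $\Lambda=-\Lambda$ and $0$ in its interior, and $(\Pi_{N\Lambda}z)(x)=\sum_{k\in N\Lambda\cap\mathbb Z^2}\langle z,e_k\rangle e_k(x)$. For $|a|<\sqrt{4\pi}$ and $g\in H$ put $:\!\exp(az)\!:(g)=\lim_N\int_{\mathbb T^2}\exp\big(a\Pi_{N\Lambda}z(x)-\frac{a^2}{2}\mathbb E^{\mu_0}[(\Pi_{N\Lambda}z)(x)^2]\big)g(x)dx$, $:\!\cos(az)\!:(g)=\lim_N\int_{\mathbb T^2}\cos(a\Pi_{N\Lambda}z(x))\exp\big(\frac{a^2}{2}\mathbb E^{\mu_0}[(\Pi_{N\Lambda}z)(x)^2]\big)g(x)dx$; these limits exist in $L^2(\mu_0)$ and do not depend on $\Lambda$. Measures. $\mu^{(a)}_{\sf exp}(dz)=\frac1{Z^{(a)}_{\sf exp}}\exp(-:\!\exp(az)\!:(\mathbf 1_{\mathbb T^2}))\mu_0(dz)$ and $\mu^{(a)}_{\sf cos}(dz)=\frac1{Z^{(a)}_{\sf cos}}\exp(-:\!\cos(az)\!:(\mathbf 1_{\mathbb T^2}))\mu_0(dz)$, where the normalizing constants are finite and positive. Cylinder functions. $\mathfrak FC_b^\infty$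 is the set of functions $F(z)=f(\langle z,\varphi_1\rangle,\dots,\langle z,\varphi_n\rangle)$ on $E$ with $n\in\mathbb N$, $f\in C_b^\infty(\mathbb R^n)$, $\varphi_j\in K$; $D_HF(z)=\sum_j\partial_jf(\langle z,\varphi_1\rangle,\dots,\langle z,\varphi_n\rangle)\varphi_j$. *)

theory Defs
  imports "HOL-Probability.Probability"
begin

definition in_L2 :: "'a measure \<Rightarrow> ('a \<Rightarrow> real) \<Rightarrow> bool" where
  "in_L2 M f \<longleftrightarrow> f \<in> borel_measurable M \<and> integrable M (\<lambda>x. (f x)\<^sup>2)"

definition L2_tendsto :: "'a measure \<Rightarrow> (nat \<Rightarrow> 'a \<Rightarrow> real) \<Rightarrow> ('a \<Rightarrow> real) \<Rightarrow> bool" where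
  "L2_tendsto M f g \<longleftrightarrow> (\<forall>n. in_L2 M (f n)) \<and> in_L2 M g \<and>
     (\<lambda>n. \<integral>x. (f n x - g x)\<^sup>2 \<partial>M) \<longlonglongrightarrow> 0"


subsection \<open>Function spaces on the torus\<close>

text \<open>Every point of \<open>(\<real>/2\<pi>\<int>)\<^sup>2\<close> has exactly one representative in \<open>[0,2\<pi>)\<^sup>2\<close>; functions on the
  torus are functions on the plane, of which only the values on this square matter.\<close>

definition torus :: "(real \<times> real) measure" where
  "torus = restrict_space lborel ({0..<2 * pi} \<times> {0..<2 * pi})"

definition inner_H :: "(real \<times> real \<Rightarrow> real) \<Rightarrow> (real \<times> real \<Rightarrow> real) \<Rightarrow> real" where
  "inner_H u v = (\<integral>x. u x * v x \<partial>torus)"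

definition lat :: "int \<times> int \<Rightarrow> real \<times> real" where
  "lat k = (of_int (fst k), of_int (snd k))"

definition lam :: "int \<times> int \<Rightarrow> real" where
  "lam k = 1 + (norm (lat k))\<^sup>2"

definition Z2_plus :: "(int \<times> int) set" where
  "Z2_plus = {k. fst k > 0} \<union> {k. fst k = 0 \<and> snd k > 0}"

definition e :: "int \<times> int \<Rightarrow> real \<times> real \<Rightarrow> real" where
  "e k x = (if k = (0, 0) then 1 / (2 * pi)
            else if k \<in> Z2_plus then cos (lat k \<bullet> x) / (sqrt 2 * pi)
            else sin (lat k \<bullet> x) / (sqrt 2 * pi))"

definition K_span :: "(real \<times> real \<Rightarrow> real) set" where
  "K_span = {\<phi>. \<exists>S c. finite S \<and> \<phi> = (\<lambda>x. \<Sum>k\<in>S. c k * e k x)}"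

definition coeff :: "(real \<times> real \<Rightarrow> real) \<Rightarrow> int \<times> int \<Rightarrow> real" where
  "coeff u k = inner_H u (e k)"

text \<open>For \<open>s < 0\<close> the elements of \<open>H\<^sup>s\<close> are distributions. An element \<open>u\<close> of \<open>H\<^sup>s\<close> is represented by
  the family of its coefficients \<open>\<langle>u, e\<^sub>k\<rangle>\<close>; by the definition of the Sobolev norm this identifies
  \<open>H\<^sup>s\<close> isometrically with the following weighted sequence space.\<close>

definition sobolev :: "real \<Rightarrow> (int \<times> int \<Rightarrow> real) set" where
  "sobolev s = {u. (\<lambda>k. lam k powr s * (u k)\<^sup>2) summable_on UNIV}"

definition sobolev_norm :: "real \<Rightarrow> (int \<times> int \<Rightarrow> real) \<Rightarrow> real" where
  "sobolev_norm s u = sqrt (\<Sum>\<^sub>\<infinity>k. lam k powr s * (u k)\<^sup>2)"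

definition sobolev_topology :: "real \<Rightarrow> (int \<times> int \<Rightarrow> real) topology" where
  "sobolev_topology s =
     Metric_space.mtopology (sobolev s) (\<lambda>u v. sobolev_norm s (\<lambda>k. u k - v k))"

definition sobolev_borel :: "real \<Rightarrow> (int \<times> int \<Rightarrow> real) measure" where
  "sobolev_borel s = sigma (sobolev s) {U. openin (sobolev_topology s) U}"

text \<open>For \<open>s \<ge> 0\<close>, in particular for the dual \<open>H\<^sup>\<delta>\<close> of \<open>H\<^bsup>-\<delta>\<^esup>\<close>, the elements are genuine functions.\<close>

definition sobolev_fun :: "real \<Rightarrow> (real \<times> real \<Rightarrow> real) set" where
  "sobolev_fun s = {l. in_L2 torus l \<and> coeff l \<in> sobolev s}"

definition pairing :: "(int \<times> int \<Rightarrow> real) \<Rightarrow> (real \<times> real \<Rightarrow> real) \<Rightarrow> real" where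
  "pairing z l = (\<Sum>\<^sub>\<infinity>k. z k * coeff l k)"

text \<open>The power \<open>A\<^sup>\<theta>\<close> of \<open>A = (1 - \<Delta>)\<^sup>-\<^sup>1\<close>. It is applied only for \<open>\<theta> = 1\<close> to functions in \<open>L\<^sup>2\<close>, where
  the series converges absolutely by Cauchy-Schwarz because \<open>\<Sum>\<^sub>k \<lambda>\<^sub>k\<^sup>-\<^sup>2 < \<infinity>\<close>, and for arbitrary
  \<open>\<theta>\<close> to trigonometric polynomials, where it is a finite sum.\<close>

definition A_pow :: "real \<Rightarrow> (real \<times> real \<Rightarrow> real) \<Rightarrow> real \<times> real \<Rightarrow> real" where
  "A_pow \<theta> u x = (\<Sum>\<^sub>\<infinity>k. lam k powr (- \<theta>) * coeff u k * e k x)"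


subsection \<open>The free field, Wick functions and Gibbs measures\<close>

definition centered_gaussian :: "real measure \<Rightarrow> bool" where
  "centered_gaussian \<nu> \<longleftrightarrow> \<nu> = return borel 0 \<or>
     (\<exists>\<sigma>>0. \<nu> = density lborel (\<lambda>x. ennreal (normal_density 0 \<sigma> x)))"

definition free_field :: "real \<Rightarrow> (int \<times> int \<Rightarrow> real) measure \<Rightarrow> bool" where
  "free_field \<delta> \<mu>0 \<longleftrightarrow> prob_space \<mu>0 \<and> sets \<mu>0 = sets (sobolev_borel (- \<delta>)) \<and>
     (\<forall>l\<in>sobolev_fun \<delta>. centered_gaussian (distr \<mu>0 borel (\<lambda>z. pairing z l))) \<and>
     (\<forall>l1\<in>sobolev_fun \<delta>. \<forall>l2\<in>sobolev_fun \<delta>.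
        (\<integral>z. pairing z l1 * pairing z l2 \<partial>\<mu>0) = inner_H (A_pow 1 l1) l2)"

definition proj :: "(real \<times> real) set \<Rightarrow> nat \<Rightarrow> (int \<times> int \<Rightarrow> real) \<Rightarrow> real \<times> real \<Rightarrow> real" where
  "proj \<Lambda> N z x = (\<Sum>k | lat k \<in> (\<lambda>y. real N *\<^sub>R y) ` \<Lambda>. z k * e k x)"

definition wick_exp_cutoff ::
  "(int \<times> int \<Rightarrow> real) measure \<Rightarrow> (real \<times> real) set \<Rightarrow> real \<Rightarrow> (real \<times> real \<Rightarrow> real) \<Rightarrow>
   nat \<Rightarrow> (int \<times> int \<Rightarrow> real) \<Rightarrow> real" where
  "wick_exp_cutoff \<mu>0 \<Lambda> a g N z =
     (\<integral>x. exp (a * proj \<Lambda> N z x - a\<^sup>2 / 2 * (\<integral>w. (proj \<Lambda> N w x)\<^sup>2 \<partial>\<mu>0)) * g x \<partial>torus)"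

definition wick_cos_cutoff ::
  "(int \<times> int \<Rightarrow> real) measure \<Rightarrow> (real \<times> real) set \<Rightarrow> real \<Rightarrow> (real \<times> real \<Rightarrow> real) \<Rightarrow>
   nat \<Rightarrow> (int \<times> int \<Rightarrow> real) \<Rightarrow> real" where
  "wick_cos_cutoff \<mu>0 \<Lambda> a g N z =
     (\<integral>x. cos (a * proj \<Lambda> N z x) * exp (a\<^sup>2 / 2 * (\<integral>w. (proj \<Lambda> N w x)\<^sup>2 \<partial>\<mu>0)) * g x \<partial>torus)"

text \<open>\<open>W\<close> is a version of \<open>:exp(az):(g)\<close>, respectively \<open>:cos(az):(g)\<close>; being \<open>L\<^sup>2\<close>-limits, these are
  determined up to null sets only.\<close>

definition is_wick_exp ::
  "(int \<times> int \<Rightarrow> real) measure \<Rightarrow> (real \<times> real) set \<Rightarrow> real \<Rightarrow> (real \<times> real \<Rightarrow> real) \<Rightarrow>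
   ((int \<times> int \<Rightarrow> real) \<Rightarrow> real) \<Rightarrow> bool" where
  "is_wick_exp \<mu>0 \<Lambda> a g W \<longleftrightarrow> L2_tendsto \<mu>0 (wick_exp_cutoff \<mu>0 \<Lambda> a g) W"

definition is_wick_cos ::
  "(int \<times> int \<Rightarrow> real) measure \<Rightarrow> (real \<times> real) set \<Rightarrow> real \<Rightarrow> (real \<times> real \<Rightarrow> real) \<Rightarrow>
   ((int \<times> int \<Rightarrow> real) \<Rightarrow> real) \<Rightarrow> bool" where
  "is_wick_cos \<mu>0 \<Lambda> a g W \<longleftrightarrow> L2_tendsto \<mu>0 (wick_cos_cutoff \<mu>0 \<Lambda> a g) W"

definition gibbs :: "'a measure \<Rightarrow> ('a \<Rightarrow> real) \<Rightarrow> 'a measure" where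
  "gibbs \<mu>0 W = density \<mu>0 (\<lambda>z. ennreal (exp (- W z) / (\<integral>w. exp (- W w) \<partial>\<mu>0)))"


subsection \<open>Cylinder functions and the pre-Dirichlet form\<close>

definition partial :: "nat \<Rightarrow> ((nat \<Rightarrow> real) \<Rightarrow> real) \<Rightarrow> (nat \<Rightarrow> real) \<Rightarrow> real" where
  "partial j f x = deriv (\<lambda>t. f (x(j := t))) (x j)"

text \<open>\<open>C\<^sub>b\<^sup>\<infinity>(\<real>\<^sup>n)\<close>, the smooth functions which are bounded together with all partial derivatives. Since
  \<open>n\<close> varies inside the definition of cylinder functions, a function on \<open>\<real>\<^sup>n\<close> is encoded as a function
  of a real sequence depending only on the first \<open>n\<close> entries; continuity with respect to the product
  topology then is continuity on \<open>\<real>\<^sup>n\<close>. The term \<open>foldr partial js f\<close> is the iterated partial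
  derivative along the multi-index \<open>js\<close>.\<close>

definition Cb_infinity :: "nat \<Rightarrow> ((nat \<Rightarrow> real) \<Rightarrow> real) set" where
  "Cb_infinity n = {f.
     (\<forall>x y. (\<forall>i<n. x i = y i) \<longrightarrow> f x = f y) \<and>
     (\<forall>js. set js \<subseteq> {..<n} \<longrightarrow>
        continuous_on UNIV (foldr partial js f) \<and> bounded (range (foldr partial js f)) \<and>
        (\<forall>j<n. \<forall>x. (\<lambda>t. foldr partial js f (x(j := t))) differentiable at (x j)))}"

definition cyl_rep :: "real \<Rightarrow> ((int \<times> int \<Rightarrow> real) \<Rightarrow> real) \<Rightarrow> nat \<Rightarrow> ((nat \<Rightarrow> real) \<Rightarrow> real) \<Rightarrow>
    (nat \<Rightarrow> real \<times> real \<Rightarrow> real) \<Rightarrow> bool" where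
  "cyl_rep \<delta> F n f \<phi> \<longleftrightarrow> f \<in> Cb_infinity n \<and> (\<forall>j<n. \<phi> j \<in> K_span) \<and>
     (\<forall>z\<in>sobolev (- \<delta>). F z = f (\<lambda>j. pairing z (\<phi> j)))"

definition FCb :: "real \<Rightarrow> ((int \<times> int \<Rightarrow> real) \<Rightarrow> real) set" where
  "FCb \<delta> = {F. \<exists>n f \<phi>. cyl_rep \<delta> F n f \<phi>}"

text \<open>The gradient at a point \<open>z\<close> of \<open>H\<^bsup>-\<delta>\<^esup>\<close> does not depend on the representation of \<open>F\<close>: it is
  a trigonometric polynomial \<open>v\<close>, and \<open>\<langle>v, e\<^sub>k\<rangle>\<close> is the derivative of \<open>F\<close> at \<open>z\<close> in direction
  \<open>e\<^sub>k\<close>.\<close>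

definition D_H :: "real \<Rightarrow> ((int \<times> int \<Rightarrow> real) \<Rightarrow> real) \<Rightarrow> (int \<times> int \<Rightarrow> real) \<Rightarrow>
    real \<times> real \<Rightarrow> real" where
  "D_H \<delta> F z = (THE v. \<exists>n f \<phi>. cyl_rep \<delta> F n f \<phi> \<and>
     v = (\<lambda>x. \<Sum>j<n. partial j f (\<lambda>i. pairing z (\<phi> i)) * \<phi> j x))"

definition pre_form :: "real \<Rightarrow> real \<Rightarrow> (int \<times> int \<Rightarrow> real) measure \<Rightarrow>
    ((int \<times> int \<Rightarrow> real) \<Rightarrow> real) \<Rightarrow> ((int \<times> int \<Rightarrow> real) \<Rightarrow> real) \<Rightarrow> real" where
  "pre_form \<gamma> \<delta> \<mu> F G =
     1 / 2 * (\<integral>z. inner_H (A_pow \<gamma> (D_H \<delta> F z)) (D_H \<delta> G z) \<partial>\<mu>)"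

text \<open>Closability of a form \<open>Q\<close> with domain \<open>D\<close> in \<open>L\<^sup>2(M)\<close>. Constant sequences show that it includes
  well-definedness on classes: \<open>Q(F,F) = 0\<close> whenever \<open>F = 0\<close> almost everywhere.\<close>

definition closable_in_L2 :: "'a measure \<Rightarrow> ('a \<Rightarrow> real) set \<Rightarrow>
    (('a \<Rightarrow> real) \<Rightarrow> ('a \<Rightarrow> real) \<Rightarrow> real) \<Rightarrow> bool" where
  "closable_in_L2 M D Q \<longleftrightarrow>
     (\<forall>F. (\<forall>n. F n \<in> D) \<longrightarrow> L2_tendsto M F (\<lambda>_. 0) \<longrightarrow>
        (\<forall>\<epsilon>>0. \<exists>N. \<forall>m\<ge>N. \<forall>n\<ge>N. Q (\<lambda>z. F m z - F n z) (\<lambda>z. F m z - F n z) < \<epsilon>) \<longrightarrow>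
        (\<lambda>n. Q (F n) (F n)) \<longlonglongrightarrow> 0)"

end

theory Submission
  imports Defs
begin

text \<open>Write \<open>z = (z\<^sub>k)\<close> for the coordinates of the field. Under \<open>\<mu>\<^sub>0\<close> they are independent centred
  Gaussians, so \<open>\<mu>\<^sub>0\<close> disintegrates along the lines \<open>t \<mapsto> z(k := t)\<close>. Along a line, a one-dimensional
  gradient form with density \<open>\<rho>\<close> is closable as soon as \<open>\<rho>\<close> is locally bounded away from 0 (Hamza's
  condition), and closability in every direction \<open>e\<^sub>k\<close> gives closability of \<open>\<E>\<close>. Hence it is enough
  that the Wick function \<open>W\<close> in the density \<open>exp(- W)\<close> is locally bounded on almost every line. The
  cutoffs \<open>W\<^sub>N\<close> converge to \<open>W\<close> in \<open>L\<^sup>2(\<mu>\<^sub>0)\<close>; if their derivatives in direction \<open>e\<^sub>k\<close> are bounded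
  in \<open>L\<^sup>2(\<mu>\<^sub>0)\<close>, then on almost every line Fatou's lemma gives a subsequence of equicontinuous functions,
  and local boundedness passes to the limit.

  The derivatives are bounded by the functions themselves, without any estimate of the Green function:
  for the exponential \<open>\<bar>\<partial>\<^sub>k W\<^sub>N\<bar> \<le> \<bar>a\<bar> W\<^sub>N\<close> pointwise, and for the cosine
  \<open>\<bar>E[sin X sin Y]\<bar> \<le> E[cos X cos Y]\<close> for jointly centred Gaussian \<open>X, Y\<close>, because
  \<open>E[cos (X \<plusminus> Y)] \<ge> 0\<close>.\<close>

section \<open>Trigonometric polynomials on the torus\<close>

text \<open>The definition of the free field prescribes one-dimensional laws and a covariance only,
  on a space \<open>sobolev (- \<delta>)\<close> that is not a product. Independence is therefore
  derived: the identity pushes the field forward to the space of all sequences, where Levy's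
  uniqueness theorem identifies its law. Whatever has to be followed along lines (cutoffs, cylinder
  functions, a version of the Wick function) is accordingly extended to all sequences with product
  measurability; agreement with the original objects is needed only on the Sobolev space or almost
  everywhere. A second obstacle is that convergence in L2 says nothing about a single line. For
  cylinder functions this is repaired by subsequences converging so fast that weighted sums of
  squares are integrable, hence finite on almost every line. Finally, the number of directions grows
  along a sequence of cylinder functions, so limits in each direction do not add up by themselves.
  The Cauchy property of the form controls the difference \<open>F n - F m\<close>, and for fixed n
  only the finitely many directions of \<open>F n\<close> remain when m tends to infinity.\<close>

lemma torus_square_borel[measurable]: "{0..<2 * pi} \<times> {0..<2 * pi} \<in> sets (borel :: (real \<times> real) measure)"
  by (simp add: borel_Times)

lemma space_torus: "space torus = {0..<2 * pi} \<times> {0..<2 * pi}"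
  by (simp add: torus_def space_restrict_space)

lemma finite_measure_torus: "finite_measure torus"
proof
  have "emeasure torus (space torus) = emeasure lborel ({0..<2 * pi} \<times> {0..<2 * pi} :: (real \<times> real) set)"
    unfolding space_torus unfolding torus_def by (subst emeasure_restrict_space) auto
  also have "\<dots> = emeasure lborel {0..<2 * pi} * emeasure lborel {0..<2 * pi}"
    unfolding lborel_prod[symmetric] by (rule lborel.emeasure_pair_measure_Times) auto
  also have "\<dots> = ennreal (2 * pi) * ennreal (2 * pi)" by simp
  finally show "emeasure torus (space torus) \<noteq> \<infinity>" by (simp add: ennreal_mult_eq_top_iff)
qed

interpretation torus: finite_measure torus by (rule finite_measure_torus)

lemma measurable_torus[measurable (raw)]:
  "f \<in> borel_measurable borel \<Longrightarrow> f \<in> borel_measurable torus"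
  unfolding torus_def by (rule measurable_restrict_space1) simp

text \<open>The phase is kept general because a sine is a cosine with phase - pi / 2
  (\<open>e_eq_cos\<close>), so orthogonality of the whole basis rests on this one integral.\<close>

lemma integral_cos_period:
  "(\<integral>y. indicator {0..<2 * pi} y * cos (of_int b * y + \<phi>) \<partial>lborel) = (if b = 0 then 2 * pi * cos \<phi> else 0)"
proof -
  let ?F = "\<lambda>y. if b = 0 then y * cos \<phi> else sin (of_int b * y + \<phi>) / of_int b"
  have "(\<integral>y. indicator {0..<2 * pi} y * cos (of_int b * y + \<phi>) \<partial>lborel)
      = (\<integral>y. cos (of_int b * y + \<phi>) * indicator {0..2 * pi} y \<partial>lborel)"
  proof (rule integral_cong_AE)
    show "AE y in lborel. indicator {0..<2 * pi} y * cos (of_int b * y + \<phi>) = cos (of_int b * y + \<phi>) * indicator {0..2 * pi} y"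
      using AE_lborel_singleton[of "2 * pi"] by eventually_elim (auto simp: indicator_def)
  qed measurable
  also have "\<dots> = ?F (2 * pi) - ?F 0"
  proof (rule integral_FTC_Icc_real)
    show "(?F has_real_derivative cos (of_int b * y + \<phi>)) (at y)" for y
      by (cases "b = 0") (auto intro!: derivative_eq_intros)
  qed (auto intro!: continuous_intros)
  also have "\<dots> = (if b = 0 then 2 * pi * cos \<phi> else 0)"
    using sin.plus_of_int[of \<phi> b] by (auto simp: ac_simps)
  finally show ?thesis .
qed

lemma integral_torus:
  fixes f :: "real \<times> real \<Rightarrow> real"
  assumes [measurable]: "f \<in> borel_measurable borel" and B: "\<And>x. \<bar>f x\<bar> \<le> B"
  shows "(\<integral>x. f x \<partial>torus) =
    (\<integral>x. indicator {0..<2 * pi} x * (\<integral>y. indicator {0..<2 * pi} y * f (x, y) \<partial>lborel) \<partial>lborel)"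
proof -
  let ?S = "{0..<2 * pi}"
  have int: "integrable (lborel \<Otimes>\<^sub>M lborel) (\<lambda>z. indicator (?S \<times> ?S) z * f z)"
  proof -
    have "emeasure (lborel \<Otimes>\<^sub>M lborel) (?S \<times> ?S) = ennreal (2 * pi) * ennreal (2 * pi)"
      by (subst lborel.emeasure_pair_measure_Times) auto
    then have "integrable (lborel \<Otimes>\<^sub>M lborel) (\<lambda>z. indicator (?S \<times> ?S) z * B :: real)"
      by (intro integrable_mult_left integrable_real_indicator) (auto simp: ennreal_mult_less_top)
    then show ?thesis
    proof (rule Bochner_Integration.integrable_bound)
      have "(\<lambda>z. indicator (?S \<times> ?S) z * f z) \<in> borel_measurable (borel \<Otimes>\<^sub>M borel)"
        unfolding borel_prod by (intro borel_measurable_times borel_measurable_indicator) auto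
      then show "(\<lambda>z. indicator (?S \<times> ?S) z * f z) \<in> borel_measurable (lborel \<Otimes>\<^sub>M lborel)"
        by (simp add: lborel_prod borel_prod)
      have "0 \<le> B" using B[of 0] by linarith
      then show "AE z in lborel \<Otimes>\<^sub>M lborel. norm (indicator (?S \<times> ?S) z * f z) \<le> norm (indicator (?S \<times> ?S) z * B :: real)"
        using B by (auto simp: indicator_def)
    qed
  qed
  have "(\<integral>x. f x \<partial>torus) = (\<integral>z. indicator (?S \<times> ?S) z * f z \<partial>(lborel \<Otimes>\<^sub>M lborel))"
    unfolding torus_def lborel_prod by (subst integral_restrict_space) auto
  also have "\<dots> = (\<integral>x. (\<integral>y. indicator (?S \<times> ?S) (x, y) * f (x, y) \<partial>lborel) \<partial>lborel)"
    by (rule lborel_pair.integral_fst'[OF int, symmetric])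
  also have "\<dots> = (\<integral>x. indicator ?S x * (\<integral>y. indicator ?S y * f (x, y) \<partial>lborel) \<partial>lborel)"
    by (intro Bochner_Integration.integral_cong refl)
      (auto simp: indicator_times mult.assoc)
  finally show ?thesis .
qed

lemma integral_torus_cos:
  "(\<integral>x. cos (lat k \<bullet> x + \<phi>) \<partial>torus) = (if k = (0, 0) then (2 * pi)\<^sup>2 * cos \<phi> else 0)"
proof -
  obtain a b where k: "k = (a, b)" by (cases k)
  have "(\<integral>x. cos (lat k \<bullet> x + \<phi>) \<partial>torus) = (\<integral>x. indicator {0..<2 * pi} x *
      (\<integral>y. indicator {0..<2 * pi} y * cos (lat k \<bullet> (x, y) + \<phi>) \<partial>lborel) \<partial>lborel)"
    by (rule integral_torus[where B = 1]) auto
  also have "\<dots> = (\<integral>x. indicator {0..<2 * pi} x *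
      (\<integral>y. indicator {0..<2 * pi} y * cos (of_int b * y + (of_int a * x + \<phi>)) \<partial>lborel) \<partial>lborel)"
    by (simp add: k lat_def inner_prod_def algebra_simps)
  also have "\<dots> = (\<integral>x. (if b = 0 then 2 * pi else 0) * (indicator {0..<2 * pi} x * cos (of_int a * x + \<phi>)) \<partial>lborel)"
    unfolding integral_cos_period by (intro Bochner_Integration.integral_cong) auto
  also have "\<dots> = (if k = (0, 0) then (2 * pi)\<^sup>2 * cos \<phi> else 0)"
    by (subst integral_mult_right_zero) (simp add: integral_cos_period k power2_eq_square)
  finally show ?thesis .
qed

lemma continuous_on_e: "continuous_on A (e k)"
proof -
  have "continuous_on A (\<lambda>x. e k x)"
    unfolding e_def by (cases "k = (0, 0)"; cases "k \<in> Z2_plus") (auto intro!: continuous_intros)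
  then show ?thesis .
qed

lemma measurable_e[measurable]: "e k \<in> borel_measurable borel"
  by (rule borel_measurable_continuous_onI[OF continuous_on_e])

lemma abs_e_le: "\<bar>e k x\<bar> \<le> 1"
proof -
  have s2: "1 \<le> sqrt 2 * pi"
    using mult_mono[of 1 "sqrt 2" 1 pi] pi_ge_two by auto
  have "\<bar>c / (sqrt 2 * pi)\<bar> \<le> 1" if "\<bar>c\<bar> \<le> 1" for c
    using that s2 by (simp add: abs_mult divide_le_eq_1)
  then show ?thesis using pi_ge_two by (auto simp: e_def)
qed

lemma e_eq_cos:
  assumes "k \<noteq> (0, 0)"
  shows "e k x = cos (lat k \<bullet> x + (if k \<in> Z2_plus then 0 else - pi / 2)) / (sqrt 2 * pi)"
  using assms by (simp add: e_def cos_diff)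

lemma integrable_torus_bounded:
  fixes f :: "real \<times> real \<Rightarrow> real"
  assumes "f \<in> borel_measurable borel" and "\<And>x. \<bar>f x\<bar> \<le> B"
  shows "integrable torus f"
  by (rule torus.integrable_const_bound[where B = B]) (use assms in auto)

lemma inner_e: "inner_H (e k) (e l) = (if k = l then 1 else 0)"
proof -
  have int: "integrable torus (\<lambda>x. cos (lat m \<bullet> x + \<phi>))" for m \<phi>
    by (rule integrable_torus_bounded[where B = 1]) auto
  define ph where "ph k = (if k \<in> Z2_plus then 0 else - pi / 2)" for k
  have one: "inner_H (e (0, 0)) (e l) = (if (0, 0) = l then 1 else 0)" for l
  proof (cases "l = (0, 0)")
    case True
    have "inner_H (e l) (e l) = (\<integral>x. 1 / (2 * pi)\<^sup>2 * cos (lat (0, 0) \<bullet> x + 0) \<partial>torus)"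
      unfolding inner_H_def using True
      by (intro Bochner_Integration.integral_cong) (auto simp: e_def lat_def inner_prod_def power2_eq_square)
    also have "\<dots> = 1" by (subst integral_mult_right_zero, subst integral_torus_cos) simp
    finally show ?thesis using True by simp
  next
    case False
    have "inner_H (e (0, 0)) (e l) = (\<integral>x. 1 / (2 * pi * (sqrt 2 * pi)) * cos (lat l \<bullet> x + ph l) \<partial>torus)"
      unfolding inner_H_def by (intro Bochner_Integration.integral_cong)
        (auto simp: e_eq_cos[OF False] ph_def[symmetric] e_def[of "(0,0)"])
    also have "\<dots> = 0" by (subst integral_mult_right_zero, subst integral_torus_cos) (simp add: False)
    finally show ?thesis using False by auto
  qed
  have comm: "inner_H (e k) (e l) = inner_H (e l) (e k)" for k l by (simp add: inner_H_def mult.commute)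
  consider "k = (0, 0)" | "l = (0, 0)" | "k \<noteq> (0, 0)" "l \<noteq> (0, 0)" by blast
  then show ?thesis
  proof cases
    case 1
    then show ?thesis using one[of l] by simp
  next
    case 2
    then show ?thesis using one[of k] comm[of k l] by auto
  next
    case 3
    have lat: "lat (k - l) = lat k - lat l" "lat (k + l) = lat k + lat l" by (auto simp: lat_def prod_eq_iff)
    have "inner_H (e k) (e l) = (\<integral>x. 1 / (4 * pi\<^sup>2) * (cos (lat (k - l) \<bullet> x + (ph k - ph l)) + cos (lat (k + l) \<bullet> x + (ph k + ph l))) \<partial>torus)"
      unfolding inner_H_def
    proof (intro Bochner_Integration.integral_cong refl)
      fix x
      have "e k x * e l x = cos (lat k \<bullet> x + ph k) * cos (lat l \<bullet> x + ph l) / (2 * pi\<^sup>2)"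
        unfolding e_eq_cos[OF 3(1)] e_eq_cos[OF 3(2)] ph_def[symmetric] by (simp add: power2_eq_square)
      also have "\<dots> = 1 / (4 * pi\<^sup>2) * (cos (lat (k - l) \<bullet> x + (ph k - ph l)) + cos (lat (k + l) \<bullet> x + (ph k + ph l)))"
      proof -
        have "lat k \<bullet> x + ph k - (lat l \<bullet> x + ph l) = lat (k - l) \<bullet> x + (ph k - ph l)"
          "lat k \<bullet> x + ph k + (lat l \<bullet> x + ph l) = lat (k + l) \<bullet> x + (ph k + ph l)"
          by (simp_all add: lat inner_diff_left inner_add_left)
        note eqs = this
        show ?thesis unfolding cos_times_cos eqs by simp
      qed
      finally show "e k x * e l x = \<dots>" .
    qed
    also have "\<dots> = 1 / (4 * pi\<^sup>2) * ((if k - l = (0, 0) then (2 * pi)\<^sup>2 * cos (ph k - ph l) else 0) + (if k + l = (0, 0) then (2 * pi)\<^sup>2 * cos (ph k + ph l) else 0))"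
      by (subst integral_mult_right_zero, subst Bochner_Integration.integral_add[OF int int], subst (1 2) integral_torus_cos) simp
    also have "\<dots> = (if k = l then 1 else 0)"
    proof -
      have "k - l = (0, 0) \<longleftrightarrow> k = l" by (cases k; cases l) auto
      \<comment> \<open>If k + l = 0, exactly one of the two indices lies in \<open>Z2_plus\<close>,
        so the phases add up to - pi / 2 and the term vanishes. If k = l, the phases cancel in the
        other term.\<close>
      moreover have "k + l = (0, 0) \<Longrightarrow> k \<noteq> l \<and> cos (ph k + ph l) = 0"
        using 3 by (cases k; cases l) (auto simp: ph_def Z2_plus_def add_eq_0_iff)
      ultimately show ?thesis by (auto simp: power_mult_distrib)
    qed
    finally show ?thesis .
  qed
qed

lemma span_bounded: "\<bar>\<Sum>k\<in>S. c k * e k x\<bar> \<le> (\<Sum>k\<in>S. \<bar>c k\<bar>)"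
  by (rule order_trans[OF sum_abs]) (auto intro!: sum_mono simp: abs_mult mult_left_le abs_e_le)

lemma inner_span_e:
  assumes "finite S"
  shows "inner_H (\<lambda>x. \<Sum>k\<in>S. c k * e k x) (e l) = (if l \<in> S then c l else 0)"
proof -
  have int: "integrable torus (\<lambda>x. c k * (e k x * e l x))" for k
    by (intro integrable_mult_right integrable_torus_bounded[where B = 1])
      (auto simp: abs_mult intro!: mult_le_one abs_e_le)
  have "inner_H (\<lambda>x. \<Sum>k\<in>S. c k * e k x) (e l) = (\<integral>x. (\<Sum>k\<in>S. c k * (e k x * e l x)) \<partial>torus)"
    by (simp add: inner_H_def sum_distrib_right mult.assoc)
  also have "\<dots> = (\<Sum>k\<in>S. c k * inner_H (e k) (e l))"
    by (subst Bochner_Integration.integral_sum[OF int]) (simp add: inner_H_def)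
  also have "\<dots> = (if l \<in> S then c l else 0)" using assms by (simp add: inner_e if_distrib[of "(*) _"] cong: if_cong)
  finally show ?thesis .
qed

lemma coeff_span:
  "finite S \<Longrightarrow> coeff (\<lambda>x. \<Sum>k\<in>S. c k * e k x) l = (if l \<in> S then c l else 0)"
  unfolding coeff_def by (rule inner_span_e)

lemma inner_span:
  assumes "finite S"
  shows "inner_H (\<lambda>x. \<Sum>k\<in>S. c k * e k x) (\<lambda>x. \<Sum>k\<in>S. d k * e k x) = (\<Sum>k\<in>S. c k * d k)"
proof -
  have int: "integrable torus (\<lambda>x. d l * ((\<Sum>k\<in>S. c k * e k x) * e l x))" for l
  proof (intro integrable_mult_right integrable_torus_bounded)
    show "\<bar>(\<Sum>k\<in>S. c k * e k x) * e l x\<bar> \<le> (\<Sum>k\<in>S. \<bar>c k\<bar>) * 1" for x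
      unfolding abs_mult by (intro mult_mono span_bounded abs_e_le) (auto intro: sum_nonneg)
  qed measurable
  have "inner_H (\<lambda>x. \<Sum>k\<in>S. c k * e k x) (\<lambda>x. \<Sum>k\<in>S. d k * e k x)
      = (\<integral>x. (\<Sum>l\<in>S. d l * ((\<Sum>k\<in>S. c k * e k x) * e l x)) \<partial>torus)"
    unfolding inner_H_def sum_distrib_left by (simp add: ac_simps)
  also have "\<dots> = (\<Sum>l\<in>S. d l * inner_H (\<lambda>x. \<Sum>k\<in>S. c k * e k x) (e l))"
    by (subst Bochner_Integration.integral_sum[OF int]) (simp add: inner_H_def)
  also have "\<dots> = (\<Sum>k\<in>S. c k * d k)" by (simp add: inner_span_e[OF assms] mult.commute)
  finally show ?thesis .
qed

lemma infsum_finite_support: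
  fixes f :: "'a \<Rightarrow> real"
  assumes "finite S" and "\<And>k. k \<notin> S \<Longrightarrow> f k = 0"
  shows "(\<Sum>\<^sub>\<infinity>k. f k) = (\<Sum>k\<in>S. f k)"
proof -
  have "infsum f UNIV = infsum f S" by (rule infsum_cong_neutral) (use assms in auto)
  then show ?thesis using assms(1) by simp
qed

lemma pairing_span:
  assumes "finite S"
  shows "pairing z (\<lambda>x. \<Sum>k\<in>S. c k * e k x) = (\<Sum>k\<in>S. z k * c k)"
  unfolding pairing_def by (subst infsum_finite_support[OF assms]) (auto simp: coeff_span assms)

lemma A_pow_span:
  assumes "finite S"
  shows "A_pow \<theta> (\<lambda>x. \<Sum>k\<in>S. c k * e k x) = (\<lambda>x. \<Sum>k\<in>S. lam k powr (- \<theta>) * c k * e k x)"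
  unfolding A_pow_def by (subst infsum_finite_support[OF assms]) (auto simp: coeff_span assms)

lemma inner_A_pow_span:
  assumes "finite S"
  shows "inner_H (A_pow \<theta> (\<lambda>x. \<Sum>k\<in>S. c k * e k x)) (\<lambda>x. \<Sum>k\<in>S. d k * e k x) =
    (\<Sum>k\<in>S. lam k powr (- \<theta>) * (c k * d k))"
  unfolding A_pow_span[OF assms] inner_span[OF assms] by (simp add: mult.assoc)

text \<open>The hypotheses in \<open>free_field\<close> concern test functions in
  \<open>sobolev_fun\<close>; this makes trigonometric polynomials admissible, which are the test
  functions used later.\<close>

lemma span_in_sobolev_fun:
  assumes "finite S"
  shows "(\<lambda>x. \<Sum>k\<in>S. c k * e k x) \<in> sobolev_fun s"
proof -
  let ?u = "\<lambda>x. \<Sum>k\<in>S. c k * e k x"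
  have "integrable torus (\<lambda>x. (?u x)\<^sup>2)"
  proof (rule integrable_torus_bounded)
    show "\<bar>(?u x)\<^sup>2\<bar> \<le> (\<Sum>k\<in>S. \<bar>c k\<bar>)\<^sup>2" for x
      using power_mono[OF span_bounded abs_ge_zero, of c x S 2] by simp
  qed measurable
  moreover have "(\<lambda>k. lam k powr s * (coeff ?u k)\<^sup>2) summable_on UNIV"
  proof (subst summable_on_cong_neutral[where T = S and g = "\<lambda>k. lam k powr s * (coeff ?u k)\<^sup>2"])
    show "(\<lambda>k. lam k powr s * (coeff ?u k)\<^sup>2) summable_on S" using assms by simp
  qed (auto simp: coeff_span assms)
  ultimately show ?thesis by (simp add: sobolev_fun_def in_L2_def sobolev_def)
qed

section \<open>The weighted sequence spaces\<close>

lemma lam_ge_1: "1 \<le> lam k"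
  by (simp add: lam_def)

lemma sobolev_finite_support:
  assumes "finite S" and "\<And>k. k \<notin> S \<Longrightarrow> u k = 0"
  shows "u \<in> sobolev s"
  unfolding sobolev_def mem_Collect_eq
  by (subst summable_on_cong_neutral[where T = S and g = "\<lambda>k. lam k powr s * (u k)\<^sup>2"])
    (use assms in auto)

lemma sobolev_diff:
  assumes u: "u \<in> sobolev s" and v: "v \<in> sobolev s"
  shows "(\<lambda>k. u k - v k) \<in> sobolev s"
proof -
  have "(\<lambda>k. 2 * (lam k powr s * (u k)\<^sup>2) + 2 * (lam k powr s * (v k)\<^sup>2)) summable_on UNIV"
    using u v unfolding sobolev_def by (intro summable_on_add summable_on_cmult_right) auto
  then show ?thesis
    unfolding sobolev_def mem_Collect_eq
  proof (rule summable_on_comparison_test)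
    fix k
    have "(u k - v k)\<^sup>2 \<le> 2 * (u k)\<^sup>2 + 2 * (v k)\<^sup>2"
      using zero_le_power2[of "u k + v k"] by (simp add: power2_eq_square algebra_simps)
    then have "lam k powr s * (u k - v k)\<^sup>2 \<le> lam k powr s * (2 * (u k)\<^sup>2 + 2 * (v k)\<^sup>2)"
      by (rule mult_left_mono) simp
    then show "lam k powr s * (u k - v k)\<^sup>2 \<le> 2 * (lam k powr s * (u k)\<^sup>2) + 2 * (lam k powr s * (v k)\<^sup>2)"
      by (simp add: algebra_simps)
  qed auto
qed

lemma sobolev_update:
  assumes "z \<in> sobolev s"
  shows "z(k := t) \<in> sobolev s"
proof -
  have "(\<lambda>j. z j - (if j = k then z k - t else 0)) \<in> sobolev s"
    by (rule sobolev_diff[OF assms sobolev_finite_support[of "{k}"]]) auto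
  moreover have "(\<lambda>j. z j - (if j = k then z k - t else 0)) = z(k := t)" by auto
  ultimately show ?thesis by simp
qed

lemma sobolev_partial_sum_le:
  assumes "u \<in> sobolev s" and "finite F"
  shows "(\<Sum>k\<in>F. lam k powr s * (u k)\<^sup>2) \<le> (sobolev_norm s u)\<^sup>2"
proof -
  have "(\<Sum>k\<in>F. lam k powr s * (u k)\<^sup>2) \<le> (\<Sum>\<^sub>\<infinity>k. lam k powr s * (u k)\<^sup>2)"
    using assms unfolding sobolev_def by (intro finite_sum_le_infsum) auto
  moreover have "0 \<le> (\<Sum>\<^sub>\<infinity>k. lam k powr s * (u k)\<^sup>2)" by (rule infsum_nonneg) simp
  ultimately show ?thesis by (simp add: sobolev_norm_def)
qed

lemma sobolev_norm_nonneg: "0 \<le> sobolev_norm s u"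
  unfolding sobolev_norm_def by (intro real_sqrt_ge_zero infsum_nonneg) simp

lemma sobolev_coordinate_le:
  assumes "u \<in> sobolev s"
  shows "sqrt (lam k powr s) * \<bar>u k\<bar> \<le> sobolev_norm s u"
proof -
  have "(sqrt (lam k powr s) * \<bar>u k\<bar>)\<^sup>2 \<le> (sobolev_norm s u)\<^sup>2"
    using sobolev_partial_sum_le[OF assms, of "{k}"] by (simp add: power_mult_distrib)
  then show ?thesis by (rule power2_le_imp_le) (rule sobolev_norm_nonneg)
qed

text \<open>Minkowski's inequality for finite index sets carries over because a sum of nonnegative
  terms is bounded as soon as its finite partial sums are.\<close>

lemma sobolev_norm_triangle:
  assumes u: "u \<in> sobolev s" and v: "v \<in> sobolev s" and uv: "(\<lambda>k. u k + v k) \<in> sobolev s"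
  shows "sobolev_norm s (\<lambda>k. u k + v k) \<le> sobolev_norm s u + sobolev_norm s v"
proof -
  let ?b = "sobolev_norm s u + sobolev_norm s v"
  have L2: "L2_set (\<lambda>k. sqrt (lam k powr s) * u k) F \<le> sobolev_norm s u"
    if "u \<in> sobolev s" "finite F" for u F
    unfolding L2_set_def using real_sqrt_le_mono[OF sobolev_partial_sum_le[OF that]]
    by (simp add: power_mult_distrib sobolev_norm_nonneg)
  have "(\<Sum>\<^sub>\<infinity>k. lam k powr s * (u k + v k)\<^sup>2) \<le> ?b\<^sup>2"
  proof (rule infsum_le_finite_sums)
    show "(\<lambda>k. lam k powr s * (u k + v k)\<^sup>2) summable_on UNIV" using uv by (simp add: sobolev_def)
    fix F :: "(int \<times> int) set" assume F: "finite F"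
    have "L2_set (\<lambda>k. sqrt (lam k powr s) * u k + sqrt (lam k powr s) * v k) F \<le> ?b"
      by (rule order_trans[OF L2_set_triangle_ineq add_mono[OF L2[OF u F] L2[OF v F]]])
    then have "sqrt (\<Sum>k\<in>F. lam k powr s * (u k + v k)\<^sup>2) \<le> ?b"
      by (simp add: L2_set_def distrib_left[symmetric] power_mult_distrib)
    then show "(\<Sum>k\<in>F. lam k powr s * (u k + v k)\<^sup>2) \<le> ?b\<^sup>2"
      by (rule sqrt_le_D)
  qed
  then show ?thesis
    unfolding sobolev_norm_def[of s "\<lambda>k. u k + v k"]
    by (intro real_le_lsqrt) (auto intro!: infsum_nonneg add_nonneg_nonneg sobolev_norm_nonneg)
qed

text \<open>The facts that describe \<open>mtopology\<close>, and with it the Borel sets of the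
  Sobolev space, become available once the axioms of a metric are verified.\<close>

lemma Metric_space_sobolev:
  "Metric_space (sobolev s) (\<lambda>u v. sobolev_norm s (\<lambda>k. u k - v k))"
proof
  fix x y z
  show "0 \<le> sobolev_norm s (\<lambda>k. x k - y k)" by (rule sobolev_norm_nonneg)
  show "sobolev_norm s (\<lambda>k. x k - y k) = sobolev_norm s (\<lambda>k. y k - x k)"
    by (simp add: sobolev_norm_def power2_commute)
  assume x: "x \<in> sobolev s" and y: "y \<in> sobolev s"
  show "sobolev_norm s (\<lambda>k. x k - y k) = 0 \<longleftrightarrow> x = y"
  proof
    assume 0: "sobolev_norm s (\<lambda>k. x k - y k) = 0"
    show "x = y"
    proof
      fix k
      have "sqrt (lam k powr s) * \<bar>x k - y k\<bar> \<le> 0"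
        using sobolev_coordinate_le[OF sobolev_diff[OF x y], of k] 0 by simp
      then show "x k = y k" using lam_ge_1[of k] by (auto simp: mult_le_0_iff)
    qed
  qed (simp add: sobolev_norm_def)
  assume z: "z \<in> sobolev s"
  show "sobolev_norm s (\<lambda>k. x k - z k) \<le> sobolev_norm s (\<lambda>k. x k - y k) + sobolev_norm s (\<lambda>k. y k - z k)"
    using sobolev_norm_triangle[OF sobolev_diff[OF x y] sobolev_diff[OF y z]] sobolev_diff[OF x z] by simp
qed

lemma openin_sobolev_topology_subset: "{U. openin (sobolev_topology s) U} \<subseteq> Pow (sobolev s)"
  using openin_subset Metric_space.topspace_mtopology[OF Metric_space_sobolev]
  by (fastforce simp: sobolev_topology_def)

lemma space_sobolev_borel: "space (sobolev_borel s) = sobolev s"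
  using openin_sobolev_topology_subset by (simp add: sobolev_borel_def space_measure_of)

lemma measurable_sobolev_coordinate: "(\<lambda>z. z k) \<in> borel_measurable (sobolev_borel s)"
proof (subst borel_measurable_iff_less, intro allI)
  fix a :: real
  let ?U = "{z \<in> sobolev s. z k < a}"
  let ?c = "sqrt (lam k powr s)"
  have c: "?c > 0" using lam_ge_1[of k] by simp
  interpret Metric_space "sobolev s" "\<lambda>u v. sobolev_norm s (\<lambda>k. u k - v k)" by (rule Metric_space_sobolev)
  have "openin (sobolev_topology s) ?U"
    unfolding sobolev_topology_def openin_mtopology
  proof (intro conjI allI impI)
    fix x assume x: "x \<in> ?U"
    \<comment> \<open>The coordinate is Lipschitz with constant \<open>1 / ?c\<close> by
      \<open>sobolev_coordinate_le\<close>, so this radius keeps \<open>y k\<close> below a.\<close>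
    have "mball x (?c * (a - x k)) \<subseteq> ?U"
    proof
      fix y assume "y \<in> mball x (?c * (a - x k))"
      then have y: "y \<in> sobolev s" and d: "sobolev_norm s (\<lambda>k. x k - y k) < ?c * (a - x k)" by auto
      have "?c * \<bar>x k - y k\<bar> < ?c * (a - x k)"
        using sobolev_coordinate_le[OF sobolev_diff[OF _ y], of x k] x d by auto
      then have "\<bar>x k - y k\<bar> < a - x k" using c by (simp only: mult_less_cancel_left_pos)
      then show "y \<in> ?U" using y by auto
    qed
    moreover have "?c * (a - x k) > 0" using x c by simp
    ultimately show "\<exists>r>0. mball x r \<subseteq> ?U" by blast
  qed auto
  then have "?U \<in> sets (sobolev_borel s)"
    using openin_sobolev_topology_subset by (auto simp: sobolev_borel_def)
  then show "{z \<in> space (sobolev_borel s). z k < a} \<in> sets (sobolev_borel s)"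
    by (simp add: space_sobolev_borel)
qed

section \<open>Closability along lines\<close>

lemma AE_lborel_exists_in_interval:
  fixes u v :: real
  assumes "AE t in lborel. P t" and "u < v"
  shows "\<exists>t\<in>{u<..<v}. P t"
proof (rule ccontr)
  assume "\<not> ?thesis"
  then have "AE t in lborel. t \<notin> {u<..<v}"
    using assms(1) by (auto elim!: eventually_mono)
  then have "emeasure lborel {u<..<v} = 0"
    by (subst (asm) AE_iff_null_sets[symmetric]) auto
  with assms(2) show False by simp
qed

text \<open>Exceptional points x are removed first, by right continuity of the tail integral. Then
  the positive and the negative part of h are densities of finite measures that agree on all rays,
  hence coincide; both parts are equal, so both vanish.\<close>

lemma AE_zero_if_tail_integrals_zero:
  fixes h :: "real \<Rightarrow> real"
  assumes int: "integrable lborel h"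
    and tail: "AE x in lborel. (\<integral>t. indicator {x<..} t * h t \<partial>lborel) = 0"
  shows "AE t in lborel. h t = 0"
proof -
  have [measurable]: "h \<in> borel_measurable borel" using int by auto
  have intx: "integrable lborel (\<lambda>t. indicator {x<..} t * h t)" for x :: real
    using integrable_real_mult_indicator[OF _ int, of "{x<..}"] by (simp add: mult.commute)
  have all: "(\<integral>t. indicator {x<..} t * h t \<partial>lborel) = 0" for x :: real
  proof -
    \<comment> \<open>Approaching x from the right makes the indicators of the rays converge at
      every t, including t = x.\<close>
    have "\<exists>s\<in>{x<..<x + 1 / real (Suc n)}. (\<integral>t. indicator {s<..} t * h t \<partial>lborel) = 0" for n
      by (rule AE_lborel_exists_in_interval[OF tail]) simp
    then obtain s where s: "\<And>n. s n \<in> {x<..<x + 1 / real (Suc n)}"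
      and s0: "\<And>n. (\<integral>t. indicator {s n<..} t * h t \<partial>lborel) = 0" by metis
    have slim: "s \<longlonglongrightarrow> x"
    proof (rule tendsto_sandwich[of "\<lambda>_. x" _ _ "\<lambda>n. x + 1 / real (Suc n)"])
      show "(\<lambda>n. x + 1 / real (Suc n)) \<longlonglongrightarrow> x"
        using tendsto_add[OF tendsto_const[of x] LIMSEQ_inverse_real_of_nat] by (simp add: field_simps)
    qed (use s in \<open>auto intro!: always_eventually simp: less_imp_le\<close>)
    have "(\<lambda>n. \<integral>t. indicator {s n<..} t * h t \<partial>lborel) \<longlonglongrightarrow> (\<integral>t. indicator {x<..} t * h t \<partial>lborel)"
    proof (rule integral_dominated_convergence[where w="\<lambda>t. \<bar>h t\<bar>"])
      show "AE t in lborel. (\<lambda>n. indicator {s n<..} t * h t) \<longlonglongrightarrow> indicator {x<..} t * h t"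
      proof (rule AE_I2)
        fix t
        have "eventually (\<lambda>n. indicator {s n<..} t = (indicator {x<..} t :: real)) sequentially"
        proof (cases "x < t")
          case True
          then show ?thesis
            using order_tendstoD(2)[OF slim True] by (auto elim!: eventually_mono)
        next
          case False
          then have "\<not> s n < t" for n using s[of n] by auto
          then show ?thesis using False by auto
        qed
        then have "(\<lambda>n. indicator {s n<..} t :: real) \<longlonglongrightarrow> indicator {x<..} t"
          by (rule tendsto_eventually)
        then show "(\<lambda>n. indicator {s n<..} t * h t) \<longlonglongrightarrow> indicator {x<..} t * h t"
          by (intro tendsto_intros)
      qed
    qed (use int in \<open>auto simp: indicator_def\<close>)
    then show ?thesis using s0 by (simp add: LIMSEQ_const_iff)
  qed
  \<comment> \<open>\<open>ennreal\<close> sends negative numbers to 0, so these are the positive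
    and the negative part of h.\<close>
  let ?p = "\<lambda>t. ennreal (h t)" and ?n = "\<lambda>t. ennreal (- h t)"
  have finp: "(\<integral>\<^sup>+t. ?p t \<partial>lborel) \<noteq> \<infinity>" and finn: "(\<integral>\<^sup>+t. ?n t \<partial>lborel) \<noteq> \<infinity>"
    using int by (auto simp: real_integrable_def)
  have "density lborel ?p = density lborel ?n"
  proof (rule measure_eqI_lessThan)
    fix x :: real
    have e: "emeasure (density lborel (\<lambda>t. ennreal (f t))) {x<..} =
        (\<integral>\<^sup>+t. ennreal (indicator {x<..} t * f t) \<partial>lborel)" if [measurable]: "f \<in> borel_measurable borel" for f :: "real \<Rightarrow> real"
      by (subst emeasure_density) (auto intro!: nn_integral_cong simp: indicator_def)
    show "emeasure (density lborel ?p) {x<..} < \<infinity>"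
    proof -
      have "emeasure (density lborel ?p) {x<..} \<le> (\<integral>\<^sup>+t. ?p t \<partial>lborel)"
        by (subst emeasure_density) (auto intro!: nn_integral_mono simp: indicator_def)
      then show ?thesis using finp by (auto simp: less_top top_unique)
    qed
    have 1: "(\<integral>\<^sup>+t. ennreal (indicator {x<..} t * h t) \<partial>lborel) \<noteq> \<infinity>"
      and 2: "(\<integral>\<^sup>+t. ennreal (- (indicator {x<..} t * h t)) \<partial>lborel) \<noteq> \<infinity>"
      using intx[of x] unfolding real_integrable_def by blast+
    have "enn2real (\<integral>\<^sup>+t. ennreal (indicator {x<..} t * h t) \<partial>lborel)
        = enn2real (\<integral>\<^sup>+t. ennreal (- (indicator {x<..} t * h t)) \<partial>lborel)"
      using real_lebesgue_integral_def[OF intx[of x]] all[of x] by simp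
    then have "(\<integral>\<^sup>+t. ennreal (indicator {x<..} t * h t) \<partial>lborel)
        = (\<integral>\<^sup>+t. ennreal (- (indicator {x<..} t * h t)) \<partial>lborel)"
      using ennreal_enn2real[of "\<integral>\<^sup>+t. ennreal (indicator {x<..} t * h t) \<partial>lborel"] 1
        ennreal_enn2real[of "\<integral>\<^sup>+t. ennreal (- (indicator {x<..} t * h t)) \<partial>lborel"] 2
      unfolding infinity_ennreal_def less_top[symmetric] by (metis less_top)
    then show "emeasure (density lborel ?p) {x<..} = emeasure (density lborel ?n) {x<..}"
      by (simp add: e)
  qed auto
  then have "AE t in lborel. ?p t = ?n t"
    by (subst (asm) finite_density_unique) (use finp in auto)
  then show ?thesis
  proof eventually_elim
    case (elim t)
    show ?case
    proof (cases "h t \<ge> 0")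
      case True
      then have "ennreal (- h t) = 0" by (simp add: ennreal_neg)
      with elim True show ?thesis by simp
    next
      case False
      then have "ennreal (h t) = 0" by (simp add: ennreal_neg)
      with elim False show ?thesis by simp
    qed
  qed
qed

lemma summable_increments_limit:
  fixes x :: "nat \<Rightarrow> real"
  assumes "\<And>j. \<bar>x (Suc j) - x j\<bar> \<le> c / 2 ^ j"
  shows "convergent x" and "\<bar>x j\<bar> \<le> \<bar>x 0\<bar> + 2 * c"
proof -
  have geo: "summable (\<lambda>j. c / 2 ^ j)" "(\<Sum>j. c / 2 ^ j) = 2 * c"
    using sums_mult[OF geometric_sums[of "1/2::real"], of c]
    by (auto simp: sums_iff power_one_over field_simps)
  have c: "c \<ge> 0" using assms[of 0] by auto
  have "summable (\<lambda>j. x (Suc j) - x j)"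
    by (rule summable_comparison_test[OF _ geo(1)]) (use assms in auto)
  then have "convergent (\<lambda>n. \<Sum>j<n. x (Suc j) - x j)" by (simp add: summable_iff_convergent)
  then have "convergent (\<lambda>n. (x n - x 0) + x 0)"
    by (intro convergent_add convergent_const) (simp add: sum_lessThan_telescope)
  then show "convergent x" by simp
  have "\<bar>x j - x 0\<bar> = \<bar>\<Sum>i<j. x (Suc i) - x i\<bar>" by (simp add: sum_lessThan_telescope)
  also have "\<dots> \<le> (\<Sum>i<j. c / 2 ^ i)" by (rule order_trans[OF sum_abs]) (intro sum_mono assms)
  also have "\<dots> \<le> 2 * c" unfolding geo(2)[symmetric] by (rule sum_le_suminf[OF geo(1)]) (use c in auto)
  finally show "\<bar>x j\<bar> \<le> \<bar>x 0\<bar> + 2 * c" by linarith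
qed

text \<open>The square root of m is traded for 1 + m. The resulting bound is linear in m and thus
  inherits local integrability from m.\<close>

lemma abs_le_if_scaled_square_le:
  fixes x m :: real
  assumes "4 ^ j * x\<^sup>2 \<le> m"
  shows "\<bar>x\<bar> \<le> (1 + m) / 2 ^ j"
proof -
  have "(2 ^ j * \<bar>x\<bar>)\<^sup>2 \<le> m"
    using assms by (simp add: power_mult_distrib power_mult[symmetric] mult.commute[of _ 2] power_mult)
  moreover have "y \<le> 1 + y\<^sup>2" for y :: real
    using zero_le_power2[of "y - 1 / 2"] by (simp add: power2_eq_square algebra_simps)
  ultimately have "2 ^ j * \<bar>x\<bar> \<le> 1 + m" by (meson add_left_mono order_trans)
  then show ?thesis by (simp add: field_simps)
qed

lemma ennreal_suminf_ge_term: "f j \<le> (\<Sum>i. f i :: ennreal)"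
  using sum_le_suminf[OF summableI, of "{j}" f] by simp

text \<open>Dividing by the local lower bound of q makes the sum \<open>M\<close> locally Lebesgue
  integrable. Where \<open>M\<close> is finite, \<open>f j\<close> tends to 0 and \<open>g j\<close>
  to some h geometrically, and all \<open>g j\<close> are dominated by one locally integrable
  function. Passing to the limit in the fundamental theorem of calculus, the increments of
  \<open>f j\<close> tend to 0, so all integrals of h between good points vanish.\<close>

lemma lines_closable:
  fixes f g :: "nat \<Rightarrow> real \<Rightarrow> real" and q :: "real \<Rightarrow> ennreal"
  assumes der: "\<And>j t. (f j has_real_derivative g j t) (at t)"
    and cont: "\<And>j. continuous_on UNIV (g j)"
    and q[measurable]: "q \<in> borel_measurable borel"
    and low: "\<And>R. \<exists>b>0. AE t in lborel. t \<in> {-R..R} \<longrightarrow> ennreal b \<le> q t"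
    and fin: "(\<integral>\<^sup>+t. (\<Sum>j. ennreal (4 ^ j * ((f j t)\<^sup>2 + (g (Suc j) t - g j t)\<^sup>2))) * q t \<partial>lborel) < \<infinity>"
  shows "AE t in lborel. (\<lambda>j. g j t) \<longlonglongrightarrow> 0"
proof -
  have [measurable]: "g j \<in> borel_measurable borel" for j
    by (rule borel_measurable_continuous_onI[OF cont])
  have "continuous_on UNIV (f j)" for j
    using der by (intro continuous_at_imp_continuous_on ballI) (rule DERIV_isCont)
  then have [measurable]: "f j \<in> borel_measurable borel" for j
    by (rule borel_measurable_continuous_onI)
  define M where "M t = (\<Sum>j. ennreal (4 ^ j * ((f j t)\<^sup>2 + (g (Suc j) t - g j t)\<^sup>2)))" for t
  have [measurable]: "M \<in> borel_measurable borel" unfolding M_def by measurable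
  have loc: "(\<integral>\<^sup>+t. M t * indicator {-R..R} t \<partial>lborel) < \<infinity>" for R
  proof -
    obtain b where b: "b > 0" "AE t in lborel. t \<in> {-R..R} \<longrightarrow> ennreal b \<le> q t" using low by blast
    have "ennreal b * (\<integral>\<^sup>+t. M t * indicator {-R..R} t \<partial>lborel) = (\<integral>\<^sup>+t. ennreal b * (M t * indicator {-R..R} t) \<partial>lborel)"
      by (subst nn_integral_cmult) auto
    also have "\<dots> \<le> (\<integral>\<^sup>+t. M t * q t \<partial>lborel)"
      by (rule nn_integral_mono_AE, use b(2) in eventually_elim)
        (auto simp: indicator_def mult.commute[of "M _"] intro: mult_right_mono)
    also have "\<dots> < \<infinity>" using fin by (simp add: M_def)
    finally show ?thesis using b(1) by (auto simp: ennreal_mult_less_top)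
  qed
  have Mfin: "AE t in lborel. M t < \<infinity>"
  proof -
    have "AE t in lborel. \<forall>n. M t * indicator {- real n..real n} t \<noteq> \<infinity>"
      unfolding AE_all_countable
    proof
      fix n show "AE t in lborel. M t * indicator {- real n..real n} t \<noteq> \<infinity>"
        by (rule nn_integral_PInf_AE) (use loc[of "real n"] in auto)
    qed
    then show ?thesis
    proof eventually_elim
      case (elim t)
      obtain n where "\<bar>t\<bar> \<le> real n" using real_arch_simple by blast
      then have "indicator {- real n..real n} t = (1::ennreal)" by (auto simp: indicator_def)
      with spec[OF elim, of n] show ?case by (simp add: less_top)
    qed
  qed
  define m where "m t = enn2real (M t)" for t
  have [measurable]: "m \<in> borel_measurable borel" unfolding m_def by measurable
  have m0: "m t \<ge> 0" for t by (simp add: m_def)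
  have dom4: "4 ^ j * ((f j t)\<^sup>2 + (g (Suc j) t - g j t)\<^sup>2) \<le> m t" if "M t < \<infinity>" for j t
  proof -
    have "ennreal (4 ^ j * ((f j t)\<^sup>2 + (g (Suc j) t - g j t)\<^sup>2)) \<le> M t"
      unfolding M_def by (rule ennreal_suminf_ge_term)
    also have "M t = ennreal (m t)" using that by (simp add: m_def)
    finally show ?thesis using m0 by (simp add: ennreal_le_iff)
  qed
  have fb: "\<bar>f j t\<bar> \<le> (1 + m t) / 2 ^ j" and gb: "\<bar>g (Suc j) t - g j t\<bar> \<le> (1 + m t) / 2 ^ j"
    if "M t < \<infinity>" for j t
  proof -
    have "4 ^ j * (f j t)\<^sup>2 \<le> m t" "4 ^ j * (g (Suc j) t - g j t)\<^sup>2 \<le> m t"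
      using dom4[OF that, of j] zero_le_power2[of "f j t"] zero_le_power2[of "g (Suc j) t - g j t"]
      by (auto simp: distrib_left elim!: order_trans[rotated])
    then show "\<bar>f j t\<bar> \<le> (1 + m t) / 2 ^ j" "\<bar>g (Suc j) t - g j t\<bar> \<le> (1 + m t) / 2 ^ j"
      by (auto intro: abs_le_if_scaled_square_le)
  qed
  have f0: "(\<lambda>j. f j t) \<longlonglongrightarrow> 0" if "M t < \<infinity>" for t
  proof (rule Lim_null_comparison)
    show "eventually (\<lambda>j. norm (f j t) \<le> (1 + m t) / 2 ^ j) sequentially" using fb[OF that] by simp
    show "(\<lambda>j. (1 + m t) / 2 ^ j) \<longlonglongrightarrow> 0"
      using tendsto_mult_right_zero[OF LIMSEQ_power_zero[of "1/2::real"], of "1 + m t"]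
      by (simp add: power_one_over field_simps)
  qed
  define h where "h t = lim (\<lambda>j. g j t)" for t
  have [measurable]: "h \<in> borel_measurable borel" unfolding h_def by measurable
  have gh: "(\<lambda>j. g j t) \<longlonglongrightarrow> h t" if "M t < \<infinity>" for t
    unfolding h_def using summable_increments_limit(1)[of "\<lambda>j. g j t"] gb[OF that] convergent_LIMSEQ_iff by blast
  have gdom: "\<bar>g j t\<bar> \<le> \<bar>g 0 t\<bar> + 2 * (1 + m t)" if "M t < \<infinity>" for j t
    using summable_increments_limit(2)[of "\<lambda>j. g j t"] gb[OF that] by blast
  have intm: "integrable lborel (\<lambda>t. indicator {-R..R} t * (\<bar>g 0 t\<bar> + 2 * (1 + m t)))" for R :: real
  proof -
    have 1: "integrable lborel (\<lambda>t. indicator {-R..R} t * (\<bar>g 0 t\<bar> + 2))"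
    proof -
      have "continuous_on {-R..R} (\<lambda>t. \<bar>g 0 t\<bar> + 2)"
        by (intro continuous_intros continuous_on_subset[OF cont[of 0]]) simp
      then show ?thesis using borel_integrable_compact[of "{-R..R}" "\<lambda>t. \<bar>g 0 t\<bar> + 2"] by simp
    qed
    have 2: "integrable lborel (\<lambda>t. indicator {-R..R} t * m t)"
    proof (rule integrableI_bounded)
      have "(\<integral>\<^sup>+t. ennreal (norm (indicator {-R..R} t * m t)) \<partial>lborel) = (\<integral>\<^sup>+t. M t * indicator {-R..R} t \<partial>lborel)"
        by (rule nn_integral_cong_AE, use Mfin in eventually_elim) (auto simp: m_def indicator_def)
      then show "(\<integral>\<^sup>+t. ennreal (norm (indicator {-R..R} t * m t)) \<partial>lborel) < \<infinity>" using loc[of R] by simp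
    qed simp
    show ?thesis
      using Bochner_Integration.integrable_add[OF 1 integrable_mult_right[OF 2, of 2]] by (simp add: algebra_simps)
  qed
  have "AE t in lborel. t \<in> {- real n..real n} \<longrightarrow> h t = 0" for n
  proof -
    \<comment> \<open>Endpoints of integration must be points where \<open>f j\<close> tends to 0,
      so points with \<open>M\<close> finite are chosen just outside [-n, n].\<close>
    obtain s where s: "s \<in> {- real n - 1<..<- real n}" "M s < \<infinity>"
      using AE_lborel_exists_in_interval[OF Mfin, of "- real n - 1" "- real n"] by auto
    obtain b where b: "b \<in> {real n<..<real n + 1}" "M b < \<infinity>"
      using AE_lborel_exists_in_interval[OF Mfin, of "real n" "real n + 1"] by auto
    have dom: "integrable lborel (\<lambda>t. indicator {s..b} t * (\<bar>g 0 t\<bar> + 2 * (1 + m t)))"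
    proof (rule Bochner_Integration.integrable_bound[OF intm[of "real n + 1"]])
      show "AE t in lborel. norm (indicator {s..b} t * (\<bar>g 0 t\<bar> + 2 * (1 + m t)))
         \<le> norm (indicator {- (real n + 1)..real n + 1} t * (\<bar>g 0 t\<bar> + 2 * (1 + m t)))"
        using s b by (auto simp: indicator_def)
    qed simp
    have zero: "(\<integral>t. indicator {x..b} t * h t \<partial>lborel) = 0" if x: "s \<le> x" "x \<le> b" "M x < \<infinity>" for x
    proof -
      have "(\<lambda>j. \<integral>t. indicator {x..b} t * g j t \<partial>lborel) \<longlonglongrightarrow> (\<integral>t. indicator {x..b} t * h t \<partial>lborel)"
      proof (rule integral_dominated_convergence[OF _ _ dom])
        show "AE t in lborel. (\<lambda>j. indicator {x..b} t * g j t) \<longlonglongrightarrow> indicator {x..b} t * h t"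
          using Mfin by eventually_elim (intro tendsto_intros gh)
        show "AE t in lborel. norm (indicator {x..b} t * g j t) \<le> indicator {s..b} t * (\<bar>g 0 t\<bar> + 2 * (1 + m t))" for j
          using Mfin by eventually_elim (use x gdom m0 in \<open>auto simp: indicator_def\<close>)
      qed simp_all
      moreover have "(\<integral>t. indicator {x..b} t * g j t \<partial>lborel) = f j b - f j x" for j
        using integral_FTC_Icc_real[OF x(2), of "f j" "g j"] der cont[of j]
        by (auto simp: mult.commute continuous_on_eq_continuous_at)
      moreover have "(\<lambda>j. f j b - f j x) \<longlonglongrightarrow> 0 - 0" by (intro tendsto_diff f0 x b)
      ultimately show ?thesis using LIMSEQ_unique by fastforce
    qed
    have hint: "integrable lborel (\<lambda>t. indicator {s..b} t * h t)"
    proof (rule Bochner_Integration.integrable_bound[OF dom])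
      show "AE t in lborel. norm (indicator {s..b} t * h t) \<le> norm (indicator {s..b} t * (\<bar>g 0 t\<bar> + 2 * (1 + m t)))"
        using Mfin
      proof eventually_elim
        case (elim t)
        have "\<bar>h t\<bar> \<le> \<bar>g 0 t\<bar> + 2 * (1 + m t)"
          by (rule tendsto_upperbound[OF tendsto_rabs[OF gh[OF elim]]]) (use gdom[OF elim] in auto)
        then show ?case by (auto simp: indicator_def)
      qed
    qed simp
    have "AE t in lborel. indicator {s..b} t * h t = 0"
    proof (rule AE_zero_if_tail_integrals_zero[OF hint])
      show "AE x in lborel. (\<integral>t. indicator {x<..} t * (indicator {s..b} t * h t) \<partial>lborel) = 0"
        using Mfin
      proof eventually_elim
        case (elim x)
        \<comment> \<open>Left of s the tail integral is the full integral over [s, b], right of b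
          it is empty, and in between it is an integral from x to b, where x is good for almost
          every x.\<close>
        consider "x < s" | "s \<le> x" "x \<le> b" | "b < x" by linarith
        then show ?case
        proof cases
          case 1
          then have "(\<integral>t. indicator {x<..} t * (indicator {s..b} t * h t) \<partial>lborel) = (\<integral>t. indicator {s..b} t * h t \<partial>lborel)"
            by (intro Bochner_Integration.integral_cong) (auto simp: indicator_def)
          then show ?thesis using zero[of s] s b by auto
        next
          case 2
          have "(\<integral>t. indicator {x<..} t * (indicator {s..b} t * h t) \<partial>lborel) = (\<integral>t. indicator {x..b} t * h t \<partial>lborel)"
          proof (rule integral_cong_AE)
            show "AE t in lborel. indicator {x<..} t * (indicator {s..b} t * h t) = indicator {x..b} t * h t"
              using AE_lborel_singleton[of x] by eventually_elim (use 2 in \<open>auto simp: indicator_def\<close>)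
          qed simp_all
          then show ?thesis using zero[OF 2 elim] by simp
        next
          case 3
          then have "(\<lambda>t. indicator {x<..} t * (indicator {s..b} t * h t)) = (\<lambda>_. 0)"
            by (auto simp: indicator_def)
          then show ?thesis by simp
        qed
      qed
    qed
    then show ?thesis by eventually_elim (use s b in \<open>auto simp: indicator_def split: if_splits\<close>)
  qed
  then have "AE t in lborel. \<forall>n. t \<in> {- real n..real n} \<longrightarrow> h t = 0"
    unfolding AE_all_countable by blast
  with Mfin show ?thesis
  proof eventually_elim
    case (elim t)
    obtain n where "\<bar>t\<bar> \<le> real n" using real_arch_simple by blast
    then have "t \<in> {- real n..real n}" by auto
    then have "h t = 0" using elim(2) by blast
    with gh[OF elim(1)] show ?case by simp
  qed
qed

text \<open>In place of Cauchy-Schwarz, |g| \<le> 1 + g^2 is integrated over [-R, R]. The bound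
  depends on f only through the energy bound L, so it is common to all functions with that
  bound.\<close>

lemma oscillation_bound:
  fixes f g :: "real \<Rightarrow> real"
  assumes der: "\<And>t. (f has_real_derivative g t) (at t)" and cont: "continuous_on UNIV g"
    and L: "(\<integral>\<^sup>+t. ennreal ((g t)\<^sup>2) * indicator {-R..R} t \<partial>lborel) \<le> ennreal L" "0 \<le> L"
    and st: "s \<in> {-R..R}" "t \<in> {-R..R}"
  shows "\<bar>f t - f s\<bar> \<le> 2 * R + L"
proof -
  have *: "\<bar>f t - f s\<bar> \<le> 2 * R + L" if st: "-R \<le> s" "s \<le> t" "t \<le> R" for s t
  proof -
    have c: "continuous_on A g" for A using continuous_on_subset[OF cont] by auto
    have i: "integrable lborel (\<lambda>r. g r * indicator {s..t} r)"
      using borel_integrable_compact[OF _ c, of "{s..t}"] by (simp add: mult.commute)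
    have i2: "integrable lborel (\<lambda>r. (g r)\<^sup>2 * indicator {-R..R} r)"
      using borel_integrable_compact[of "{-R..R}" "\<lambda>r. (g r)\<^sup>2"] c by (simp add: mult.commute continuous_on_power)
    have "(\<integral>\<^sup>+r. ennreal ((g r)\<^sup>2 * indicator {-R..R} r) \<partial>lborel) \<le> ennreal L"
      using L(1) by (simp add: ennreal_mult' ennreal_indicator)
    then have le: "(\<integral>r. (g r)\<^sup>2 * indicator {-R..R} r \<partial>lborel) \<le> L"
      using L(2) by (subst (asm) nn_integral_eq_integral[OF i2]) auto
    have i1: "integrable lborel (\<lambda>r. indicator {-R..R} r :: real)"
      by (rule integrable_real_indicator) (auto simp: emeasure_lborel_Icc_eq)
    have "f t - f s = (\<integral>r. g r * indicator {s..t} r \<partial>lborel)"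
      using integral_FTC_Icc_real[OF st(2), of f g] der cont by (auto simp: continuous_on_eq_continuous_at)
    also have "\<bar>\<dots>\<bar> \<le> (\<integral>r. indicator {-R..R} r + (g r)\<^sup>2 * indicator {-R..R} r \<partial>lborel)"
    proof (rule integral_abs_bound_integral)
      fix r
      have "\<bar>y\<bar> \<le> 1 + y\<^sup>2" for y :: real using abs_le_if_scaled_square_le[of 0 y "y\<^sup>2"] by simp
      then show "\<bar>g r * indicator {s..t} r\<bar> \<le> indicator {-R..R} r + (g r)\<^sup>2 * indicator {-R..R} r"
        using st by (auto simp: indicator_def)
    qed (use i i1 i2 in auto)
    also have "\<dots> \<le> 2 * R + L" using le st by (subst Bochner_Integration.integral_add[OF i1 i2]) auto
    finally show ?thesis .
  qed
  show ?thesis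
    using *[of s t] *[of t s] st by (cases "s \<le> t") (auto simp: abs_minus_commute)
qed

text \<open>The interface between the product structure of the field and the one-dimensional
  arguments: \<nu> is a mixture over y of the images of p(t) dt under t \<mapsto>
  \<open>\<Phi> y t\<close>. Continuity and positivity give p a positive lower bound on every
  bounded interval (\<open>p_lower\<close>), so locally p dt dominates a multiple of Lebesgue
  measure.\<close>

locale fibred_measure =
  fixes \<nu> :: "'a measure" and Q :: "'b measure" and \<Phi> :: "'b \<Rightarrow> real \<Rightarrow> 'a" and p :: "real \<Rightarrow> real"
  assumes Phi_measurable[measurable]: "(\<lambda>(y, t). \<Phi> y t) \<in> Q \<Otimes>\<^sub>M borel \<rightarrow>\<^sub>M \<nu>"
    and p_cont: "continuous_on UNIV p"
    and p_pos: "\<And>t. 0 < p t"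
    and disintegration: "\<And>h. h \<in> borel_measurable \<nu> \<Longrightarrow>
      (\<integral>\<^sup>+x. h x \<partial>\<nu>) = (\<integral>\<^sup>+y. (\<integral>\<^sup>+t. h (\<Phi> y t) * ennreal (p t) \<partial>lborel) \<partial>Q)"
begin

lemma p_measurable[measurable]: "p \<in> borel_measurable borel"
  by (rule borel_measurable_continuous_onI[OF p_cont])

lemma Phi_fibre: "y \<in> space Q \<Longrightarrow> \<Phi> y \<in> borel \<rightarrow>\<^sub>M \<nu>"
  using measurable_compose[OF measurable_Pair1' Phi_measurable] by simp

lemma p_lower: "\<exists>b>0. \<forall>t\<in>{-R..R}. b \<le> p t"
proof (cases "{-R..R} = {}")
  case True
  then show ?thesis by (auto intro!: exI[of _ 1])
next
  case False
  then obtain s where "s \<in> {-R..R}" "\<forall>t\<in>{-R..R}. p s \<le> p t"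
    using continuous_attains_inf[of "{-R..R}" p] continuous_on_subset[OF p_cont] by auto
  then show ?thesis using p_pos[of s] by auto
qed

text \<open>Because p is positive, a set that is null for p dt is null for Lebesgue measure as
  well.\<close>

lemma AE_fibres:
  assumes "AE x in \<nu>. P x"
  shows "AE y in Q. AE t in lborel. P (\<Phi> y t)"
proof -
  obtain N where N: "{x \<in> space \<nu>. \<not> P x} \<subseteq> N" "emeasure \<nu> N = 0" "N \<in> sets \<nu>"
    using AE_E[OF assms] by blast
  note [measurable] = N(3)
  have "(\<integral>\<^sup>+y. (\<integral>\<^sup>+t. indicator N (\<Phi> y t) * ennreal (p t) \<partial>lborel) \<partial>Q) = 0"
    using disintegration[of "indicator N"] N by simp
  then have "AE y in Q. (\<integral>\<^sup>+t. indicator N (\<Phi> y t) * ennreal (p t) \<partial>lborel) = 0"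
    by (subst (asm) nn_integral_0_iff_AE) auto
  with AE_space show ?thesis
  proof eventually_elim
    case (elim y)
    note [measurable] = Phi_fibre[OF elim(1)]
    have "AE t in lborel. indicator N (\<Phi> y t) * ennreal (p t) = 0"
      using elim(2) by (subst (asm) nn_integral_0_iff_AE) auto
    then show ?case
    proof eventually_elim
      case (elim t)
      have "\<Phi> y t \<in> space \<nu>" using Phi_fibre[OF \<open>y \<in> space Q\<close>] by (auto simp: measurable_def)
      then show ?case using elim N(1) p_pos[of t] by (auto simp: indicator_def split: if_splits)
    qed
  qed
qed

text \<open>Measurability of the good set is assumed because the disintegration evaluates measurable
  functions only.\<close>

lemma AE_from_fibres:
  assumes [measurable]: "{x \<in> space \<nu>. P x} \<in> sets \<nu>"
    and "AE y in Q. AE t in lborel. P (\<Phi> y t)"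
  shows "AE x in \<nu>. P x"
proof -
  let ?N = "space \<nu> - {x \<in> space \<nu>. P x}"
  have "emeasure \<nu> ?N = (\<integral>\<^sup>+y. (\<integral>\<^sup>+t. indicator ?N (\<Phi> y t) * ennreal (p t) \<partial>lborel) \<partial>Q)"
    using disintegration[of "indicator ?N"] by simp
  also have "\<dots> = (\<integral>\<^sup>+y. 0 \<partial>Q)"
  proof (rule nn_integral_cong_AE)
    show "AE y in Q. (\<integral>\<^sup>+t. indicator ?N (\<Phi> y t) * ennreal (p t) \<partial>lborel) = 0"
      using assms(2)
    proof eventually_elim
      case (elim y)
      have "(\<integral>\<^sup>+t. indicator ?N (\<Phi> y t) * ennreal (p t) \<partial>lborel) = (\<integral>\<^sup>+t. 0 \<partial>(lborel :: real measure))"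
        by (rule nn_integral_cong_AE, use elim in eventually_elim) (auto simp: indicator_def)
      then show ?case by simp
    qed
  qed
  finally have "emeasure \<nu> ?N = 0" by simp
  then show ?thesis by (intro AE_I[of _ _ ?N]) auto
qed

text \<open>By Fatou the lower limit of the energies is finite on almost every fibre. The infinitely
  many n with small energy depend on the fibre; since the whole sequence \<open>W n\<close>
  converges almost everywhere, a bound that holds for infinitely many n still passes to
  \<open>V\<close>.\<close>

lemma limit_locally_bounded_on_fibres:
  fixes W DW :: "nat \<Rightarrow> 'a \<Rightarrow> real"
  assumes DW[measurable]: "\<And>n. DW n \<in> borel_measurable \<nu>"
    and der: "\<And>n y t. ((\<lambda>t. W n (\<Phi> y t)) has_real_derivative DW n (\<Phi> y t)) (at t)"
    and cont: "\<And>n y. continuous_on UNIV (\<lambda>t. DW n (\<Phi> y t))"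
    and bound: "\<And>n. (\<integral>\<^sup>+x. ennreal ((DW n x)\<^sup>2) \<partial>\<nu>) \<le> C" and C: "C < \<infinity>"
    and conv: "AE x in \<nu>. (\<lambda>n. W n x) \<longlonglongrightarrow> V x"
  shows "AE y in Q. \<forall>R. \<exists>B. AE t in lborel. t \<in> {-R..R} \<longrightarrow> \<bar>V (\<Phi> y t)\<bar> \<le> B"
proof -
  let ?I = "\<lambda>n y. \<integral>\<^sup>+t. ennreal ((DW n (\<Phi> y t))\<^sup>2) * ennreal (p t) \<partial>lborel"
  have "(\<integral>\<^sup>+y. liminf (\<lambda>n. ?I n y) \<partial>Q) \<le> liminf (\<lambda>n. \<integral>\<^sup>+y. ?I n y \<partial>Q)"
    by (rule nn_integral_liminf) measurable
  also have "\<dots> \<le> C"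
  proof -
    have "(\<integral>\<^sup>+y. ?I n y \<partial>Q) \<le> C" for n
      using bound[of n] disintegration[of "\<lambda>x. ennreal ((DW n x)\<^sup>2)"] by simp
    then have "liminf (\<lambda>n. \<integral>\<^sup>+y. ?I n y \<partial>Q) \<le> liminf (\<lambda>n. C)" by (intro Liminf_mono) auto
    then show ?thesis by (simp add: Liminf_const)
  qed
  finally have "(\<integral>\<^sup>+y. liminf (\<lambda>n. ?I n y) \<partial>Q) \<noteq> \<infinity>" using C by auto
  then have "AE y in Q. liminf (\<lambda>n. ?I n y) \<noteq> \<infinity>" by (rule nn_integral_PInf_AE[rotated]) measurable
  with AE_fibres[OF conv] AE_space show ?thesis
  proof eventually_elim
    case (elim y)
    note [measurable] = Phi_fibre[OF elim(2)]
    obtain L where L: "0 \<le> L" "liminf (\<lambda>n. ?I n y) < ennreal L"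
    proof
      show "0 \<le> enn2real (liminf (\<lambda>n. ?I n y)) + 1" by simp
      have "liminf (\<lambda>n. ?I n y) = ennreal (enn2real (liminf (\<lambda>n. ?I n y)))"
        using elim(3) by (simp add: less_top)
      also have "\<dots> < ennreal (enn2real (liminf (\<lambda>n. ?I n y)) + 1)"
        by (rule ennreal_lessI) (simp_all add: add_nonneg_pos)
      finally show "liminf (\<lambda>n. ?I n y) < ennreal (enn2real (liminf (\<lambda>n. ?I n y)) + 1)" .
    qed
    have freq: "\<exists>\<^sub>F n in sequentially. ?I n y < ennreal L"
    proof (rule ccontr)
      assume "\<not> ?thesis"
      then have "\<forall>\<^sub>F n in sequentially. ennreal L \<le> ?I n y" by (simp add: not_frequently not_less)
      then have "ennreal L \<le> liminf (\<lambda>n. ?I n y)" by (rule Liminf_bounded)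
      with L show False by simp
    qed
    show ?case
    proof
      fix R :: real
      show "\<exists>B. AE t in lborel. t \<in> {-R..R} \<longrightarrow> \<bar>V (\<Phi> y t)\<bar> \<le> B"
      proof (cases "0 < R")
        case False
        \<comment> \<open>For R \<le> 0 the interval has at most one point, so it is a null
          set.\<close>
        have "AE t in lborel. t \<in> {-R..R} \<longrightarrow> \<bar>V (\<Phi> y t)\<bar> \<le> 0"
          using AE_lborel_singleton[of R] by eventually_elim (use False in auto)
        then show ?thesis by blast
      next
        case True
        obtain b where b: "b > 0" "\<And>t. t \<in> {-R..R} \<Longrightarrow> b \<le> p t" using p_lower[of R] by blast
        obtain t0 where t0: "t0 \<in> {-R<..<R}" "(\<lambda>n. W n (\<Phi> y t0)) \<longlonglongrightarrow> V (\<Phi> y t0)"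
          using AE_lborel_exists_in_interval[OF elim(1), of "-R" R] True by auto
        \<comment> \<open>At the anchor \<open>t0\<close> the functions \<open>W n\<close> converge,
          so eventually they exceed |V| there by at most 1. The rest is the oscillation: since p
          \<ge> b, energy below L with weight p means Lebesgue energy at most L / b.\<close>
        define B where "B = \<bar>V (\<Phi> y t0)\<bar> + 1 + (2 * R + L / b)"
        have osc: "\<bar>W n (\<Phi> y t) - W n (\<Phi> y t0)\<bar> \<le> 2 * R + L / b"
          if I: "?I n y < ennreal L" and t: "t \<in> {-R..R}" for n t
        proof (rule oscillation_bound[OF der cont])
          have "ennreal b * (\<integral>\<^sup>+t. ennreal ((DW n (\<Phi> y t))\<^sup>2) * indicator {-R..R} t \<partial>lborel)
              = (\<integral>\<^sup>+t. ennreal b * (ennreal ((DW n (\<Phi> y t))\<^sup>2) * indicator {-R..R} t) \<partial>lborel)"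
            by (subst nn_integral_cmult) auto
          also have "\<dots> \<le> ?I n y"
            by (intro nn_integral_mono) (use b in \<open>auto simp: indicator_def mult.commute[of "ennreal b"]
                intro!: mult_left_mono ennreal_leI\<close>)
          also have "\<dots> \<le> ennreal L" using I by simp
          finally have "inverse (ennreal b) * (ennreal b * (\<integral>\<^sup>+t. ennreal ((DW n (\<Phi> y t))\<^sup>2) * indicator {-R..R} t \<partial>lborel))
              \<le> inverse (ennreal b) * ennreal L" by (rule mult_left_mono) simp
          moreover have "inverse (ennreal b) * ennreal b = 1"
            using b by (simp add: inverse_ennreal ennreal_mult[symmetric])
          moreover have "inverse (ennreal b) * ennreal L = ennreal (L / b)"
            using b L by (simp add: inverse_ennreal ennreal_mult[symmetric] field_simps)
          ultimately show "(\<integral>\<^sup>+t. ennreal ((DW n (\<Phi> y t))\<^sup>2) * indicator {-R..R} t \<partial>lborel) \<le> ennreal (L / b)"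
            by (simp add: mult.assoc[symmetric])
        qed (use b L t t0 in auto)
        have ev: "\<forall>\<^sub>F n in sequentially. \<bar>W n (\<Phi> y t0)\<bar> \<le> \<bar>V (\<Phi> y t0)\<bar> + 1"
        proof -
          have "\<forall>\<^sub>F n in sequentially. \<bar>W n (\<Phi> y t0)\<bar> < \<bar>V (\<Phi> y t0)\<bar> + 1"
            by (rule order_tendstoD(2)[OF tendsto_rabs[OF t0(2)]]) simp
          then show ?thesis by eventually_elim simp
        qed
        have bd: "\<exists>\<^sub>F n in sequentially. \<bar>W n (\<Phi> y t)\<bar> \<le> B" if t: "t \<in> {-R..R}" for t
          using frequently_eventually_frequently[OF freq ev]
        proof (rule frequently_elim1)
          fix n assume "?I n y < ennreal L \<and> \<bar>W n (\<Phi> y t0)\<bar> \<le> \<bar>V (\<Phi> y t0)\<bar> + 1"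
          then show "\<bar>W n (\<Phi> y t)\<bar> \<le> B" using osc[OF _ t, of n] unfolding B_def by linarith
        qed
        have "AE t in lborel. t \<in> {-R..R} \<longrightarrow> \<bar>V (\<Phi> y t)\<bar> \<le> B"
          using elim(1)
        proof eventually_elim
          case (elim t)
          show ?case
          proof (intro impI, rule ccontr)
            \<comment> \<open>If |V| were larger than B, then |W n| would be so for all large n,
              whereas it is at most B infinitely often.\<close>
            assume t: "t \<in> {-R..R}" and "\<not> \<bar>V (\<Phi> y t)\<bar> \<le> B"
            then have "\<forall>\<^sub>F n in sequentially. B < \<bar>W n (\<Phi> y t)\<bar>"
              by (intro order_tendstoD(1)[OF tendsto_rabs[OF elim]]) simp
            with bd[OF t] show False
              by (simp add: frequently_def not_le)
          qed
        qed
        then show ?thesis by blast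
      qed
    qed
  qed
qed

text \<open>Along a fast subsequence r the sum \<open>T\<close> is \<kappa>-integrable, so on almost
  every fibre \<open>lines_closable\<close> applies with the fibre density of \<kappa>, which is
  bounded below where \<open>V\<close> is bounded. Hence \<open>G (r j)\<close> tends to 0 almost
  everywhere. The Cauchy property then upgrades this to convergence of the full sequence in
  L2.\<close>

lemma derivative_closable:
  fixes F G :: "nat \<Rightarrow> 'a \<Rightarrow> real" and V :: "'a \<Rightarrow> real"
  assumes F[measurable]: "\<And>n. F n \<in> borel_measurable \<nu>" and G[measurable]: "\<And>n. G n \<in> borel_measurable \<nu>"
    and V[measurable]: "V \<in> borel_measurable \<nu>"
    and der: "\<And>n y t. ((\<lambda>t. F n (\<Phi> y t)) has_real_derivative G n (\<Phi> y t)) (at t)"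
    and cont: "\<And>n y. continuous_on UNIV (\<lambda>t. G n (\<Phi> y t))"
    and Vb: "AE y in Q. \<forall>R. \<exists>B. AE t in lborel. t \<in> {-R..R} \<longrightarrow> \<bar>V (\<Phi> y t)\<bar> \<le> B"
    and c: "0 < c"
    and \<kappa>: "\<kappa> = density \<nu> (\<lambda>x. ennreal (c * exp (- V x)))"
    and F0: "(\<lambda>n. \<integral>\<^sup>+x. ennreal ((F n x)\<^sup>2) \<partial>\<kappa>) \<longlonglongrightarrow> 0"
    and cauchy: "\<And>\<epsilon>. \<epsilon> > 0 \<Longrightarrow> \<exists>N. \<forall>m\<ge>N. \<forall>n\<ge>N. (\<integral>\<^sup>+x. ennreal ((G m x - G n x)\<^sup>2) \<partial>\<kappa>) < ennreal \<epsilon>"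
  shows "(\<lambda>n. \<integral>\<^sup>+x. ennreal ((G n x)\<^sup>2) \<partial>\<kappa>) \<longlonglongrightarrow> 0"
proof -
  have sets_\<kappa>[measurable_cong]: "sets \<kappa> = sets \<nu>" by (simp add: \<kappa>)
  have "\<exists>r. strict_mono r \<and> (\<forall>j. (\<integral>\<^sup>+x. ennreal ((F (r j) x)\<^sup>2) \<partial>\<kappa>) < ennreal (1 / 8 ^ j) \<and>
      (\<forall>n\<ge>r j. (\<integral>\<^sup>+x. ennreal ((G n x - G (r j) x)\<^sup>2) \<partial>\<kappa>) < ennreal (1 / 8 ^ j)))"
  proof -
    have ex: "\<exists>m>k. (\<integral>\<^sup>+x. ennreal ((F m x)\<^sup>2) \<partial>\<kappa>) < ennreal (1 / 8 ^ j) \<and>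
      (\<forall>n\<ge>m. (\<integral>\<^sup>+x. ennreal ((G n x - G m x)\<^sup>2) \<partial>\<kappa>) < ennreal (1 / 8 ^ j))" for j k :: nat
    proof -
      obtain N1 where N1: "\<And>n. n \<ge> N1 \<Longrightarrow> (\<integral>\<^sup>+x. ennreal ((F n x)\<^sup>2) \<partial>\<kappa>) < ennreal (1 / 8 ^ j)"
        using order_tendstoD(2)[OF F0, of "ennreal (1 / 8 ^ j)"] by (auto simp: eventually_sequentially)
      obtain N2 where N2: "\<And>m n. m \<ge> N2 \<Longrightarrow> n \<ge> N2 \<Longrightarrow> (\<integral>\<^sup>+x. ennreal ((G m x - G n x)\<^sup>2) \<partial>\<kappa>) < ennreal (1 / 8 ^ j)"
        using cauchy[of "1 / 8 ^ j"] by auto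
      show ?thesis
        by (rule exI[of _ "Suc k + N1 + N2"]) (use N1 N2 in auto)
    qed
    let ?P = "\<lambda>j m. (\<integral>\<^sup>+x. ennreal ((F m x)\<^sup>2) \<partial>\<kappa>) < ennreal (1 / 8 ^ j) \<and>
      (\<forall>n\<ge>m. (\<integral>\<^sup>+x. ennreal ((G n x - G m x)\<^sup>2) \<partial>\<kappa>) < ennreal (1 / 8 ^ j))"
    have "\<exists>r. \<forall>j. ?P j (r j) \<and> r j < r (Suc j)"
    proof (rule dependent_nat_choice)
      show "\<exists>m. ?P 0 m" using ex[of 0 0] by blast
      show "\<exists>m'. ?P (Suc j) m' \<and> m < m'" for m j using ex[of m "Suc j"] by blast
    qed
    then obtain r where "\<And>j. ?P j (r j) \<and> r j < r (Suc j)" by blast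
    then show ?thesis by (intro exI[of _ r]) (auto simp: strict_mono_Suc_iff)
  qed
  then obtain r where r: "strict_mono r"
    and rF: "\<And>j. (\<integral>\<^sup>+x. ennreal ((F (r j) x)\<^sup>2) \<partial>\<kappa>) < ennreal (1 / 8 ^ j)"
    and rG: "\<And>j n. n \<ge> r j \<Longrightarrow> (\<integral>\<^sup>+x. ennreal ((G n x - G (r j) x)\<^sup>2) \<partial>\<kappa>) < ennreal (1 / 8 ^ j)" by blast
  \<comment> \<open>The integrals decay at rate 1 / 8 ^ j; the weight 4 ^ j leaves the summable 2 *
    (1 / 2) ^ j, and is exactly what \<open>lines_closable\<close> turns into pointwise increments
    of order 1 / 2 ^ j.\<close>
  define T where "T x = (\<Sum>j. ennreal (4 ^ j * ((F (r j) x)\<^sup>2 + (G (r (Suc j)) x - G (r j) x)\<^sup>2)))" for x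
  have [measurable]: "T \<in> borel_measurable \<nu>" unfolding T_def by measurable
  have "(\<integral>\<^sup>+x. T x \<partial>\<kappa>) = (\<Sum>j. \<integral>\<^sup>+x. ennreal (4 ^ j * ((F (r j) x)\<^sup>2 + (G (r (Suc j)) x - G (r j) x)\<^sup>2)) \<partial>\<kappa>)"
    unfolding T_def by (rule nn_integral_suminf) measurable
  also have "\<dots> \<le> (\<Sum>j. ennreal (2 * (1 / 2) ^ j))"
  proof (rule suminf_le)
    fix j
    have "(\<integral>\<^sup>+x. ennreal (4 ^ j * ((F (r j) x)\<^sup>2 + (G (r (Suc j)) x - G (r j) x)\<^sup>2)) \<partial>\<kappa>)
       = ennreal (4 ^ j) * ((\<integral>\<^sup>+x. ennreal ((F (r j) x)\<^sup>2) \<partial>\<kappa>) + (\<integral>\<^sup>+x. ennreal ((G (r (Suc j)) x - G (r j) x)\<^sup>2) \<partial>\<kappa>))"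
      by (subst nn_integral_add[symmetric]; (subst nn_integral_cmult[symmetric])?) (auto simp: ennreal_mult)
    also have "\<dots> \<le> ennreal (4 ^ j) * (ennreal (1 / 8 ^ j) + ennreal (1 / 8 ^ j))"
      using rF[of j] rG[of j "r (Suc j)"] r by (intro mult_left_mono add_mono) (auto simp: strict_mono_less_eq less_imp_le)
    also have "\<dots> = ennreal (2 * (1 / 2) ^ j)"
    proof -
      have "4 ^ j * (1 / 8 ^ j + 1 / 8 ^ j) = (2 * (1 / 2) ^ j :: real)"
        using power_mult_distrib[of "4::real" 2 j] by (simp add: field_simps power_one_over)
      then show ?thesis by (simp flip: ennreal_plus ennreal_mult)
    qed
    finally show "(\<integral>\<^sup>+x. ennreal (4 ^ j * ((F (r j) x)\<^sup>2 + (G (r (Suc j)) x - G (r j) x)\<^sup>2)) \<partial>\<kappa>) \<le> ennreal (2 * (1 / 2) ^ j)" .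
  qed auto
  also have "\<dots> < \<infinity>"
    unfolding infinity_ennreal_def less_top[symmetric]
  proof (rule ennreal_suminf_neq_top)
    show "summable (\<lambda>j. 2 * (1 / 2) ^ j :: real)" by (intro summable_mult summable_geometric) simp
  qed simp
  also have "(\<integral>\<^sup>+x. T x \<partial>\<kappa>) = (\<integral>\<^sup>+x. ennreal (c * exp (- V x)) * T x \<partial>\<nu>)"
    unfolding \<kappa> by (rule nn_integral_density) measurable
  finally have "(\<integral>\<^sup>+x. ennreal (c * exp (- V x)) * T x \<partial>\<nu>) < \<infinity>" .
  then have "(\<integral>\<^sup>+y. (\<integral>\<^sup>+t. ennreal (c * exp (- V (\<Phi> y t))) * T (\<Phi> y t) * ennreal (p t) \<partial>lborel) \<partial>Q) \<noteq> \<infinity>"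
    using disintegration[of "\<lambda>x. ennreal (c * exp (- V x)) * T x"] by (simp add: less_top)
  then have "AE y in Q. (\<integral>\<^sup>+t. ennreal (c * exp (- V (\<Phi> y t))) * T (\<Phi> y t) * ennreal (p t) \<partial>lborel) \<noteq> \<infinity>"
    by (rule nn_integral_PInf_AE[rotated]) measurable
  with Vb AE_space have "AE y in Q. AE t in lborel. (\<lambda>j. G (r j) (\<Phi> y t)) \<longlonglongrightarrow> 0"
  proof eventually_elim
    case (elim y)
    note [measurable] = Phi_fibre[OF elim(2)]
    show ?case
    proof (rule lines_closable[where q = "\<lambda>t. ennreal (c * exp (- V (\<Phi> y t))) * ennreal (p t)"
          and f = "\<lambda>j t. F (r j) (\<Phi> y t)"])
      fix R :: real
      obtain B where B: "AE t in lborel. t \<in> {-R..R} \<longrightarrow> \<bar>V (\<Phi> y t)\<bar> \<le> B" using elim(1) by blast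
      obtain b where b: "b > 0" "\<And>t. t \<in> {-R..R} \<Longrightarrow> b \<le> p t" using p_lower[of R] by blast
      show "\<exists>b>0. AE t in lborel. t \<in> {-R..R} \<longrightarrow> ennreal b \<le> ennreal (c * exp (- V (\<Phi> y t))) * ennreal (p t)"
      proof (intro exI conjI)
        show "0 < c * exp (- B) * b" using b c by simp
        show "AE t in lborel. t \<in> {-R..R} \<longrightarrow> ennreal (c * exp (- B) * b) \<le> ennreal (c * exp (- V (\<Phi> y t))) * ennreal (p t)"
          using B
        proof eventually_elim
          case (elim t)
          show ?case
          proof
            assume t: "t \<in> {-R..R}"
            have "c * exp (- B) * b \<le> c * exp (- V (\<Phi> y t)) * p t"
              using elim t b c by (intro mult_mono) auto
            then show "ennreal (c * exp (- B) * b) \<le> ennreal (c * exp (- V (\<Phi> y t))) * ennreal (p t)"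
              using c p_pos[of t] by (subst ennreal_mult[symmetric]) (auto intro: ennreal_leI less_imp_le)
          qed
        qed
      qed
    next
      have "(\<integral>\<^sup>+t. T (\<Phi> y t) * (ennreal (c * exp (- V (\<Phi> y t))) * ennreal (p t)) \<partial>lborel)
          = (\<integral>\<^sup>+t. ennreal (c * exp (- V (\<Phi> y t))) * T (\<Phi> y t) * ennreal (p t) \<partial>lborel)"
        by (intro nn_integral_cong) (simp add: ac_simps)
      also have "\<dots> < \<infinity>" using elim(3) by (simp add: less_top)
      finally show "(\<integral>\<^sup>+t. (\<Sum>j. ennreal (4 ^ j * ((F (r j) (\<Phi> y t))\<^sup>2 + (G (r (Suc j)) (\<Phi> y t) - G (r j) (\<Phi> y t))\<^sup>2)))
          * (ennreal (c * exp (- V (\<Phi> y t))) * ennreal (p t)) \<partial>lborel) < \<infinity>"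
        by (simp add: T_def)
    qed (use der cont in auto)
  qed
  then have "AE x in \<nu>. (\<lambda>j. G (r j) x) \<longlonglongrightarrow> 0" by (rule AE_from_fibres[rotated]) measurable
  then have conv: "AE x in \<kappa>. (\<lambda>j. G (r j) x) \<longlonglongrightarrow> 0"
    unfolding \<kappa> by (subst AE_density) auto
  show ?thesis
  proof (rule order_tendstoI)
    fix \<epsilon> :: ennreal assume "0 < \<epsilon>"
    then obtain d where d: "0 < d" "d < \<epsilon>" using dense by blast
    then have "d = ennreal (enn2real d)" by (metis ennreal_enn2real less_top order_less_trans top_greatest less_le_trans)
    with d obtain \<delta> where \<delta>: "\<delta> > 0" "ennreal \<delta> < \<epsilon>" by (metis ennreal_less_zero_iff)
    obtain N where N: "\<And>m n. m \<ge> N \<Longrightarrow> n \<ge> N \<Longrightarrow> (\<integral>\<^sup>+x. ennreal ((G m x - G n x)\<^sup>2) \<partial>\<kappa>) < ennreal \<delta>"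
      using cauchy[OF \<delta>(1)] by auto
    have "(\<integral>\<^sup>+x. ennreal ((G n x)\<^sup>2) \<partial>\<kappa>) < \<epsilon>" if n: "n \<ge> N" for n
    proof -
      \<comment> \<open>As \<open>G (r j)\<close> tends to 0, \<open>G n\<close> is the limit of
        \<open>G n - G (r j)\<close> for j to infinity. Fatou bounds its norm by the Cauchy
        differences.\<close>
      have "(\<integral>\<^sup>+x. ennreal ((G n x)\<^sup>2) \<partial>\<kappa>) = (\<integral>\<^sup>+x. liminf (\<lambda>j. ennreal ((G n x - G (r j) x)\<^sup>2)) \<partial>\<kappa>)"
      proof (rule nn_integral_cong_AE, use conv in eventually_elim)
        case (elim x)
        have "(\<lambda>j. ennreal ((G n x - G (r j) x)\<^sup>2)) \<longlonglongrightarrow> ennreal ((G n x - 0)\<^sup>2)"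
          by (intro tendsto_ennrealI tendsto_intros elim)
        then show ?case using lim_imp_Liminf[of sequentially] by (metis diff_zero sequentially_bot)
      qed
      also have "\<dots> \<le> liminf (\<lambda>j. \<integral>\<^sup>+x. ennreal ((G n x - G (r j) x)\<^sup>2) \<partial>\<kappa>)"
        by (rule nn_integral_liminf) measurable
      also have "\<dots> \<le> liminf (\<lambda>j. ennreal \<delta>)"
      proof (rule Liminf_mono)
        have "\<forall>\<^sub>F j in sequentially. N \<le> r j"
          using r by (meson eventually_sequentiallyI order_trans seq_suble)
        then show "\<forall>\<^sub>F j in sequentially. (\<integral>\<^sup>+x. ennreal ((G n x - G (r j) x)\<^sup>2) \<partial>\<kappa>) \<le> ennreal \<delta>"
          by eventually_elim (use N n in \<open>auto intro: less_imp_le\<close>)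
      qed
      also have "\<dots> = ennreal \<delta>" by (simp add: Liminf_const)
      finally show ?thesis using \<delta>(2) by simp
    qed
    then show "\<forall>\<^sub>F n in sequentially. (\<integral>\<^sup>+x. ennreal ((G n x)\<^sup>2) \<partial>\<kappa>) < \<epsilon>"
      by (auto simp: eventually_sequentially)
  qed auto
qed

end

section \<open>Independence of the coordinates of the free field\<close>

text \<open>The space of all sequences is a product and is invariant under every change of a
  coordinate; it replaces the Sobolev space whenever lines are considered.\<close>

abbreviation seq_borel :: "('i \<Rightarrow> real) measure" where
  "seq_borel \<equiv> PiM UNIV (\<lambda>_. borel)"

lemma char_normal_density:
  assumes \<sigma>: "0 < \<sigma>"
  shows "char (density lborel (\<lambda>x. ennreal (normal_density 0 \<sigma> x))) t = complex_of_real (exp (- (\<sigma>\<^sup>2 * t\<^sup>2) / 2))"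
proof -
  let ?N = "density lborel (\<lambda>x. ennreal (normal_density 0 \<sigma> x))"
  interpret prob_space ?N by (rule prob_space_normal_density[OF \<sigma>])
  have "distributed ?N lborel (\<lambda>x. x) (normal_density 0 \<sigma>)"
    by (auto simp: distributed_def distr_id2 cong: distr_cong)
  then have "distributed ?N lborel (\<lambda>x. (x - 0) / \<sigma>) std_normal_density"
    by (subst (asm) normal_standard_normal_convert[OF \<sigma>])
  then have D: "distr ?N lborel (\<lambda>x. x / \<sigma>) = std_normal_distribution"
    by (simp add: distributed_distr_eq_density)
  have "char std_normal_distribution (\<sigma> * t) = (\<integral>x. iexp (\<sigma> * t * x) \<partial>distr ?N lborel (\<lambda>x. x / \<sigma>))"
    by (simp add: char_def D)
  also have "\<dots> = (\<integral>x. iexp (\<sigma> * t * (x / \<sigma>)) \<partial>?N)" by (subst integral_distr) auto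
  also have "\<dots> = char ?N t" using \<sigma> by (simp add: char_def mult.commute)
  finally show ?thesis by (simp add: char_std_normal_distribution power_mult_distrib)
qed

text \<open>Levy's uniqueness theorem under the probability with density Y / E Y: there X has the
  characteristic function of N, hence the law N. If E Y = 0 there is nothing to normalise, but then
  Y vanishes almost surely.\<close>

lemma (in prob_space) law_from_weighted_char:
  fixes X Y :: "'a \<Rightarrow> real"
  assumes X[measurable]: "X \<in> borel_measurable M" and Y[measurable]: "Y \<in> borel_measurable M"
    and Y0: "\<And>x. 0 \<le> Y x" and Yb: "\<And>x. Y x \<le> b"
    and N: "real_distribution N" and q: "\<And>s. char N s = complex_of_real (q s)"
    and c: "\<And>s. expectation (\<lambda>x. Y x * cos (s * X x)) = expectation Y * q s"
    and s: "\<And>s. expectation (\<lambda>x. Y x * sin (s * X x)) = 0"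
    and B[measurable]: "B \<in> sets borel"
  shows "expectation (\<lambda>x. Y x * indicator B (X x)) = expectation Y * measure N B"
proof -
  have bd: "integrable M (\<lambda>x. Y x * f x)" if [measurable]: "f \<in> borel_measurable M" and f: "\<And>x. \<bar>f x\<bar> \<le> 1" for f
  proof (rule integrable_const_bound[where B = b])
    show "AE x in M. norm (Y x * f x) \<le> b"
    proof (rule AE_I2)
      fix x
      have "\<bar>Y x\<bar> * \<bar>f x\<bar> \<le> b * 1" using Y0[of x] Yb[of x] f[of x] by (intro mult_mono) auto
      then show "norm (Y x * f x) \<le> b" by (simp add: abs_mult)
    qed
  qed measurable
  have iY: "integrable M Y" using bd[of "\<lambda>_. 1"] by simp
  define m where "m = expectation Y"
  have m0: "0 \<le> m" unfolding m_def by (rule Bochner_Integration.integral_nonneg) (rule Y0)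
  show ?thesis
  proof (cases "m = 0")
    case True
    then have "AE x in M. Y x = 0"
      using integral_nonneg_eq_0_iff_AE[OF iY] Y0 by (simp add: m_def)
    then have "expectation (\<lambda>x. Y x * indicator B (X x)) = expectation (\<lambda>_. 0)"
      by (intro integral_cong_AE) auto
    then show ?thesis using True by (simp add: m_def)
  next
    case False
    with m0 have m: "0 < m" by simp
    let ?P = "density M (\<lambda>x. ennreal (Y x / m))"
    have "prob_space ?P"
    proof
      have "emeasure ?P (space ?P) = (\<integral>\<^sup>+x. ennreal (Y x / m) \<partial>M)"
        by (subst emeasure_density) (auto intro!: nn_integral_cong)
      also have "\<dots> = ennreal (expectation (\<lambda>x. Y x / m))"
        using iY Y0 m by (intro nn_integral_eq_integral) auto
      also have "\<dots> = 1" using m by (simp add: m_def[symmetric])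
      finally show "emeasure ?P (space ?P) = 1" .
    qed
    then interpret P: prob_space ?P .
    let ?D = "distr ?P borel X"
    have int: "(\<integral>y. f y \<partial>?D) = expectation (\<lambda>x. (Y x / m) *\<^sub>R f (X x))"
      if [measurable]: "f \<in> borel_measurable borel" for f :: "real \<Rightarrow> 'b::{banach, second_countable_topology}"
      using Y0 m by (subst integral_distr; (subst integral_density)?) auto
    have "real_distribution ?D"
      by (intro real_distribution.intro P.prob_space_distr real_distribution_axioms.intro) auto
    moreover have "char ?D = char N"
    proof
      fix t
      have ch: "char ?D t = (CLINT x|M. (Y x / m) *\<^sub>R iexp (t * X x))"
        unfolding char_def by (rule int) measurable
      have ich: "integrable M (\<lambda>x. (Y x / m) *\<^sub>R iexp (t * X x))"
        by (rule Bochner_Integration.integrable_bound[OF integrable_divide[OF iY, of m]])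
          (auto simp: norm_mult)
      have "Re (char ?D t) = expectation (\<lambda>x. (Y x * cos (t * X x)) / m)"
        using ich by (simp add: ch integral_Re[symmetric] Re_exp)
      also have "\<dots> = q t" using c[of t] m by (simp add: m_def[symmetric])
      finally have 1: "Re (char ?D t) = q t" .
      have "Im (char ?D t) = expectation (\<lambda>x. (Y x * sin (t * X x)) / m)"
        using ich by (simp add: ch integral_Im[symmetric] Im_exp)
      also have "\<dots> = 0" using s[of t] by simp
      finally show "char ?D t = char N t" using 1 q[of t] by (simp add: complex_eq_iff)
    qed
    ultimately have D: "?D = N" by (rule Levy_uniqueness[OF _ N])
    have "measure N B = (\<integral>y. indicator B y \<partial>?D)"
      unfolding D using real_distribution.space_eq_univ[OF N] by simp
    also have "\<dots> = expectation (\<lambda>x. (Y x * indicator B (X x)) / m)" by (subst int) auto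
    finally show ?thesis using m by (simp add: m_def[symmetric])
  qed
qed

text \<open>The hypothesis \<open>H\<close> is the joint characteristic function in real form. In
  \<open>key\<close> the variables are converted one at a time: the indices in J still appear inside
  the cosine, those in A already as indicators, and moving b from J to A is an application of
  \<open>law_from_weighted_char\<close> to \<open>X b\<close>. With J empty, \<open>key\<close>
  gives the measure of a cylinder set.\<close>

lemma (in prob_space) product_law_from_cosines:
  fixes X :: "'i \<Rightarrow> 'a \<Rightarrow> real" and v :: "'i \<Rightarrow> real"
  assumes X[measurable]: "\<And>i. X i \<in> borel_measurable M"
    and N: "\<And>i. real_distribution (N i)"
    and q: "\<And>i s. char (N i) s = complex_of_real (exp (- (v i * s\<^sup>2) / 2))"
    and H: "\<And>J t \<theta>. finite J \<Longrightarrow> expectation (\<lambda>\<omega>. cos ((\<Sum>j\<in>J. X j \<omega> * t j) + \<theta>)) =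
      cos \<theta> * exp (- (\<Sum>j\<in>J. v j * (t j)\<^sup>2) / 2)"
  shows "distr M seq_borel (\<lambda>\<omega> i. X i \<omega>) = PiM UNIV N"
proof -
  have key: "expectation (\<lambda>\<omega>. (\<Prod>a\<in>A. indicator (B a) (X a \<omega>)) * cos ((\<Sum>j\<in>J. X j \<omega> * t j) + \<theta>)) =
      (\<Prod>a\<in>A. measure (N a) (B a)) * (cos \<theta> * exp (- (\<Sum>j\<in>J. v j * (t j)\<^sup>2) / 2))"
    if "finite A" "finite J" "A \<inter> J = {}" "\<And>a. B a \<in> sets borel" for A J t \<theta> and B :: "'i \<Rightarrow> real set"
    using that
  proof (induction A arbitrary: J t \<theta> rule: finite_induct)
    case empty
    then show ?case using H by simp
  next
    case (insert b A)
    note [measurable] = insert.prems(3)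
    let ?D = "\<lambda>\<omega>. \<Prod>a\<in>A. indicator (B a) (X a \<omega>) :: real"
    let ?p = "\<Prod>a\<in>A. measure (N a) (B a)"
    let ?S = "\<lambda>\<omega>. \<Sum>j\<in>J. X j \<omega> * t j"
    let ?q = "exp (- (\<Sum>j\<in>J. v j * (t j)\<^sup>2) / 2)"
    have D01: "0 \<le> ?D \<omega>" "?D \<omega> \<le> 1" for \<omega> by (auto intro!: prod_nonneg prod_le_1)
    have bd: "integrable M (\<lambda>\<omega>. ?D \<omega> * f \<omega>)" if [measurable]: "f \<in> borel_measurable M" and f: "\<And>x. \<bar>f x\<bar> \<le> 1" for f
    proof (rule integrable_const_bound[where B = 1])
      show "AE x in M. norm (?D x * f x) \<le> 1"
        using D01 f by (auto simp: abs_mult intro!: mult_le_one)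
    qed measurable
    have bJ: "b \<notin> J" "A \<inter> J = {}" "A \<inter> insert b J = {}" using insert by auto
    have IH: "expectation (\<lambda>\<omega>. ?D \<omega> * cos (?S \<omega> + \<phi>)) = ?p * (cos \<phi> * ?q)" for \<phi>
      using insert.IH[OF \<open>finite J\<close> bJ(2) insert.prems(3)] .
    have IH2: "expectation (\<lambda>\<omega>. ?D \<omega> * cos (?S \<omega> + s * X b \<omega> + \<phi>)) = ?p * (cos \<phi> * (?q * exp (- (v b * s\<^sup>2) / 2)))" for s \<phi>
    proof -
      have 1: "(\<Sum>j\<in>insert b J. X j \<omega> * (t(b := s)) j) = ?S \<omega> + s * X b \<omega>" for \<omega>
        using bJ(1) insert.prems(1) by (subst sum.insert) (auto intro!: sum.cong)
      have 2: "(\<Sum>j\<in>insert b J. v j * ((t(b := s)) j)\<^sup>2) = (\<Sum>j\<in>J. v j * (t j)\<^sup>2) + v b * s\<^sup>2"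
        using bJ(1) insert.prems(1) by (subst sum.insert) (auto intro!: sum.cong)
      have 3: "exp (- ((\<Sum>j\<in>J. v j * (t j)\<^sup>2) + v b * s\<^sup>2) / 2) = ?q * exp (- (v b * s\<^sup>2) / 2)"
        by (simp add: exp_add[symmetric] add_divide_distrib diff_divide_distrib)
      show ?thesis
        using insert.IH[of "insert b J" "t(b := s)" \<phi>] bJ(3) insert.prems(1,3) unfolding 1 2 3 by simp
    qed
    have E1: "expectation (\<lambda>\<omega>. ?D \<omega> * cos (s * X b \<omega> + \<phi>)) = ?p * (cos \<phi> * exp (- (v b * s\<^sup>2) / 2))" for s \<phi>
      using insert.IH[of "{b}" "\<lambda>_. s" \<phi>] insert.hyps insert.prems(3) by (simp add: mult.commute)
    have E0: "expectation ?D = ?p" using insert.IH[of "{}" "\<lambda>_. 0" 0] insert.prems(3) by simp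
    have ind1: "expectation (\<lambda>\<omega>. ?D \<omega> * indicator (B b) (X b \<omega>)) = ?p * measure (N b) (B b)"
    proof (subst law_from_weighted_char[OF _ _ _ _ N q, of "X b" ?D 1 b])
      show "expectation (\<lambda>\<omega>. ?D \<omega> * cos (s * X b \<omega>)) = expectation ?D * exp (- (v b * s\<^sup>2) / 2)" for s
        using E1[of s 0] E0 by simp
      show "expectation (\<lambda>\<omega>. ?D \<omega> * sin (s * X b \<omega>)) = 0" for s
        using E1[of s "- pi / 2"] by (simp add: cos_diff)
    qed (use D01 E0 in auto)
    \<comment> \<open>A weight has to be nonnegative, which the cosine is not. The summand 1 repairs
      this, and its contribution \<open>ind1\<close> is subtracted again at the end.\<close>
    let ?Y = "\<lambda>\<omega>. ?D \<omega> * (1 + cos (?S \<omega> + \<theta>))"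
    have EY: "expectation ?Y = ?p * (1 + cos \<theta> * ?q)"
    proof -
      have "expectation ?Y = expectation (\<lambda>\<omega>. ?D \<omega> * 1 + ?D \<omega> * cos (?S \<omega> + \<theta>))" by (simp add: distrib_left)
      also have "\<dots> = expectation ?D + expectation (\<lambda>\<omega>. ?D \<omega> * cos (?S \<omega> + \<theta>))"
        by (subst Bochner_Integration.integral_add[OF bd bd]) auto
      finally show ?thesis using E0 IH by (simp add: distrib_left)
    qed
    let ?c = "\<lambda>s \<phi> \<omega>. cos (?S \<omega> + s * X b \<omega> + \<phi>)"
    have ind2: "expectation (\<lambda>\<omega>. ?Y \<omega> * indicator (B b) (X b \<omega>)) = ?p * (1 + cos \<theta> * ?q) * measure (N b) (B b)"
    proof (subst law_from_weighted_char[OF _ _ _ _ N q, of "X b" ?Y 2 b])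
      fix \<omega>
      have c: "0 \<le> 1 + cos (?S \<omega> + \<theta>)" "1 + cos (?S \<omega> + \<theta>) \<le> 2"
        using cos_ge_minus_one[of "?S \<omega> + \<theta>"] cos_le_one[of "?S \<omega> + \<theta>"] by linarith+
      then show "0 \<le> ?Y \<omega>" using D01(1) by (intro mult_nonneg_nonneg)
      show "?Y \<omega> \<le> 2" using mult_mono[OF D01(2) c(2) _ c(1)] by simp
    next
      fix s
      have "expectation (\<lambda>\<omega>. ?Y \<omega> * cos (s * X b \<omega>)) = expectation (\<lambda>\<omega>. ?D \<omega> * cos (s * X b \<omega> + 0) +
          (1/2 * (?D \<omega> * ?c s \<theta> \<omega>) + 1/2 * (?D \<omega> * ?c (- s) \<theta> \<omega>)))"
      proof (intro Bochner_Integration.integral_cong refl)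
        fix \<omega>
        have "cos (?S \<omega> + \<theta>) * cos (s * X b \<omega>) = (?c (- s) \<theta> \<omega> + ?c s \<theta> \<omega>) / 2"
          unfolding cos_times_cos by (simp add: algebra_simps)
        then show "?Y \<omega> * cos (s * X b \<omega>) = ?D \<omega> * cos (s * X b \<omega> + 0) +
          (1/2 * (?D \<omega> * ?c s \<theta> \<omega>) + 1/2 * (?D \<omega> * ?c (- s) \<theta> \<omega>))"
          by (simp add: distrib_left distrib_right mult.assoc add_divide_distrib)
      qed
      also have "\<dots> = expectation (\<lambda>\<omega>. ?D \<omega> * cos (s * X b \<omega> + 0)) +
          (1/2 * expectation (\<lambda>\<omega>. ?D \<omega> * ?c s \<theta> \<omega>) + 1/2 * expectation (\<lambda>\<omega>. ?D \<omega> * ?c (- s) \<theta> \<omega>))"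
        by (subst Bochner_Integration.integral_add; (subst Bochner_Integration.integral_add)?)
          (intro Bochner_Integration.integrable_add integrable_mult_right bd | simp)+
      also have "\<dots> = expectation ?Y * exp (- (v b * s\<^sup>2) / 2)"
        unfolding E1 IH2 EY by (simp add: algebra_simps)
      finally show "expectation (\<lambda>\<omega>. ?Y \<omega> * cos (s * X b \<omega>)) = expectation ?Y * exp (- (v b * s\<^sup>2) / 2)" .
      \<comment> \<open>A sine is a cosine with phase shifted by - pi / 2, so \<open>E1\<close> and
        \<open>IH2\<close> apply again: the first term carries the factor cos (- pi / 2) = 0, the
        other two are equal and cancel.\<close>
      have "expectation (\<lambda>\<omega>. ?Y \<omega> * sin (s * X b \<omega>)) = expectation (\<lambda>\<omega>. ?D \<omega> * cos (s * X b \<omega> + (- pi / 2)) +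
          (1/2 * (?D \<omega> * ?c s (\<theta> - pi / 2) \<omega>) - 1/2 * (?D \<omega> * ?c (- s) (\<theta> - pi / 2) \<omega>)))"
      proof (intro Bochner_Integration.integral_cong refl)
        fix \<omega>
        have sc: "cos (x + (y - pi / 2)) = sin (x + y)" for x y :: real
        proof -
          have "x + (y - pi / 2) = (x + y) - pi / 2" by simp
          then show ?thesis by (simp only: cos_diff) simp
        qed
        have "cos (?S \<omega> + \<theta>) * sin (s * X b \<omega>) = (sin (?S \<omega> + s * X b \<omega> + \<theta>) - sin (?S \<omega> + (- s) * X b \<omega> + \<theta>)) / 2"
          unfolding cos_times_sin by (simp add: algebra_simps)
        then show "?Y \<omega> * sin (s * X b \<omega>) = ?D \<omega> * cos (s * X b \<omega> + (- pi / 2)) +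
          (1/2 * (?D \<omega> * ?c s (\<theta> - pi / 2) \<omega>) - 1/2 * (?D \<omega> * ?c (- s) (\<theta> - pi / 2) \<omega>))"
          unfolding sc using sc[of "s * X b \<omega>" 0]
          by (simp add: distrib_left distrib_right mult.assoc diff_divide_distrib right_diff_distrib)
      qed
      also have "\<dots> = expectation (\<lambda>\<omega>. ?D \<omega> * cos (s * X b \<omega> + (- pi / 2))) +
          (1/2 * expectation (\<lambda>\<omega>. ?D \<omega> * ?c s (\<theta> - pi / 2) \<omega>) - 1/2 * expectation (\<lambda>\<omega>. ?D \<omega> * ?c (- s) (\<theta> - pi / 2) \<omega>))"
        by (subst Bochner_Integration.integral_add; (subst Bochner_Integration.integral_diff)?)
          (intro Bochner_Integration.integrable_diff integrable_mult_right bd | simp)+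
      also have "\<dots> = 0"
        unfolding E1 IH2 by simp
      finally show "expectation (\<lambda>\<omega>. ?Y \<omega> * sin (s * X b \<omega>)) = 0" .
    qed (use EY in auto)
    have "expectation (\<lambda>\<omega>. ?Y \<omega> * indicator (B b) (X b \<omega>)) = expectation (\<lambda>\<omega>. ?D \<omega> * indicator (B b) (X b \<omega>) +
        ?D \<omega> * (indicator (B b) (X b \<omega>) * cos (?S \<omega> + \<theta>)))"
      by (intro Bochner_Integration.integral_cong) (auto simp: algebra_simps)
    also have "\<dots> = expectation (\<lambda>\<omega>. ?D \<omega> * indicator (B b) (X b \<omega>)) +
        expectation (\<lambda>\<omega>. ?D \<omega> * (indicator (B b) (X b \<omega>) * cos (?S \<omega> + \<theta>)))"
      by (rule Bochner_Integration.integral_add[OF bd bd]) (auto simp: indicator_def)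
    finally have "expectation (\<lambda>\<omega>. ?D \<omega> * (indicator (B b) (X b \<omega>) * cos (?S \<omega> + \<theta>))) =
        measure (N b) (B b) * ?p * (cos \<theta> * ?q)"
      unfolding ind1 ind2 by (simp add: algebra_simps)
    then show ?case
      using insert.hyps by (simp add: ac_simps)
  qed
  interpret N: product_prob_space N UNIV
    by (intro product_prob_spaceI real_distribution.axioms(1)[OF N])
  have sN: "sets (N i) = sets borel" "space (N i) = UNIV" for i
    using real_distribution.events_eq_borel[OF N] real_distribution.space_eq_univ[OF N] by auto
  have XM[measurable]: "(\<lambda>\<omega> i. X i \<omega>) \<in> M \<rightarrow>\<^sub>M seq_borel"
    by (rule measurable_PiM_single') auto
  show ?thesis
  proof (rule N.PiM_eq)
    show S: "sets (distr M seq_borel (\<lambda>\<omega> i. X i \<omega>)) = sets (PiM UNIV N)"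
      by (simp add: sN cong: sets_PiM_cong)
    fix J :: "'i set" and F
    assume J: "finite J" and F: "\<And>j. j \<in> J \<Longrightarrow> F j \<in> sets (N j)"
    let ?E = "prod_emb UNIV N J (\<Pi>\<^sub>E j\<in>J. F j)"
    have E: "?E = {x. \<forall>j\<in>J. x j \<in> F j}"
      by (auto simp: prod_emb_def sN space_PiM PiE_def Pi_def extensional_def)
    have Em: "?E \<in> sets seq_borel"
      unfolding S[simplified] by (rule sets_PiM_I) (use J F in auto)
    \<comment> \<open>\<open>key\<close> asks for a Borel set at every index, whereas F is
      controlled on J only.\<close>
    let ?F = "\<lambda>j. if j \<in> J then F j else {}"
    have "emeasure (distr M seq_borel (\<lambda>\<omega> i. X i \<omega>)) ?E = emeasure M ((\<lambda>\<omega> i. X i \<omega>) -` ?E \<inter> space M)"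
      by (rule emeasure_distr[OF XM Em])
    also have "\<dots> = ennreal (expectation (indicator ((\<lambda>\<omega> i. X i \<omega>) -` ?E \<inter> space M)))"
      using measurable_sets[OF XM Em] by (simp add: emeasure_eq_measure)
    also have "expectation (indicator ((\<lambda>\<omega> i. X i \<omega>) -` ?E \<inter> space M)) = expectation (\<lambda>\<omega>. \<Prod>a\<in>J. indicator (?F a) (X a \<omega>) :: real)"
    proof (rule Bochner_Integration.integral_cong[OF refl])
      fix \<omega> assume "\<omega> \<in> space M"
      then show "indicator ((\<lambda>\<omega> i. X i \<omega>) -` ?E \<inter> space M) \<omega> = (\<Prod>a\<in>J. indicator (?F a) (X a \<omega>) :: real)"
        using J by (auto simp: E indicator_def prod_zero_iff intro!: prod.neutral[symmetric])
    qed
    also have "\<dots> = (\<Prod>a\<in>J. measure (N a) (?F a))"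
      using key[OF J, of "{}" ?F "\<lambda>_. 0" 0] F by (auto simp: sN)
    also have "\<dots> = (\<Prod>a\<in>J. measure (N a) (F a))" by (intro prod.cong) auto
    also have "ennreal \<dots> = (\<Prod>j\<in>J. emeasure (N j) (F j))"
      by (subst prod_ennreal[symmetric])
        (auto intro!: prod.cong simp: finite_measure.emeasure_eq_measure[OF prob_space.finite_measure[OF real_distribution.axioms(1)[OF N]]])
    finally show "emeasure (distr M seq_borel (\<lambda>\<omega> i. X i \<omega>)) ?E = (\<Prod>j\<in>J. emeasure (N j) (F j))" .
  qed
qed

section \<open>The law of the free field as a product of Gaussians\<close>

lemma free_field_space: "free_field \<delta> \<mu>0 \<Longrightarrow> space \<mu>0 = sobolev (- \<delta>)"
  using sets_eq_imp_space_eq[of \<mu>0 "sobolev_borel (- \<delta>)"] by (simp add: free_field_def space_sobolev_borel)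

lemma free_field_coordinate:
  assumes "free_field \<delta> \<mu>0"
  shows "(\<lambda>z. z k) \<in> borel_measurable \<mu>0"
proof -
  have "sets \<mu>0 = sets (sobolev_borel (- \<delta>))" using assms by (simp add: free_field_def)
  from measurable_cong_sets[OF this refl] measurable_sobolev_coordinate show ?thesis by blast
qed

text \<open>The prescribed covariance with both test functions equal to one trigonometric
  polynomial. It yields the variances of the coordinates and, with \<open>c k = e k x\<close>, the
  renormalisation constants of the cutoffs.\<close>

lemma free_field_second_moment:
  assumes "free_field \<delta> \<mu>0" and "finite S"
  shows "(\<integral>z. (\<Sum>k\<in>S. z k * c k)\<^sup>2 \<partial>\<mu>0) = (\<Sum>k\<in>S. 1 / lam k * (c k)\<^sup>2)"
proof -
  let ?l = "\<lambda>x. \<Sum>k\<in>S. c k * e k x"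
  have "(\<integral>z. pairing z ?l * pairing z ?l \<partial>\<mu>0) = inner_H (A_pow 1 ?l) ?l"
    using assms(1) span_in_sobolev_fun[OF assms(2)] unfolding free_field_def by blast
  also have "\<dots> = (\<Sum>k\<in>S. 1 / lam k * (c k)\<^sup>2)"
  proof -
    have "lam k powr - 1 = 1 / lam k" for k
      using lam_ge_1[of k] by (simp add: powr_minus_divide)
    then show ?thesis unfolding inner_A_pow_span[OF assms(2)] by (simp add: power2_eq_square)
  qed
  finally show ?thesis by (simp add: pairing_span[OF assms(2)] power2_eq_square)
qed

text \<open>A linear combination of coordinates is the pairing with a trigonometric polynomial,
  hence a centred Gaussian, and its variance is the second moment just computed. The Dirac measure
  is the case of variance 0 and obeys the same formula. The phase \<theta> keeps cosine and sine in
  one real identity.\<close>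

lemma free_field_cos:
  assumes ff: "free_field \<delta> \<mu>0" and S: "finite S"
  shows "(\<integral>z. cos ((\<Sum>k\<in>S. z k * c k) + \<theta>) \<partial>\<mu>0) = cos \<theta> * exp (- (\<Sum>k\<in>S. 1 / lam k * (c k)\<^sup>2) / 2)"
proof -
  note [measurable] = free_field_coordinate[OF ff]
  interpret prob_space \<mu>0 using ff by (simp add: free_field_def)
  define X where "X z = (\<Sum>k\<in>S. z k * c k)" for z
  have [measurable]: "X \<in> borel_measurable \<mu>0" unfolding X_def by measurable
  define v where "v = (\<Sum>k\<in>S. 1 / lam k * (c k)\<^sup>2)"
  let ?N = "distr \<mu>0 borel X"
  have "centered_gaussian (distr \<mu>0 borel (\<lambda>z. pairing z (\<lambda>x. \<Sum>k\<in>S. c k * e k x)))"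
    using ff span_in_sobolev_fun[OF S] unfolding free_field_def by blast
  then have g: "centered_gaussian ?N" by (simp add: pairing_span[OF S] X_def[abs_def])
  have v: "(\<integral>x. x\<^sup>2 \<partial>?N) = v"
    using free_field_second_moment[OF ff S, of c] by (subst integral_distr) (auto simp: X_def v_def)
  have E: "(\<integral>z. cos (X z + \<theta>) \<partial>\<mu>0) = (\<integral>x. cos (x + \<theta>) \<partial>?N)"
    by (subst integral_distr) auto
  from g consider "?N = return borel 0" | \<sigma> where "\<sigma> > 0" "?N = density lborel (\<lambda>x. ennreal (normal_density 0 \<sigma> x))"
    unfolding centered_gaussian_def by blast
  then have "(\<integral>x. cos (x + \<theta>) \<partial>?N) = cos \<theta> * exp (- v / 2)"
  proof cases
    case 1
    have "v = 0" unfolding v[symmetric] 1 by (subst integral_return) auto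
    then show ?thesis unfolding 1 by (subst integral_return) auto
  next
    case 2
    interpret N: prob_space ?N by (rule prob_space_distr) measurable
    have "v = (\<integral>x. normal_density 0 \<sigma> x * (x - 0) ^ (2 * 1) \<partial>lborel)"
      unfolding v[symmetric] 2(2) by (subst integral_density) auto
    also have "\<dots> = \<sigma>\<^sup>2" by (subst integral_normal_moment_even[OF 2(1)]) (simp add: fact_numeral)
    finally have v\<sigma>: "v = \<sigma>\<^sup>2" .
    have ch: "(CLINT x|?N. iexp (1 * x)) = complex_of_real (exp (- v / 2))"
      using char_normal_density[OF 2(1), of 1] unfolding 2(2) char_def v\<sigma> by simp
    have int: "integrable ?N (\<lambda>x. iexp (1 * x))"
      by (rule N.integrable_const_bound[where B = 1]) auto
    have c: "(\<integral>x. cos x \<partial>?N) = exp (- v / 2)"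
      using arg_cong[OF ch, of Re] integral_Re[OF int] by (simp add: Re_exp)
    have s: "(\<integral>x. sin x \<partial>?N) = 0"
      using arg_cong[OF ch, of Im] integral_Im[OF int] by (simp add: Im_exp)
    have "(\<integral>x. cos (x + \<theta>) \<partial>?N) = (\<integral>x. cos x * cos \<theta> - sin x * sin \<theta> \<partial>?N)" by (simp add: cos_add)
    also have "\<dots> = (\<integral>x. cos x * cos \<theta> \<partial>?N) - (\<integral>x. sin x * sin \<theta> \<partial>?N)"
      by (intro Bochner_Integration.integral_diff integrable_mult_left N.integrable_const_bound[where B = 1]) auto
    finally show ?thesis using c s by simp
  qed
  with E show ?thesis by (simp add: X_def v_def)
qed

definition free_coordinate_law :: "int \<times> int \<Rightarrow> real measure" where
  "free_coordinate_law k = density lborel (\<lambda>x. ennreal (normal_density 0 (1 / sqrt (lam k)) x))"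

lemma real_distribution_free_coordinate_law: "real_distribution (free_coordinate_law k)"
  unfolding free_coordinate_law_def using lam_ge_1[of k]
  by (intro real_distribution.intro prob_space_normal_density real_distribution_axioms.intro) auto

text \<open>The map is the identity: only the underlying space and its sigma-algebra change, from
  the Sobolev space with its Borel sets to all sequences.\<close>

lemma free_field_law:
  assumes ff: "free_field \<delta> \<mu>0"
  shows "distr \<mu>0 seq_borel (\<lambda>z. z) = PiM UNIV free_coordinate_law"
proof -
  interpret prob_space \<mu>0 using ff by (simp add: free_field_def)
  show ?thesis
  proof (rule product_law_from_cosines[where X = "\<lambda>i z. z i" and v = "\<lambda>k. 1 / lam k"])
    show "char (free_coordinate_law i) s = complex_of_real (exp (- (1 / lam i * s\<^sup>2) / 2))" for i s
      unfolding free_coordinate_law_def using lam_ge_1[of i]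
      by (subst char_normal_density) (auto simp: power_divide)
  qed (auto intro: free_field_coordinate[OF ff] real_distribution_free_coordinate_law simp: free_field_cos[OF ff])
qed

text \<open>Fubini for the product of one factor with all the others. A point of the product over
  \<open>UNIV - {k}\<close> carries a dummy value at k, which the update overwrites.\<close>

lemma fibred_free_field:
  "fibred_measure (PiM UNIV free_coordinate_law) (PiM (UNIV - {k}) free_coordinate_law)
     (\<lambda>y t. y(k := t)) (normal_density 0 (1 / sqrt (lam k)))"
proof
  let ?N = free_coordinate_law
  let ?p = "normal_density 0 (1 / sqrt (lam k))"
  have pN: "prob_space (?N i)" for i using real_distribution_free_coordinate_law by (rule real_distribution.axioms)
  interpret Q: prob_space "PiM (UNIV - {k}) ?N" by (rule prob_space_PiM) (rule pN)
  interpret Nk: prob_space "?N k" by (rule pN)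
  have ins: "insert k (UNIV - {k}) = UNIV" by auto
  have sN: "sets (?N i) = sets borel" for i by (simp add: free_coordinate_law_def)
  have m0: "(\<lambda>(x, y). y(k := x)) \<in> ?N k \<Otimes>\<^sub>M PiM (UNIV - {k}) ?N \<rightarrow>\<^sub>M PiM UNIV ?N"
    using measurable_add_dim[of k "UNIV - {k}" ?N] measurable_compose[OF measurable_pair_swap']
    unfolding ins by (simp add: case_prod_beta)
  have sw: "(\<lambda>(y, t). (t, y)) \<in> PiM (UNIV - {k}) ?N \<Otimes>\<^sub>M borel \<rightarrow>\<^sub>M ?N k \<Otimes>\<^sub>M PiM (UNIV - {k}) ?N"
    using measurable_pair_swap'[of "PiM (UNIV - {k}) ?N" "?N k"] sN
    by (simp cong: measurable_cong_sets sets_pair_measure_cong)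
  show "(\<lambda>(y, t). y(k := t)) \<in> PiM (UNIV - {k}) ?N \<Otimes>\<^sub>M borel \<rightarrow>\<^sub>M PiM UNIV ?N"
    using measurable_compose[OF sw m0] by (simp add: case_prod_beta')
  show "continuous_on UNIV ?p"
    unfolding normal_density_def using lam_ge_1[of k] by (intro continuous_intros) auto
  show "0 < ?p t" for t by (rule normal_density_pos) (use lam_ge_1[of k] in auto)
  fix h :: "_ \<Rightarrow> ennreal" assume [measurable]: "h \<in> borel_measurable (PiM UNIV ?N)"
  have hm: "(\<lambda>(x, y). h (y(k := x))) \<in> borel_measurable (?N k \<Otimes>\<^sub>M PiM (UNIV - {k}) ?N)"
    using measurable_compose[OF m0, of h borel] by (simp add: case_prod_beta')
  interpret P: pair_sigma_finite "?N k" "PiM (UNIV - {k}) ?N" ..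
  have "(\<integral>\<^sup>+x. h x \<partial>PiM UNIV ?N) = (\<integral>\<^sup>+x. h x \<partial>distr (?N k \<Otimes>\<^sub>M PiM (UNIV - {k}) ?N) (PiM UNIV ?N) (\<lambda>(x, X). X(k := x)))"
    using distr_pair_PiM_eq_PiM[of "UNIV - {k}" ?N k] pN unfolding ins by simp
  also have "\<dots> = (\<integral>\<^sup>+(x, y). h (y(k := x)) \<partial>(?N k \<Otimes>\<^sub>M PiM (UNIV - {k}) ?N))"
    by (subst nn_integral_distr[OF m0]) (auto simp: case_prod_beta')
  also have "\<dots> = (\<integral>\<^sup>+y. (\<integral>\<^sup>+t. h (y(k := t)) \<partial>?N k) \<partial>PiM (UNIV - {k}) ?N)"
    using P.nn_integral_snd[OF hm] by simp
  also have "\<dots> = (\<integral>\<^sup>+y. (\<integral>\<^sup>+t. h (y(k := t)) * ennreal (?p t) \<partial>lborel) \<partial>PiM (UNIV - {k}) ?N)"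
  proof (rule nn_integral_cong)
    fix y assume y: "y \<in> space (PiM (UNIV - {k}) ?N)"
    have "(\<lambda>t. h (y(k := t))) \<in> borel_measurable (?N k)"
      using measurable_compose[OF measurable_Pair2'[OF y] hm] by simp
    then have [measurable]: "(\<lambda>t. h (y(k := t))) \<in> borel_measurable borel" by (simp add: sN cong: measurable_cong_sets)
    show "(\<integral>\<^sup>+t. h (y(k := t)) \<partial>?N k) = (\<integral>\<^sup>+t. h (y(k := t)) * ennreal (?p t) \<partial>lborel)"
      unfolding free_coordinate_law_def by (subst nn_integral_density) (auto simp: mult.commute)
  qed
  finally show "(\<integral>\<^sup>+x. h x \<partial>PiM UNIV ?N) = (\<integral>\<^sup>+y. (\<integral>\<^sup>+t. h (y(k := t)) * ennreal (?p t) \<partial>lborel) \<partial>PiM (UNIV - {k}) ?N)" .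
qed

section \<open>Derivatives of Wick functions\<close>

lemma continuous_bounded_on_ball:
  fixes \<psi> :: "real \<Rightarrow> real"
  assumes "continuous_on UNIV \<psi>"
  obtains C where "\<And>u. \<bar>u\<bar> \<le> r \<Longrightarrow> \<bar>\<psi> u\<bar> \<le> C"
proof -
  have "compact (\<psi> ` {-r..r})"
    by (intro compact_continuous_image continuous_on_subset[OF assms]) auto
  then obtain C where "\<And>u. u \<in> {-r..r} \<Longrightarrow> norm (\<psi> u) \<le> C"
    by (meson bounded_iff compact_imp_bounded imageI)
  moreover have "u \<in> {-r..r}" if "\<bar>u\<bar> \<le> r" for u using that by auto
  ultimately show ?thesis using that[of C] by (metis real_norm_def)
qed

lemma abs_affine_le:
  fixes A b s :: real
  assumes "\<bar>A\<bar> \<le> \<alpha>" and "\<bar>b\<bar> \<le> \<beta>" and "\<bar>s\<bar> \<le> T"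
  shows "\<bar>A + s * b\<bar> \<le> \<alpha> + T * \<beta>"
proof -
  have "\<bar>s\<bar> * \<bar>b\<bar> \<le> T * \<beta>" using assms by (intro mult_mono) auto
  then show ?thesis using abs_triangle_ineq[of A "s * b"] assms(1) by (simp add: abs_mult)
qed

context finite_measure
begin

lemma integral_line_continuous:
  fixes \<psi> :: "real \<Rightarrow> real" and A b w :: "'a \<Rightarrow> real"
  assumes \<psi>: "continuous_on UNIV \<psi>"
    and [measurable]: "A \<in> borel_measurable M" "b \<in> borel_measurable M" "w \<in> borel_measurable M"
    and A: "\<And>x. \<bar>A x\<bar> \<le> \<alpha>" and b: "\<And>x. \<bar>b x\<bar> \<le> \<beta>" and w: "\<And>x. \<bar>w x\<bar> \<le> \<omega>"
  shows "continuous_on UNIV (\<lambda>t. \<integral>x. \<psi> (A x + t * b x) * w x \<partial>M)"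
proof (subst continuous_on_sequentially, intro allI ballI impI)
  have [measurable]: "\<psi> \<in> borel_measurable borel" by (rule borel_measurable_continuous_onI[OF \<psi>])
  fix s :: "nat \<Rightarrow> real" and t
  assume "(\<forall>n. s n \<in> UNIV) \<and> s \<longlonglongrightarrow> t"
  then have s: "s \<longlonglongrightarrow> t" by simp
  then obtain T where T: "\<And>n. \<bar>s n\<bar> \<le> T"
    using convergent_imp_Bseq[of s] unfolding convergent_def Bseq_def by auto
  obtain C where C: "\<And>u. \<bar>u\<bar> \<le> \<alpha> + T * \<beta> \<Longrightarrow> \<bar>\<psi> u\<bar> \<le> C" using continuous_bounded_on_ball[OF \<psi>] by blast
  have arg: "\<bar>A x + s n * b x\<bar> \<le> \<alpha> + T * \<beta>" for x n
    by (rule abs_affine_le[OF A b T])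
  have "(\<lambda>n. \<integral>x. \<psi> (A x + s n * b x) * w x \<partial>M) \<longlonglongrightarrow> (\<integral>x. \<psi> (A x + t * b x) * w x \<partial>M)"
  proof (rule integral_dominated_convergence[where w = "\<lambda>_. C * \<omega>"])
    show "AE x in M. (\<lambda>n. \<psi> (A x + s n * b x) * w x) \<longlonglongrightarrow> \<psi> (A x + t * b x) * w x"
      by (intro AE_I2 tendsto_intros continuous_on_tendsto_compose[OF \<psi>] s) auto
    show "AE x in M. norm (\<psi> (A x + s n * b x) * w x) \<le> C * \<omega>" for n
    proof (rule AE_I2)
      fix x
      have "\<bar>\<psi> (A x + s n * b x)\<bar> * \<bar>w x\<bar> \<le> C * \<omega>"
        using C[OF arg[of x n]] w[of x] by (intro mult_mono) auto
      then show "norm (\<psi> (A x + s n * b x) * w x) \<le> C * \<omega>" by (simp add: abs_mult)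
    qed
  qed auto
  then show "((\<lambda>t. \<integral>x. \<psi> (A x + t * b x) * w x \<partial>M) \<circ> s) \<longlonglongrightarrow> (\<integral>x. \<psi> (A x + t * b x) * w x \<partial>M)"
    by (simp add: o_def)
qed

text \<open>For parameters in [-T, T] all arguments stay in one compact interval, on which \<psi>'
  is bounded. By the mean value inequality the same constant dominates the difference
  quotients.\<close>

lemma integral_line_derivative:
  fixes \<psi> \<psi>' :: "real \<Rightarrow> real" and A b w :: "'a \<Rightarrow> real"
  assumes der: "\<And>u. (\<psi> has_real_derivative \<psi>' u) (at u)" and \<psi>': "continuous_on UNIV \<psi>'"
    and [measurable]: "A \<in> borel_measurable M" "b \<in> borel_measurable M" "w \<in> borel_measurable M"
    and A: "\<And>x. \<bar>A x\<bar> \<le> \<alpha>" and b: "\<And>x. \<bar>b x\<bar> \<le> \<beta>" and w: "\<And>x. \<bar>w x\<bar> \<le> \<omega>"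
  shows "((\<lambda>t. \<integral>x. \<psi> (A x + t * b x) * w x \<partial>M) has_real_derivative
      (\<integral>x. \<psi>' (A x + t * b x) * (b x * w x) \<partial>M)) (at t)"
proof -
  have \<psi>: "continuous_on UNIV \<psi>"
    using der by (intro continuous_at_imp_continuous_on ballI) (rule DERIV_isCont)
  have [measurable]: "\<psi> \<in> borel_measurable borel" "\<psi>' \<in> borel_measurable borel"
    by (rule borel_measurable_continuous_onI[OF \<psi>], rule borel_measurable_continuous_onI[OF \<psi>'])
  let ?f = "\<lambda>t x. \<psi> (A x + t * b x) * w x"
  have bd: "\<bar>A x + s * b x\<bar> \<le> \<alpha> + T * \<beta>" if "\<bar>s\<bar> \<le> T" for s T x
    by (rule abs_affine_le[OF A b that])
  have int: "integrable M (?f s)" for s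
  proof -
    obtain C where C: "\<And>u. \<bar>u\<bar> \<le> \<alpha> + \<bar>s\<bar> * \<beta> \<Longrightarrow> \<bar>\<psi> u\<bar> \<le> C" using continuous_bounded_on_ball[OF \<psi>] by blast
    show ?thesis
    proof (rule integrable_const_bound[where B = "C * \<omega>"])
      show "AE x in M. norm (?f s x) \<le> C * \<omega>"
      proof (rule AE_I2)
        fix x
        have "\<bar>\<psi> (A x + s * b x)\<bar> * \<bar>w x\<bar> \<le> C * \<omega>"
          using C[OF bd[of s "\<bar>s\<bar>" x]] w[of x] by (intro mult_mono) auto
        then show "norm (?f s x) \<le> C * \<omega>" by (simp add: abs_mult)
      qed
    qed measurable
  qed
  have derx: "((\<lambda>t. ?f t x) has_real_derivative \<psi>' (A x + t * b x) * (b x * w x)) (at t)" for t x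
    by (rule derivative_eq_intros DERIV_chain2[OF der] refl | simp)+
  show ?thesis
    unfolding has_field_derivative_iff tendsto_at_iff_sequentially o_def
  proof (intro allI impI)
    fix s :: "nat \<Rightarrow> real"
    assume s0: "\<forall>i. s i \<in> UNIV - {t}" and s: "s \<longlonglongrightarrow> t"
    obtain T where T: "\<And>n. \<bar>s n\<bar> \<le> T"
      using convergent_imp_Bseq[of s] s unfolding convergent_def Bseq_def by auto
    have Tt: "\<bar>t\<bar> \<le> T" by (rule LIMSEQ_le_const2[OF tendsto_rabs[OF s]]) (use T in auto)
    obtain C where C: "\<And>u. \<bar>u\<bar> \<le> \<alpha> + T * \<beta> \<Longrightarrow> \<bar>\<psi>' u\<bar> \<le> C" using continuous_bounded_on_ball[OF \<psi>'] by blast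
    have C': "\<bar>\<psi>' (A x + r * b x) * (b x * w x)\<bar> \<le> C * (\<beta> * \<omega>)" if "\<bar>r\<bar> \<le> T" for r x
    proof -
      have "\<bar>\<psi>' (A x + r * b x)\<bar> * (\<bar>b x\<bar> * \<bar>w x\<bar>) \<le> C * (\<beta> * \<omega>)"
        using C[OF bd[OF that, of x]] b[of x] w[of x] by (intro mult_mono) auto
      then show ?thesis by (simp add: abs_mult)
    qed
    have "(\<lambda>n. \<integral>x. (?f (s n) x - ?f t x) / (s n - t) \<partial>M) \<longlonglongrightarrow> (\<integral>x. \<psi>' (A x + t * b x) * (b x * w x) \<partial>M)"
    proof (rule integral_dominated_convergence[where w = "\<lambda>_. C * (\<beta> * \<omega>)"])
      show "AE x in M. (\<lambda>n. (?f (s n) x - ?f t x) / (s n - t)) \<longlonglongrightarrow> \<psi>' (A x + t * b x) * (b x * w x)"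
        using derx[of _ t] s0 s unfolding has_field_derivative_iff tendsto_at_iff_sequentially o_def by blast
      show "AE x in M. norm ((?f (s n) x - ?f t x) / (s n - t)) \<le> C * (\<beta> * \<omega>)" for n
      proof (rule AE_I2)
        fix x
        have "norm (?f (s n) x - ?f t x) \<le> C * (\<beta> * \<omega>) * norm (s n - t)"
        proof (rule field_differentiable_bound[of "{-T..T}"])
          show "((\<lambda>t. ?f t x) has_real_derivative \<psi>' (A x + r * b x) * (b x * w x)) (at r within {-T..T})" for r
            by (rule has_field_derivative_at_within[OF derx])
          show "norm (\<psi>' (A x + r * b x) * (b x * w x)) \<le> C * (\<beta> * \<omega>)" if "r \<in> {-T..T}" for r
            using C'[of r x] that by (auto simp: abs_le_iff)
        qed (use T[of n] Tt in \<open>auto simp: abs_le_iff\<close>)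
        then show "norm ((?f (s n) x - ?f t x) / (s n - t)) \<le> C * (\<beta> * \<omega>)"
          using s0 by (simp add: divide_le_eq)
      qed
    qed auto
    then show "(\<lambda>n. ((\<integral>x. ?f (s n) x \<partial>M) - (\<integral>x. ?f t x \<partial>M)) / (s n - t)) \<longlonglongrightarrow> (\<integral>x. \<psi>' (A x + t * b x) * (b x * w x) \<partial>M)"
      using int by (simp add: Bochner_Integration.integral_diff)
  qed
qed

text \<open>Writes the square of an integral over the torus as a double integral, so that the
  expectation can be taken under the integral sign.\<close>

lemma integral_times_integral:
  fixes f g :: "'a \<Rightarrow> real"
  assumes [measurable]: "f \<in> borel_measurable M" "g \<in> borel_measurable M"
    and f: "\<And>x. \<bar>f x\<bar> \<le> \<alpha>" and g: "\<And>x. \<bar>g x\<bar> \<le> \<beta>"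
  shows "(\<integral>x. f x \<partial>M) * (\<integral>x. g x \<partial>M) = (\<integral>p. f (fst p) * g (snd p) \<partial>(M \<Otimes>\<^sub>M M))"
proof -
  interpret P: pair_sigma_finite M M ..
  interpret MM: finite_measure "M \<Otimes>\<^sub>M M" by (rule finite_measure_pair_measure) (rule finite_measure_axioms)+
  have "integrable (M \<Otimes>\<^sub>M M) (\<lambda>p. f (fst p) * g (snd p))"
  proof (rule MM.integrable_const_bound[where B = "\<alpha> * \<beta>"])
    show "AE p in M \<Otimes>\<^sub>M M. norm (f (fst p) * g (snd p)) \<le> \<alpha> * \<beta>"
      using f g by (auto simp: abs_mult intro!: mult_mono order_trans[OF abs_ge_zero])
  qed measurable
  from P.integral_fst'[OF this] show ?thesis by simp
qed

end

text \<open>Both sides are squares of integrals over the torus; Fubini turns them into double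
  integrals of the two-point functions of sine and cosine, which are compared at each pair of
  points. The Gaussian law enters through \<open>pos\<close> alone.\<close>

lemma wick_cos_derivative_bound:
  fixes \<mu> :: "(int \<times> int \<Rightarrow> real) measure" and w b :: "real \<times> real \<Rightarrow> real"
  assumes \<mu>: "prob_space \<mu>" and coord[measurable]: "\<And>k. (\<lambda>z. z k) \<in> borel_measurable \<mu>"
    and S: "finite S"
    and pos: "\<And>c. 0 \<le> (\<integral>z. cos (\<Sum>k\<in>S. z k * c k) \<partial>\<mu>)"
    and [measurable]: "w \<in> borel_measurable torus" "b \<in> borel_measurable torus"
    and w: "\<And>x. 0 \<le> w x" "\<And>x. w x \<le> \<omega>" and b: "\<And>x. \<bar>b x\<bar> \<le> \<beta>"
  shows "(\<integral>z. (\<integral>x. sin (a * (\<Sum>k\<in>S. z k * e k x)) * (b x * w x) \<partial>torus)\<^sup>2 \<partial>\<mu>)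
    \<le> \<beta>\<^sup>2 * (\<integral>z. (\<integral>x. cos (a * (\<Sum>k\<in>S. z k * e k x)) * w x \<partial>torus)\<^sup>2 \<partial>\<mu>)"
proof -
  interpret \<mu>: prob_space \<mu> by (rule \<mu>)
  interpret TT: finite_measure "torus \<Otimes>\<^sub>M torus"
    by (rule finite_measure_pair_measure) (rule finite_measure_torus)+
  interpret P: pair_sigma_finite \<mu> "torus \<Otimes>\<^sub>M torus" ..
  interpret F: finite_measure "\<mu> \<Otimes>\<^sub>M (torus \<Otimes>\<^sub>M torus)"
    by (rule finite_measure_pair_measure) (rule \<mu>.finite_measure_axioms TT.finite_measure_axioms)+
  have e_meas[measurable]: "e k \<in> borel_measurable torus" for k by measurable
  define u where "u z x = a * (\<Sum>k\<in>S. z k * e k x)" for z x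
  have u_meas[measurable]: "(\<lambda>p. u (f p) (g p)) \<in> borel_measurable M"
    if [measurable]: "f \<in> M \<rightarrow>\<^sub>M \<mu>" "g \<in> M \<rightarrow>\<^sub>M torus" for M :: "'c measure" and f g
    unfolding u_def using measurable_compose[OF that(1) coord] by measurable
  have u_meas2[measurable]: "u z \<in> borel_measurable torus" for z
    unfolding u_def[abs_def] by measurable
  have \<beta>0: "0 \<le> \<beta>" using b[of 0] by linarith
  have bw: "\<bar>b x * w x\<bar> \<le> \<beta> * \<omega>" for x
    unfolding abs_mult using b[of x] w[of x] \<beta>0 by (intro mult_mono) auto
  have w\<omega>: "\<bar>w x\<bar> \<le> \<omega>" for x using w[of x] by simp
  \<comment> \<open>Stated for general h and c, since it is used twice: with sine and the weight b
    w, and with cosine and the weight w.\<close>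
  have fub: "(\<integral>z. (\<integral>x. h (u z x) * c x \<partial>torus)\<^sup>2 \<partial>\<mu>) =
      (\<integral>p. (\<integral>z. h (u z (fst p)) * h (u z (snd p)) \<partial>\<mu>) * (c (fst p) * c (snd p)) \<partial>(torus \<Otimes>\<^sub>M torus))"
    and fub_int: "integrable (torus \<Otimes>\<^sub>M torus) (\<lambda>p. (\<integral>z. h (u z (fst p)) * h (u z (snd p)) \<partial>\<mu>) * (c (fst p) * c (snd p)))"
    if [measurable]: "h \<in> borel_measurable borel" "c \<in> borel_measurable torus"
      and h: "\<And>t. \<bar>h t\<bar> \<le> 1" and c: "\<And>x. \<bar>c x\<bar> \<le> \<gamma>" for h c :: "_ \<Rightarrow> real" and \<gamma>
  proof -
    let ?G = "\<lambda>z p. h (u z (fst p)) * h (u z (snd p)) * (c (fst p) * c (snd p))"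
    have G1: "\<bar>h r * h s * (c x * c y)\<bar> \<le> \<gamma> * \<gamma>" for r s x y
    proof -
      have "\<bar>h r\<bar> * \<bar>h s\<bar> \<le> 1" using h by (intro mult_le_one) auto
      moreover have "\<bar>c x\<bar> * \<bar>c y\<bar> \<le> \<gamma> * \<gamma>" using c[of x] c[of y] by (intro mult_mono) auto
      ultimately have "\<bar>h r\<bar> * \<bar>h s\<bar> * (\<bar>c x\<bar> * \<bar>c y\<bar>) \<le> 1 * (\<gamma> * \<gamma>)"
        by (rule mult_mono) auto
      then show ?thesis by (simp add: abs_mult)
    qed
    have int: "integrable (\<mu> \<Otimes>\<^sub>M (torus \<Otimes>\<^sub>M torus)) (\<lambda>(z, p). ?G z p)"
      by (rule F.integrable_const_bound[where B = "\<gamma> * \<gamma>"]) (use G1 in \<open>auto simp: split_beta'\<close>)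
    have sq: "(\<integral>x. h (u z x) * c x \<partial>torus)\<^sup>2 = (\<integral>p. ?G z p \<partial>(torus \<Otimes>\<^sub>M torus))" for z
    proof -
      have hc: "\<bar>h (u z x) * c x\<bar> \<le> 1 * \<gamma>" for x
        unfolding abs_mult using h[of "u z x"] c[of x] by (intro mult_mono) auto
      show ?thesis
        unfolding power2_eq_square
        by (subst torus.integral_times_integral[OF _ _ hc hc]) (auto intro!: Bochner_Integration.integral_cong)
    qed
    have "(\<integral>z. (\<integral>x. h (u z x) * c x \<partial>torus)\<^sup>2 \<partial>\<mu>) = (\<integral>p. (\<integral>z. ?G z p \<partial>\<mu>) \<partial>(torus \<Otimes>\<^sub>M torus))"
      unfolding sq by (rule P.Fubini_integral[OF int, symmetric])
    then show "(\<integral>z. (\<integral>x. h (u z x) * c x \<partial>torus)\<^sup>2 \<partial>\<mu>) =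
      (\<integral>p. (\<integral>z. h (u z (fst p)) * h (u z (snd p)) \<partial>\<mu>) * (c (fst p) * c (snd p)) \<partial>(torus \<Otimes>\<^sub>M torus))" by simp
    show "integrable (torus \<Otimes>\<^sub>M torus) (\<lambda>p. (\<integral>z. h (u z (fst p)) * h (u z (snd p)) \<partial>\<mu>) * (c (fst p) * c (snd p)))"
      using P.integrable_snd[OF int] by simp
  qed
  have comp: "\<bar>\<integral>z. sin (u z x) * sin (u z y) \<partial>\<mu>\<bar> \<le> (\<integral>z. cos (u z x) * cos (u z y) \<partial>\<mu>)"
    if "x \<in> space torus" "y \<in> space torus" for x y
  proof -
    have pos': "0 \<le> (\<integral>z. cos (u z x + s * u z y) \<partial>\<mu>)" for s
    proof -
      have "u z x + s * u z y = (\<Sum>k\<in>S. z k * (a * (e k x + s * e k y)))" for z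
        by (simp add: u_def sum_distrib_left sum.distrib[symmetric] algebra_simps)
      then show ?thesis using pos[of "\<lambda>k. a * (e k x + s * e k y)"] by simp
    qed
    have um[measurable]: "(\<lambda>z. u z x) \<in> borel_measurable \<mu>" for x unfolding u_def by measurable
    have i: "integrable \<mu> (\<lambda>z. cos (u z x + s * u z y))" for s
      by (rule \<mu>.integrable_const_bound[where B = 1]) auto
    \<comment> \<open>Up to the factor 1 / 2 the claim reads |m - p| \<le> m + p, true because both
      numbers are nonnegative.\<close>
    let ?p = "\<integral>z. cos (u z x + 1 * u z y) \<partial>\<mu>" and ?m = "\<integral>z. cos (u z x + (- 1) * u z y) \<partial>\<mu>"
    have "(\<integral>z. sin (u z x) * sin (u z y) \<partial>\<mu>) = (\<integral>z. (cos (u z x + (- 1) * u z y) - cos (u z x + 1 * u z y)) / 2 \<partial>\<mu>)"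
      by (simp add: sin_times_sin)
    also have "\<dots> = (?m - ?p) / 2" using i[of "-1"] i[of 1] by (subst integral_divide_zero, subst Bochner_Integration.integral_diff) auto
    finally have s: "(\<integral>z. sin (u z x) * sin (u z y) \<partial>\<mu>) = (?m - ?p) / 2" .
    have "(\<integral>z. cos (u z x) * cos (u z y) \<partial>\<mu>) = (\<integral>z. (cos (u z x + (- 1) * u z y) + cos (u z x + 1 * u z y)) / 2 \<partial>\<mu>)"
      by (simp add: cos_times_cos)
    also have "\<dots> = (?m + ?p) / 2" using i[of "-1"] i[of 1] by (subst integral_divide_zero, subst Bochner_Integration.integral_add) auto
    finally show ?thesis using s pos'[of 1] pos'[of "-1"] by (simp add: abs_le_iff)
  qed
  have "(\<integral>z. (\<integral>x. sin (u z x) * (b x * w x) \<partial>torus)\<^sup>2 \<partial>\<mu>) =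
      (\<integral>p. (\<integral>z. sin (u z (fst p)) * sin (u z (snd p)) \<partial>\<mu>) * ((b (fst p) * w (fst p)) * (b (snd p) * w (snd p))) \<partial>(torus \<Otimes>\<^sub>M torus))"
    by (rule fub[OF _ _ _ bw]) auto
  also have "\<dots> \<le> (\<integral>p. \<beta>\<^sup>2 * ((\<integral>z. cos (u z (fst p)) * cos (u z (snd p)) \<partial>\<mu>) * (w (fst p) * w (snd p))) \<partial>(torus \<Otimes>\<^sub>M torus))"
  proof (rule integral_mono)
    show "integrable (torus \<Otimes>\<^sub>M torus) (\<lambda>p. (\<integral>z. sin (u z (fst p)) * sin (u z (snd p)) \<partial>\<mu>) * ((b (fst p) * w (fst p)) * (b (snd p) * w (snd p))))"
      by (rule fub_int[OF _ _ _ bw]) auto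
    show "integrable (torus \<Otimes>\<^sub>M torus) (\<lambda>p. \<beta>\<^sup>2 * ((\<integral>z. cos (u z (fst p)) * cos (u z (snd p)) \<partial>\<mu>) * (w (fst p) * w (snd p))))"
      by (intro integrable_mult_right fub_int[OF _ _ _ w\<omega>]) auto
    fix p assume "p \<in> space (torus \<Otimes>\<^sub>M torus)"
    then have p: "fst p \<in> space torus" "snd p \<in> space torus" by (auto simp: space_pair_measure)
    let ?s = "\<integral>z. sin (u z (fst p)) * sin (u z (snd p)) \<partial>\<mu>" and ?c = "\<integral>z. cos (u z (fst p)) * cos (u z (snd p)) \<partial>\<mu>"
    have "?s * ((b (fst p) * w (fst p)) * (b (snd p) * w (snd p))) \<le> \<bar>?s\<bar> * ((\<bar>b (fst p)\<bar> * \<bar>w (fst p)\<bar>) * (\<bar>b (snd p)\<bar> * \<bar>w (snd p)\<bar>))"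
      by (rule order_trans[OF abs_ge_self]) (simp add: abs_mult)
    \<comment> \<open>As w is nonnegative, |w| is w itself, so the bounding double integral is again
      the square of an integral with weight w.\<close>
    also have "\<dots> \<le> ?c * ((\<beta> * w (fst p)) * (\<beta> * w (snd p)))"
    proof (rule mult_mono[OF comp[OF p]])
      show "\<bar>b (fst p)\<bar> * \<bar>w (fst p)\<bar> * (\<bar>b (snd p)\<bar> * \<bar>w (snd p)\<bar>) \<le> \<beta> * w (fst p) * (\<beta> * w (snd p))"
        using b w(1) \<beta>0 by (intro mult_mono) auto
      show "0 \<le> ?c" using comp[OF p] by linarith
    qed simp
    finally show "?s * ((b (fst p) * w (fst p)) * (b (snd p) * w (snd p))) \<le> \<beta>\<^sup>2 * (?c * (w (fst p) * w (snd p)))"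
      by (simp add: power2_eq_square ac_simps)
  qed
  also have "\<dots> = \<beta>\<^sup>2 * (\<integral>z. (\<integral>x. cos (u z x) * w x \<partial>torus)\<^sup>2 \<partial>\<mu>)"
    by (subst fub[OF _ _ _ w\<omega>]) auto
  finally show ?thesis by (simp add: u_def)
qed

text \<open>Along the line the argument of \<psi> at x is affine in t. Its slope is
  \<open>a * e k x\<close> if the mode k survives the cutoff and 0 otherwise.\<close>

lemma wick_line_derivative:
  assumes S: "finite S" and der: "\<And>u. (\<psi> has_real_derivative \<psi>' u) (at u)" and \<psi>': "continuous_on UNIV \<psi>'"
    and [measurable]: "w \<in> borel_measurable borel" and w: "\<And>x. \<bar>w x\<bar> \<le> \<omega>"
  shows "((\<lambda>t. \<integral>x. \<psi> (a * (\<Sum>j\<in>S. (y(k := t)) j * e j x)) * w x \<partial>torus) has_real_derivative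
      (\<integral>x. \<psi>' (a * (\<Sum>j\<in>S. (y(k := t)) j * e j x)) * ((if k \<in> S then a * e k x else 0) * w x) \<partial>torus)) (at t)"
    and "continuous_on UNIV (\<lambda>t. \<integral>x. \<psi>' (a * (\<Sum>j\<in>S. (y(k := t)) j * e j x)) *
      ((if k \<in> S then a * e k x else 0) * w x) \<partial>torus)"
proof -
  let ?A = "\<lambda>x. a * (\<Sum>j\<in>S - {k}. y j * e j x)" and ?b = "\<lambda>x. if k \<in> S then a * e k x else 0"
  have line: "a * (\<Sum>j\<in>S. (y(k := t)) j * e j x) = ?A x + t * ?b x" for t x
  proof (cases "k \<in> S")
    case True
    have r: "(\<Sum>j\<in>S - {k}. (y(k := t)) j * e j x) = (\<Sum>j\<in>S - {k}. y j * e j x)" by (intro sum.cong) auto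
    show ?thesis unfolding sum.remove[OF S True] r using True by (simp add: algebra_simps)
  next
    case False
    then show ?thesis by (auto intro!: sum.cong)
  qed
  have A: "\<bar>?A x\<bar> \<le> \<bar>a\<bar> * (\<Sum>j\<in>S - {k}. \<bar>y j\<bar>)" for x
    unfolding abs_mult by (intro mult_left_mono span_bounded) simp
  have b: "\<bar>?b x\<bar> \<le> \<bar>a\<bar>" for x using abs_e_le[of k x] by (auto simp: abs_mult mult_left_le)
  have bw: "\<bar>?b x * w x\<bar> \<le> \<bar>a\<bar> * \<omega>" for x
    unfolding abs_mult by (intro mult_mono b w) auto
  have [measurable]: "?A \<in> borel_measurable torus" "?b \<in> borel_measurable torus" "w \<in> borel_measurable torus"
    by measurable
  show "((\<lambda>t. \<integral>x. \<psi> (a * (\<Sum>j\<in>S. (y(k := t)) j * e j x)) * w x \<partial>torus) has_real_derivative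
      (\<integral>x. \<psi>' (a * (\<Sum>j\<in>S. (y(k := t)) j * e j x)) * (?b x * w x) \<partial>torus)) (at t)"
    unfolding line by (rule torus.integral_line_derivative[OF der \<psi>' _ _ _ A b w]) measurable
  show "continuous_on UNIV (\<lambda>t. \<integral>x. \<psi>' (a * (\<Sum>j\<in>S. (y(k := t)) j * e j x)) * (?b x * w x) \<partial>torus)"
    unfolding line by (rule torus.integral_line_continuous[OF \<psi>' _ _ _ A b bw]) measurable
qed

lemma wick_integral_measurable:
  assumes \<psi>: "continuous_on UNIV \<psi>" and [measurable]: "w \<in> borel_measurable borel"
  shows "(\<lambda>z. \<integral>x. \<psi> (a * (\<Sum>j\<in>S. z j * e j x)) * w x \<partial>torus :: real) \<in> borel_measurable seq_borel"
proof -
  have [measurable]: "\<psi> \<in> borel_measurable borel" by (rule borel_measurable_continuous_onI[OF \<psi>])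
  have [measurable]: "e k \<in> borel_measurable torus" for k by measurable
  have [measurable]: "w \<in> borel_measurable torus" by measurable
  show ?thesis by measurable
qed

text \<open>The only property of the two Wick functions that closability needs.\<close>

definition line_regular :: "(int \<times> int \<Rightarrow> real) measure \<Rightarrow> real \<Rightarrow> ((int \<times> int \<Rightarrow> real) \<Rightarrow> real) \<Rightarrow> int \<times> int \<Rightarrow>
    ((int \<times> int \<Rightarrow> real) \<Rightarrow> real) \<Rightarrow> bool" where
  "line_regular \<mu> c W k D \<longleftrightarrow> W \<in> borel_measurable seq_borel \<and>
     D \<in> borel_measurable seq_borel \<and>
     (\<forall>y t. ((\<lambda>t. W (y(k := t))) has_real_derivative D (y(k := t))) (at t)) \<and>
     (\<forall>y. continuous_on UNIV (\<lambda>t. D (y(k := t)))) \<and>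
     (\<integral>\<^sup>+z. ennreal ((D z)\<^sup>2) \<partial>\<mu>) \<le> ennreal c * (\<integral>\<^sup>+z. ennreal ((W z)\<^sup>2) \<partial>\<mu>)"

lemma proj_finite_sum: "\<exists>S. finite S \<and> (\<forall>z x. proj \<Lambda> N z x = (\<Sum>k\<in>S. z k * e k x))"
proof (cases "finite {k. lat k \<in> (\<lambda>y. real N *\<^sub>R y) ` \<Lambda>}")
  case True
  then show ?thesis unfolding proj_def by blast
next
  case False
  \<comment> \<open>A sum over an infinite set is 0 by convention, as is the sum over the empty
    set.\<close>
  then show ?thesis unfolding proj_def by (intro exI[of _ "{}"]) simp
qed

text \<open>The lower bound makes the weight of the exponential at most 1, the upper one makes the
  weight of the cosine bounded. Growth of \<open>card S\<close> with the cutoff is harmless: it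
  serves boundedness at a fixed cutoff, while the constant that has to be uniform is the
  \<open>a\<^sup>2\<close> in \<open>line_regular\<close>.\<close>

lemma proj_variance_bound: "0 \<le> (\<Sum>k\<in>S. 1 / lam k * (e k x)\<^sup>2)" "(\<Sum>k\<in>S. 1 / lam k * (e k x)\<^sup>2) \<le> real (card S)"
proof -
  have "1 / lam k * (e k x)\<^sup>2 \<le> 1" "0 \<le> 1 / lam k * (e k x)\<^sup>2" for k
  proof -
    have "(e k x)\<^sup>2 \<le> 1" using abs_e_le[of k x] by (simp add: abs_square_le_1)
    then show "1 / lam k * (e k x)\<^sup>2 \<le> 1" using lam_ge_1[of k] by (simp add: divide_le_eq_1)
    show "0 \<le> 1 / lam k * (e k x)\<^sup>2" using lam_ge_1[of k] by simp
  qed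
  then show "0 \<le> (\<Sum>k\<in>S. 1 / lam k * (e k x)\<^sup>2)" "(\<Sum>k\<in>S. 1 / lam k * (e k x)\<^sup>2) \<le> real (card S)"
    using sum_bounded_above[of S "\<lambda>k. 1 / lam k * (e k x)\<^sup>2" 1] by (auto intro: sum_nonneg)
qed

text \<open>The counterterm does not depend on z and is absorbed into the weight w. Differentiation
  multiplies the nonnegative integrand by a factor of modulus at most |a|, so the bound holds for
  every z and can be integrated directly.\<close>

lemma wick_exp_line_regular:
  assumes ff: "free_field \<delta> \<mu>0"
  shows "\<exists>D. line_regular \<mu>0 (a\<^sup>2) (wick_exp_cutoff \<mu>0 \<Lambda> a (\<lambda>_. 1) N) k D"
proof -
  obtain S where S: "finite S" and proj: "\<And>z x. proj \<Lambda> N z x = (\<Sum>k\<in>S. z k * e k x)"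
    using proj_finite_sum by blast
  define w where "w x = exp (- (a\<^sup>2 / 2 * (\<Sum>k\<in>S. 1 / lam k * (e k x)\<^sup>2)))" for x
  have w0: "0 \<le> w x" and w1: "\<bar>w x\<bar> \<le> 1" for x
    using proj_variance_bound(1)[where S = S and x = x] by (auto simp: w_def)
  have [measurable]: "w \<in> borel_measurable borel" unfolding w_def by measurable
  have [measurable]: "w \<in> borel_measurable torus" by measurable
  let ?b = "\<lambda>x. if k \<in> S then a * e k x else 0"
  have b: "\<bar>?b x\<bar> \<le> \<bar>a\<bar>" for x using abs_e_le[of k x] by (auto simp: abs_mult mult_left_le)
  have W: "wick_exp_cutoff \<mu>0 \<Lambda> a (\<lambda>_. 1) N = (\<lambda>z. \<integral>x. exp (a * (\<Sum>j\<in>S. z j * e j x)) * w x \<partial>torus)"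
    unfolding wick_exp_cutoff_def proj free_field_second_moment[OF ff S] w_def
    by (simp add: mult_exp_exp)
  let ?W = "\<lambda>z. \<integral>x. exp (a * (\<Sum>j\<in>S. z j * e j x)) * w x \<partial>torus"
  let ?D = "\<lambda>z. \<integral>x. exp (a * (\<Sum>j\<in>S. z j * e j x)) * (?b x * w x) \<partial>torus"
  have ec: "continuous_on UNIV (exp :: real \<Rightarrow> real)" by (intro continuous_intros)
  have Wm[measurable]: "?W \<in> borel_measurable seq_borel"
    by (rule wick_integral_measurable[OF ec]) measurable
  have [measurable]: "?D \<in> borel_measurable seq_borel"
    by (rule wick_integral_measurable[OF ec]) measurable
  let ?E = "\<lambda>z x. exp (a * (\<Sum>j\<in>S. z j * e j x))"
  have le: "(?D z)\<^sup>2 \<le> a\<^sup>2 * (?W z)\<^sup>2" for z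
  proof -
    have E: "?E z x \<le> exp (\<bar>a\<bar> * (\<Sum>j\<in>S. \<bar>z j\<bar>))" for x
    proof -
      have "\<bar>a * (\<Sum>j\<in>S. z j * e j x)\<bar> \<le> \<bar>a\<bar> * (\<Sum>j\<in>S. \<bar>z j\<bar>)"
        unfolding abs_mult by (intro mult_left_mono span_bounded) simp
      then show ?thesis by (simp add: abs_le_iff)
    qed
    have bw: "\<bar>?b x * w x\<bar> \<le> \<bar>a\<bar> * 1" for x unfolding abs_mult by (intro mult_mono b w1) auto
    have i: "integrable torus (\<lambda>x. ?E z x * w x)"
    proof (rule integrable_torus_bounded)
      show "\<bar>?E z x * w x\<bar> \<le> exp (\<bar>a\<bar> * (\<Sum>j\<in>S. \<bar>z j\<bar>)) * 1" for x
        unfolding abs_mult using E[of x] w1[of x] by (intro mult_mono) auto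
    qed measurable
    have i': "integrable torus (\<lambda>x. ?E z x * (?b x * w x))"
    proof (rule integrable_torus_bounded)
      show "\<bar>?E z x * (?b x * w x)\<bar> \<le> exp (\<bar>a\<bar> * (\<Sum>j\<in>S. \<bar>z j\<bar>)) * (\<bar>a\<bar> * 1)" for x
        unfolding abs_mult[of "exp _"] using E[of x] bw[of x] by (intro mult_mono) auto
    qed measurable
    have "\<bar>?D z\<bar> \<le> (\<integral>x. \<bar>a\<bar> * (?E z x * w x) \<partial>torus)"
    proof (rule integral_abs_bound_integral[OF i' integrable_mult_right[OF i]])
      fix x
      have "\<bar>?b x\<bar> * (?E z x * w x) \<le> \<bar>a\<bar> * (?E z x * w x)"
        using b[of x] w0[of x] by (intro mult_right_mono) auto
      then show "\<bar>?E z x * (?b x * w x)\<bar> \<le> \<bar>a\<bar> * (?E z x * w x)"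
        using w0[of x] by (simp add: abs_mult ac_simps)
    qed
    also have "\<dots> = \<bar>a\<bar> * ?W z" by simp
    finally have "\<bar>?D z\<bar>\<^sup>2 \<le> (\<bar>a\<bar> * ?W z)\<^sup>2" by (rule power_mono) simp
    then show ?thesis by (simp add: power_mult_distrib)
  qed
  have id: "(\<lambda>z. z) \<in> \<mu>0 \<rightarrow>\<^sub>M seq_borel"
    by (rule measurable_PiM_single') (use free_field_coordinate[OF ff] in auto)
  have "line_regular \<mu>0 (a\<^sup>2) ?W k ?D"
    unfolding line_regular_def
  proof (intro conjI allI)
    show "((\<lambda>t. ?W (y(k := t))) has_real_derivative ?D (y(k := t))) (at t)" for y t
      by (rule wick_line_derivative(1)[OF S _ ec _ w1]) (auto intro: DERIV_exp)
    show "continuous_on UNIV (\<lambda>t. ?D (y(k := t)))" for y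
      by (rule wick_line_derivative(2)[OF S _ ec _ w1]) (auto intro: DERIV_exp)
    have "(\<integral>\<^sup>+z. ennreal ((?D z)\<^sup>2) \<partial>\<mu>0) \<le> (\<integral>\<^sup>+z. ennreal (a\<^sup>2) * ennreal ((?W z)\<^sup>2) \<partial>\<mu>0)"
      by (intro nn_integral_mono) (use le in \<open>simp add: ennreal_mult[symmetric] ennreal_leI\<close>)
    also have "\<dots> = ennreal (a\<^sup>2) * (\<integral>\<^sup>+z. ennreal ((?W z)\<^sup>2) \<partial>\<mu>0)"
      by (intro nn_integral_cmult measurable_compose[OF _ measurable_ennreal]
          borel_measurable_power measurable_compose[OF id Wm])
    finally show "(\<integral>\<^sup>+z. ennreal ((?D z)\<^sup>2) \<partial>\<mu>0) \<le> ennreal (a\<^sup>2) * (\<integral>\<^sup>+z. ennreal ((?W z)\<^sup>2) \<partial>\<mu>0)" .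
  qed measurable
  then show ?thesis unfolding W by blast
qed

text \<open>Unlike for the exponential, the derivative is controlled only after integration over the
  field. Integrability of both squares at fixed cutoff is needed to turn that inequality into one
  between \<open>nn_integral\<close>s.\<close>

lemma wick_cos_line_regular:
  assumes ff: "free_field \<delta> \<mu>0"
  shows "\<exists>D. line_regular \<mu>0 (a\<^sup>2) (wick_cos_cutoff \<mu>0 \<Lambda> a (\<lambda>_. 1) N) k D"
proof -
  interpret prob_space \<mu>0 using ff by (simp add: free_field_def)
  obtain S where S: "finite S" and proj: "\<And>z x. proj \<Lambda> N z x = (\<Sum>k\<in>S. z k * e k x)"
    using proj_finite_sum by blast
  define w where "w x = exp (a\<^sup>2 / 2 * (\<Sum>k\<in>S. 1 / lam k * (e k x)\<^sup>2))" for x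
  let ?\<omega> = "exp (a\<^sup>2 / 2 * real (card S))"
  have w0: "0 \<le> w x" and w1: "w x \<le> ?\<omega>" for x
    using proj_variance_bound(2)[where S = S and x = x] by (auto simp: w_def intro!: mult_left_mono)
  have w2: "\<bar>w x\<bar> \<le> ?\<omega>" for x using w0[of x] w1[of x] by simp
  have [measurable]: "w \<in> borel_measurable borel" unfolding w_def by measurable
  let ?b = "\<lambda>x. if k \<in> S then a * e k x else 0"
  have b: "\<bar>?b x\<bar> \<le> \<bar>a\<bar>" for x using abs_e_le[of k x] by (auto simp: abs_mult mult_left_le)
  have W: "wick_cos_cutoff \<mu>0 \<Lambda> a (\<lambda>_. 1) N = (\<lambda>z. \<integral>x. cos (a * (\<Sum>j\<in>S. z j * e j x)) * w x \<partial>torus)"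
    unfolding wick_cos_cutoff_def proj free_field_second_moment[OF ff S] w_def by simp
  let ?W = "\<lambda>z. \<integral>x. cos (a * (\<Sum>j\<in>S. z j * e j x)) * w x \<partial>torus"
  let ?D = "\<lambda>z. \<integral>x. - sin (a * (\<Sum>j\<in>S. z j * e j x)) * (?b x * w x) \<partial>torus"
  have cc: "continuous_on UNIV (cos :: real \<Rightarrow> real)" "continuous_on UNIV (\<lambda>u::real. - sin u)"
    by (intro continuous_intros)+
  have Wm: "?W \<in> borel_measurable seq_borel"
    by (rule wick_integral_measurable[OF cc(1)]) measurable
  have Dm: "?D \<in> borel_measurable seq_borel"
    by (rule wick_integral_measurable[OF cc(2)]) measurable
  have id: "(\<lambda>z. z) \<in> \<mu>0 \<rightarrow>\<^sub>M seq_borel"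
    by (rule measurable_PiM_single') (use free_field_coordinate[OF ff] in auto)
  have bd: "integrable \<mu>0 (\<lambda>z. (\<integral>x. h (a * (\<Sum>j\<in>S. z j * e j x)) * c x \<partial>torus)\<^sup>2)"
    if [measurable]: "(\<lambda>z. \<integral>x. h (a * (\<Sum>j\<in>S. z j * e j x)) * c x \<partial>torus) \<in> borel_measurable \<mu>0"
      "h \<in> borel_measurable borel" "c \<in> borel_measurable borel"
      and h: "\<And>u. \<bar>h u\<bar> \<le> 1" and c: "\<And>x. \<bar>c x\<bar> \<le> C" for h c :: "_ \<Rightarrow> real" and C
  proof -
    have "\<bar>\<integral>x. h (a * (\<Sum>j\<in>S. z j * e j x)) * c x \<partial>torus\<bar> \<le> (\<integral>x. C \<partial>torus)" for z
    proof (rule integral_abs_bound_integral)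
      have *: "\<bar>h (a * (\<Sum>j\<in>S. z j * e j x)) * c x\<bar> \<le> C" for x
        using mult_mono[OF h[of "a * (\<Sum>j\<in>S. z j * e j x)"] c[of x]] by (simp add: abs_mult)
      then show "\<bar>h (a * (\<Sum>j\<in>S. z j * e j x)) * c x\<bar> \<le> C" for x .
      show "integrable torus (\<lambda>x. h (a * (\<Sum>j\<in>S. z j * e j x)) * c x)"
        by (rule integrable_torus_bounded[OF _ *]) measurable
    qed simp
    from power_mono[OF this abs_ge_zero, where n = 2] show ?thesis
      by (intro integrable_const_bound[where B = "(\<integral>x. C \<partial>torus)\<^sup>2"]) auto
  qed
  have bw: "\<bar>?b x * w x\<bar> \<le> \<bar>a\<bar> * ?\<omega>" for x unfolding abs_mult by (intro mult_mono b w2) auto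
  have iW: "integrable \<mu>0 (\<lambda>z. (?W z)\<^sup>2)" by (rule bd[OF measurable_compose[OF id Wm] _ _ _ w2]) auto
  have iD: "integrable \<mu>0 (\<lambda>z. (?D z)\<^sup>2)" by (rule bd[OF measurable_compose[OF id Dm] _ _ _ bw]) auto
  have le: "(\<integral>z. (?D z)\<^sup>2 \<partial>\<mu>0) \<le> a\<^sup>2 * (\<integral>z. (?W z)\<^sup>2 \<partial>\<mu>0)"
  proof -
    have "(\<integral>z. (\<integral>x. sin (a * (\<Sum>k\<in>S. z k * e k x)) * (?b x * w x) \<partial>torus)\<^sup>2 \<partial>\<mu>0) \<le> \<bar>a\<bar>\<^sup>2 * (\<integral>z. (?W z)\<^sup>2 \<partial>\<mu>0)"
    proof (rule wick_cos_derivative_bound[OF prob_space_axioms free_field_coordinate[OF ff] S _ _ _ w0 w1 b])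
      show "0 \<le> (\<integral>z. cos (\<Sum>k\<in>S. z k * c k) \<partial>\<mu>0)" for c
        using free_field_cos[OF ff S, of c 0] by simp
    qed measurable
    then show ?thesis by simp
  qed
  have "line_regular \<mu>0 (a\<^sup>2) ?W k ?D"
    unfolding line_regular_def
  proof (intro conjI allI Wm Dm)
    show "((\<lambda>t. ?W (y(k := t))) has_real_derivative ?D (y(k := t))) (at t)" for y t
      by (rule wick_line_derivative(1)[OF S _ cc(2) _ w2]) (auto intro: DERIV_cos)
    show "continuous_on UNIV (\<lambda>t. ?D (y(k := t)))" for y
      by (rule wick_line_derivative(2)[OF S DERIV_cos cc(2) _ w2]) auto
    show "(\<integral>\<^sup>+z. ennreal ((?D z)\<^sup>2) \<partial>\<mu>0) \<le> ennreal (a\<^sup>2) * (\<integral>\<^sup>+z. ennreal ((?W z)\<^sup>2) \<partial>\<mu>0)"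
      unfolding nn_integral_eq_integral[OF iW AE_I2[OF zero_le_power2]] nn_integral_eq_integral[OF iD AE_I2[OF zero_le_power2]]
      using le by (subst ennreal_mult[symmetric]) (auto intro: ennreal_leI)
  qed
  then show ?thesis unfolding W by blast
qed

section \<open>Cylinder functions\<close>

lemma mean_value_unordered:
  fixes g g' :: "real \<Rightarrow> real"
  assumes "\<And>t. (g has_real_derivative g' t) (at t)"
  shows "\<exists>\<xi>. \<bar>\<xi> - a\<bar> \<le> \<bar>b - a\<bar> \<and> g b - g a = (b - a) * g' \<xi>"
proof -
  consider "a < b" | "b < a" | "a = b" by linarith
  then show ?thesis
  proof cases
    case 1
    then obtain \<xi> where "a < \<xi>" "\<xi> < b" "g b - g a = (b - a) * g' \<xi>" using MVT2[of a b g g'] assms by blast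
    then show ?thesis by (intro exI[of _ \<xi>]) auto
  next
    case 2
    then obtain \<xi> where \<xi>: "b < \<xi>" "\<xi> < a" "g a - g b = (a - b) * g' \<xi>" using MVT2[of b a g g'] assms by blast
    from \<xi>(3) have "g b - g a = (b - a) * g' \<xi>" by (simp add: algebra_simps)
    with \<xi> show ?thesis by (intro exI[of _ \<xi>]) auto
  qed auto
qed

lemma Cb_infinityD:
  assumes "f \<in> Cb_infinity n"
  shows "\<And>x y. (\<And>i. i < n \<Longrightarrow> x i = y i) \<Longrightarrow> f x = f y"
    and "continuous_on UNIV f"
    and "\<And>j. j < n \<Longrightarrow> continuous_on UNIV (partial j f)"
    and "\<And>j. j < n \<Longrightarrow> bounded (range (partial j f))"
    and "\<And>j x. j < n \<Longrightarrow> ((\<lambda>t. f (x(j := t))) has_real_derivative partial j f (x(j := t))) (at t)"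
proof -
  have dep: "\<forall>x y. (\<forall>i<n. x i = y i) \<longrightarrow> f x = f y"
    and js: "set js \<subseteq> {..<n} \<Longrightarrow> continuous_on UNIV (foldr partial js f) \<and> bounded (range (foldr partial js f)) \<and>
        (\<forall>j<n. \<forall>x. (\<lambda>t. foldr partial js f (x(j := t))) differentiable at (x j))" for js
    using assms unfolding Cb_infinity_def by blast+
  show "\<And>x y. (\<And>i. i < n \<Longrightarrow> x i = y i) \<Longrightarrow> f x = f y" using dep by blast
  show "continuous_on UNIV f" using js[of "[]"] by simp
  show "\<And>j. j < n \<Longrightarrow> continuous_on UNIV (partial j f)" using js[of "[_]"] by simp
  show "\<And>j. j < n \<Longrightarrow> bounded (range (partial j f))" using js[of "[_]"] by simp
  show "((\<lambda>t. f (x(j := t))) has_real_derivative partial j f (x(j := t))) (at t)" if "j < n" for j x t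
  proof -
    have "(\<lambda>s. f ((x(j := t))(j := s))) differentiable at ((x(j := t)) j)"
      using js[of "[]"] that by (metis empty_subsetI foldr_Nil id_apply list.set(1))
    then have "(\<lambda>s. f (x(j := s))) differentiable at t" by simp
    then have "((\<lambda>s. f (x(j := s))) has_real_derivative deriv (\<lambda>s. f (x(j := s))) t) (at t)"
      by (metis DERIV_deriv_iff_real_differentiable)
    then show ?thesis by (simp add: partial_def)
  qed
qed

text \<open>\<open>Cb_infinity\<close> speaks of partial derivatives only, so the chain rule is
  built up one coordinate at a time: \<open>v m h\<close> has its first m coordinates moved, and the
  step from m to m + 1 is evaluated by the mean value theorem.\<close>

lemma Cb_infinity_directional_derivative_at_0:
  assumes f: "f \<in> Cb_infinity n"
  shows "((\<lambda>h. f (\<lambda>i. y i + h * c i)) has_real_derivative (\<Sum>j<n. c j * partial j f y)) (at 0)"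
proof -
  define v where "v m h = (\<lambda>i. if i < m then y i + h * c i else y i)" for m h
  have v0: "v m 0 = y" for m by (auto simp: v_def)
  have "((\<lambda>h. f (v m h)) has_real_derivative (\<Sum>j<m. c j * partial j f y)) (at 0)" if "m \<le> n" for m
    using that
  proof (induction m)
    case 0
    then show ?case by (simp add: v_def)
  next
    case (Suc m)
    then have m: "m < n" by simp
    \<comment> \<open>Joint continuity in both arguments is needed: as h tends to 0, the
      intermediate point \<open>\<xi> h\<close> and the base point \<open>v m h\<close> move
      simultaneously.\<close>
    define \<psi> where "\<psi> p = partial m f ((v m (fst p))(m := snd p))" for p :: "real \<times> real"
    have "continuous_on UNIV (\<lambda>p::real \<times> real. (v m (fst p))(m := snd p))"
    proof (rule continuous_on_coordinatewise_then_product)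
      fix i
      show "continuous_on UNIV (\<lambda>p::real \<times> real. ((v m (fst p))(m := snd p)) i)"
        unfolding v_def by (cases "i = m"; cases "i < m") (auto intro!: continuous_intros)
    qed
    then have cont: "continuous_on UNIV \<psi>"
      unfolding \<psi>_def using continuous_on_compose2[OF Cb_infinityD(3)[OF f m]] by blast
    have vm: "v m h m = y m" "(v m h)(m := y m) = v m h" "(v m h)(m := y m + h * c m) = v (Suc m) h" for h
      by (auto simp: v_def fun_eq_iff less_Suc_eq)
    have "\<forall>h. \<exists>\<xi>. \<bar>\<xi> - y m\<bar> \<le> \<bar>h * c m\<bar> \<and> f (v (Suc m) h) - f (v m h) = (h * c m) * \<psi> (h, \<xi>)"
    proof
      fix h
      show "\<exists>\<xi>. \<bar>\<xi> - y m\<bar> \<le> \<bar>h * c m\<bar> \<and> f (v (Suc m) h) - f (v m h) = (h * c m) * \<psi> (h, \<xi>)"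
        using mean_value_unordered[OF Cb_infinityD(5)[OF f m, of "v m h"], of "y m" "y m + h * c m"]
        by (simp add: vm \<psi>_def)
    qed
    then obtain \<xi> where \<xi>: "\<And>h. \<bar>\<xi> h - y m\<bar> \<le> \<bar>h * c m\<bar>"
      and d: "\<And>h. f (v (Suc m) h) - f (v m h) = (h * c m) * \<psi> (h, \<xi> h)" by metis
    have "((\<lambda>h. \<xi> h - y m) \<longlongrightarrow> 0) (at 0)"
    proof (rule Lim_null_comparison)
      show "\<forall>\<^sub>F h in at 0. norm (\<xi> h - y m) \<le> \<bar>h * c m\<bar>" using \<xi> by simp
      show "((\<lambda>h. \<bar>h * c m\<bar>) \<longlongrightarrow> 0) (at 0)" by (intro tendsto_eq_intros) auto
    qed
    then have "(\<xi> \<longlongrightarrow> y m) (at 0)" by (simp add: LIM_zero_iff)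
    then have "((\<lambda>h. (h, \<xi> h)) \<longlongrightarrow> (0, y m)) (at 0)" by (intro tendsto_intros)
    then have "((\<lambda>h. \<psi> (h, \<xi> h)) \<longlongrightarrow> \<psi> (0, y m)) (at 0)"
      by (rule continuous_on_tendsto_compose[OF cont]) auto
    then have "((\<lambda>h. c m * \<psi> (h, \<xi> h)) \<longlongrightarrow> c m * partial m f y) (at 0)"
      by (auto intro!: tendsto_intros simp: \<psi>_def v0)
    moreover have "\<forall>\<^sub>F h in at 0. c m * \<psi> (h, \<xi> h) =
        ((f (v (Suc m) h) - f (v m h)) - (f (v (Suc m) 0) - f (v m 0))) / (h - 0)"
      by (auto simp: eventually_at_filter d v0)
    ultimately have "((\<lambda>h. f (v (Suc m) h) - f (v m h)) has_real_derivative c m * partial m f y) (at 0)"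
      unfolding has_field_derivative_iff using tendsto_cong by fast
    from DERIV_add[OF this Suc.IH] Suc.prems show ?case by (simp add: add.commute)
  qed
  from this[of n] have "((\<lambda>h. f (v n h)) has_real_derivative (\<Sum>j<n. c j * partial j f y)) (at 0)" by simp
  moreover have "f (v n h) = f (\<lambda>i. y i + h * c i)" for h
    by (rule Cb_infinityD(1)[OF f]) (simp add: v_def)
  ultimately show ?thesis by simp
qed

lemma Cb_infinity_directional_derivative:
  assumes f: "f \<in> Cb_infinity n"
  shows "((\<lambda>t. f (\<lambda>i. y i + t * c i)) has_real_derivative (\<Sum>j<n. c j * partial j f (\<lambda>i. y i + t * c i))) (at t)"
proof -
  have "((\<lambda>h. f (\<lambda>i. y i + (t + h) * c i)) has_real_derivative (\<Sum>j<n. c j * partial j f (\<lambda>i. y i + t * c i))) (at 0)"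
    using Cb_infinity_directional_derivative_at_0[OF f, of "\<lambda>i. y i + t * c i" c] by (simp add: algebra_simps)
  then show ?thesis
    using DERIV_at_within_shift[of "\<lambda>s. f (\<lambda>i. y i + s * c i)" _ t 0 UNIV] by (simp add: add.commute)
qed

lemma partial_independent:
  assumes f: "f \<in> Cb_infinity n" and "\<And>i. i < n \<Longrightarrow> x i = y i" and "j < n"
  shows "partial j f x = partial j f y"
proof -
  have "f (x(j := t)) = f (y(j := t))" for t by (rule Cb_infinityD(1)[OF f]) (use assms in auto)
  with assms show ?thesis by (simp add: partial_def)
qed

text \<open>A family closed under all partial derivatives turns statements about iterated derivatives into
  statements about one derivative.\<close>

lemma Cb_infinityI:
  assumes "f \<in> U" and dep: "\<And>x y. (\<And>i. i < n \<Longrightarrow> x i = y i) \<Longrightarrow> f x = f y"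
    and U: "\<And>u. u \<in> U \<Longrightarrow> continuous_on UNIV u" "\<And>u. u \<in> U \<Longrightarrow> bounded (range u)"
      "\<And>u j x. u \<in> U \<Longrightarrow> (\<lambda>t. u (x(j := t))) differentiable at (x j)" "\<And>u j. u \<in> U \<Longrightarrow> partial j u \<in> U"
  shows "f \<in> Cb_infinity n"
proof -
  have "foldr partial js f \<in> U" for js
    by (induction js) (simp_all add: assms(1) U(4))
  with U have "continuous_on UNIV (foldr partial js f)" "bounded (range (foldr partial js f))"
    "(\<lambda>t. foldr partial js f (x(j := t))) differentiable at (x j)" for js x j by blast+
  then show ?thesis unfolding Cb_infinity_def mem_Collect_eq by (intro conjI allI impI dep) auto
qed

text \<open>The converse of \<open>Cb_infinityI\<close>. The family consists of the iterated
  derivatives along indices below n; the zero function is added because derivatives along the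
  remaining indices vanish.\<close>

lemma Cb_infinity_closed_family:
  assumes f: "f \<in> Cb_infinity n"
  obtains U where "f \<in> U" "(\<lambda>_. 0) \<in> U" "\<And>u. u \<in> U \<Longrightarrow> continuous_on UNIV u" "\<And>u. u \<in> U \<Longrightarrow> bounded (range u)"
      "\<And>u j x. u \<in> U \<Longrightarrow> (\<lambda>t. u (x(j := t))) differentiable at (x j)" "\<And>u j. u \<in> U \<Longrightarrow> partial j u \<in> U"
proof
  let ?U = "insert (\<lambda>_. 0) {foldr partial js f |js. set js \<subseteq> {..<n}}"
  have js: "continuous_on UNIV (foldr partial js f) \<and> bounded (range (foldr partial js f)) \<and>
        (\<forall>j<n. \<forall>x. (\<lambda>t. foldr partial js f (x(j := t))) differentiable at (x j))" if "set js \<subseteq> {..<n}" for js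
    using f that unfolding Cb_infinity_def by blast
  have dep: "foldr partial js f x = foldr partial js f y" if "set js \<subseteq> {..<n}" "\<And>i. i < n \<Longrightarrow> x i = y i" for js x y
    using that
  proof (induction js arbitrary: x y)
    case Nil
    then show ?case using Cb_infinityD(1)[OF f, of x y] by simp
  next
    case (Cons j js)
    have "foldr partial js f (x(j := t)) = foldr partial js f (y(j := t))" for t
      by (rule Cons.IH) (use Cons.prems in auto)
    with Cons.prems show ?case by (simp add: partial_def[of j "foldr partial js f"])
  qed
  have const: "foldr partial js f (x(j := t)) = foldr partial js f x" if "set js \<subseteq> {..<n}" "\<not> j < n" for js x j t
    by (rule dep) (use that in auto)
  show "f \<in> ?U" by (auto intro!: exI[of _ "[]"])
  show "(\<lambda>_. 0) \<in> ?U" by simp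
  show "continuous_on UNIV u" if "u \<in> ?U" for u using that js by auto
  show "bounded (range u)" if "u \<in> ?U" for u using that js by auto
  show "(\<lambda>t. u (x(j := t))) differentiable at (x j)" if u: "u \<in> ?U" for u j x
  proof (cases "u = (\<lambda>_. 0)")
    case False
    then obtain js where u: "u = foldr partial js f" "set js \<subseteq> {..<n}" using u by blast
    show ?thesis
    proof (cases "j < n")
      case True
      then show ?thesis using js[OF u(2)] u(1) by blast
    next
      case False
      then have "(\<lambda>t. u (x(j := t))) = (\<lambda>t. u x)" using const[OF u(2)] u(1) by auto
      then show ?thesis by simp
    qed
  qed simp
  show "partial j u \<in> ?U" if u: "u \<in> ?U" for u j
  proof (cases "u = (\<lambda>_. 0)")
    case True
    then have "partial j u = (\<lambda>_. 0)" by (auto simp: partial_def)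
    then show ?thesis by simp
  next
    case False
    then obtain js where u: "u = foldr partial js f" "set js \<subseteq> {..<n}" using u by blast
    show ?thesis
    proof (cases "j < n")
      case True
      then have "partial j u = foldr partial (j # js) f" "set (j # js) \<subseteq> {..<n}" using u by auto
      then show ?thesis by blast
    next
      case False
      have "partial j u = (\<lambda>_. 0)"
      proof
        fix x
        have "(\<lambda>t. u (x(j := t))) = (\<lambda>t. u x)" using const[OF u(2) False] u(1) by auto
        then show "partial j u x = 0" by (simp add: partial_def)
      qed
      then show ?thesis by simp
    qed
  qed
qed

text \<open>The variables of f and g are concatenated, so that two cylinder functions with unrelated
  test functions can be subtracted. The closed family consists of the differences of members of the
  two given families.\<close>

lemma Cb_infinity_diff_shift:
  assumes f: "f \<in> Cb_infinity n" and g: "g \<in> Cb_infinity m"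
  shows "(\<lambda>x. f x - g (\<lambda>i. x (n + i))) \<in> Cb_infinity (n + m)"
proof -
  obtain U where U: "f \<in> U" "(\<lambda>_. 0) \<in> U" "\<And>u. u \<in> U \<Longrightarrow> continuous_on UNIV u" "\<And>u. u \<in> U \<Longrightarrow> bounded (range u)"
      "\<And>u j x. u \<in> U \<Longrightarrow> (\<lambda>t. u (x(j := t))) differentiable at (x j)" "\<And>u j. u \<in> U \<Longrightarrow> partial j u \<in> U"
    using Cb_infinity_closed_family[OF f] by blast
  obtain V where V: "g \<in> V" "(\<lambda>_. 0) \<in> V" "\<And>u. u \<in> V \<Longrightarrow> continuous_on UNIV u" "\<And>u. u \<in> V \<Longrightarrow> bounded (range u)"
      "\<And>u j x. u \<in> V \<Longrightarrow> (\<lambda>t. u (x(j := t))) differentiable at (x j)" "\<And>u j. u \<in> V \<Longrightarrow> partial j u \<in> V"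
    using Cb_infinity_closed_family[OF g] by blast
  let ?sh = "\<lambda>x i. x (n + i) :: real"
  let ?w = "\<lambda>u v x. u x - v (?sh x) :: real"
  let ?W = "{?w u v |u v. u \<in> U \<and> v \<in> V}"
  have sh: "?sh (x(j := t)) = (if j < n then ?sh x else (?sh x)(j - n := t))" for x j t
    by (auto simp: fun_eq_iff)
  have vdiff: "(\<lambda>t. v (?sh (x(j := t)))) differentiable at (x j)" if "v \<in> V" for v x j
  proof (cases "j < n")
    case False
    then have "?sh x (j - n) = x j" by simp
    then show ?thesis using V(5)[OF that, of "?sh x" "j - n"] False by (simp only: sh if_False)
  qed (simp only: sh if_True differentiable_const)
  show ?thesis
  proof (rule Cb_infinityI[of _ ?W])
    show "?w f g \<in> ?W" using U V by blast
    show "?w f g x = ?w f g y" if "\<And>i. i < n + m \<Longrightarrow> x i = y i" for x y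
    proof -
      have "f x = f y" by (rule Cb_infinityD(1)[OF f]) (use that in auto)
      moreover have "g (?sh x) = g (?sh y)" by (rule Cb_infinityD(1)[OF g]) (use that in auto)
      ultimately show ?thesis by simp
    qed
  next
    fix w assume "w \<in> ?W"
    then obtain u v where w: "w = ?w u v" and u: "u \<in> U" and v: "v \<in> V" by blast
    have "continuous_on UNIV ?sh"
      by (intro continuous_on_coordinatewise_then_product) simp
    then have "continuous_on UNIV (\<lambda>x. v (?sh x))"
      using continuous_on_compose2[OF V(3)[OF v]] by blast
    then show "continuous_on UNIV w" unfolding w by (intro continuous_on_diff U(3)[OF u])
    show "bounded (range w)"
    proof -
      obtain A B where "\<And>x. norm (u x) \<le> A" "\<And>x. norm (v x) \<le> B"
        using U(4)[OF u] V(4)[OF v] by (auto simp: bounded_iff)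
      then have "norm (w x) \<le> A + B" for x
        unfolding w by (meson add_mono norm_triangle_ineq4 order_trans)
      then show ?thesis by (auto simp: bounded_iff)
    qed
    fix j
    show "(\<lambda>t. w (x(j := t))) differentiable at (x j)" for x
      unfolding w by (intro differentiable_diff U(5)[OF u] vdiff[OF v])
    show "partial j w \<in> ?W"
    proof -
      \<comment> \<open>Directions below n do not move the variables of g, those from n on act with
        index j - n.\<close>
      let ?v' = "if j < n then (\<lambda>_. 0) else partial (j - n) v"
      have "partial j w x = ?w (partial j u) ?v' x" for x
      proof -
        have "partial j w x = deriv (\<lambda>t. u (x(j := t))) (x j) - deriv (\<lambda>t. v (?sh (x(j := t)))) (x j)"
          unfolding partial_def w
          using U(5)[OF u, of x j] vdiff[OF v, of x j]
          by (intro DERIV_imp_deriv DERIV_diff) (simp_all add: DERIV_deriv_iff_real_differentiable)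
        moreover have "deriv (\<lambda>t. v (?sh (x(j := t)))) (x j) = ?v' (?sh x)"
          by (cases "j < n") (simp_all only: sh if_True if_False, simp_all add: partial_def)
        ultimately show ?thesis by (simp add: partial_def)
      qed
      then have "partial j w = ?w (partial j u) ?v'" by blast
      moreover have "?v' \<in> V" using V(2,6) v by auto
      ultimately show ?thesis using U(6)[OF u] by blast
    qed
  qed
qed

text \<open>Closability evaluates the form on differences \<open>F m - F n\<close>, and
  \<open>D_H\<close> is meaningful only for functions that have a representation.\<close>

lemma FCb_diff:
  assumes "F \<in> FCb \<delta>" and "G \<in> FCb \<delta>"
  shows "(\<lambda>z. F z - G z) \<in> FCb \<delta>"
proof -
  obtain n f \<phi> m g \<psi> where F: "cyl_rep \<delta> F n f \<phi>" and G: "cyl_rep \<delta> G m g \<psi>"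
    using assms unfolding FCb_def by blast
  let ?\<chi> = "\<lambda>j. if j < n then \<phi> j else \<psi> (j - n)"
  have "cyl_rep \<delta> (\<lambda>z. F z - G z) (n + m) (\<lambda>x. f x - g (\<lambda>i. x (n + i))) ?\<chi>"
    unfolding cyl_rep_def
  proof (intro conjI allI impI ballI)
    show "(\<lambda>x. f x - g (\<lambda>i. x (n + i))) \<in> Cb_infinity (n + m)"
      using F G by (intro Cb_infinity_diff_shift) (auto simp: cyl_rep_def)
    show "?\<chi> j \<in> K_span" if "j < n + m" for j using F G that by (auto simp: cyl_rep_def)
    fix z assume "z \<in> sobolev (- \<delta>)"
    then have "F z = f (\<lambda>j. pairing z (\<phi> j))" "G z = g (\<lambda>j. pairing z (\<psi> j))"
      using F G by (auto simp: cyl_rep_def)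
    moreover have "f (\<lambda>j. pairing z (\<phi> j)) = f (\<lambda>j. pairing z (?\<chi> j))"
      by (rule Cb_infinityD(1)[of f n]) (use F in \<open>auto simp: cyl_rep_def\<close>)
    ultimately show "F z - G z = f (\<lambda>j. pairing z (?\<chi> j)) - g (\<lambda>i. pairing z (?\<chi> (n + i)))" by simp
  qed
  then show ?thesis unfolding FCb_def by blast
qed

text \<open>Here \<open>F\<close> is a version of a cylinder function defined on all sequences, \<open>D k\<close> its derivative in
  direction \<open>e\<^sub>k\<close>, and \<open>S\<close> a set containing all coordinates on which it depends.\<close>

definition cylinder_data :: "((int \<times> int \<Rightarrow> real) \<Rightarrow> real) \<Rightarrow> (int \<times> int \<Rightarrow> (int \<times> int \<Rightarrow> real) \<Rightarrow> real) \<Rightarrow>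
    (int \<times> int) set \<Rightarrow> bool" where
  "cylinder_data F D S \<longleftrightarrow> finite S \<and> F \<in> borel_measurable seq_borel \<and>
     (\<forall>k. D k \<in> borel_measurable seq_borel) \<and>
     (\<forall>k y t. ((\<lambda>t. F (y(k := t))) has_real_derivative D k (y(k := t))) (at t)) \<and>
     (\<forall>k y. continuous_on UNIV (\<lambda>t. D k (y(k := t)))) \<and>
     (\<forall>k. \<exists>B. \<forall>z. \<bar>D k z\<bar> \<le> B) \<and> (\<forall>k z. k \<notin> S \<longrightarrow> D k z = 0)"

text \<open>The test functions are expanded over one common finite set S of modes, with coefficients
  \<open>d j k\<close>. The chain rule then gives the derivative in direction e_k as the sum over j
  of \<open>d j k\<close> times the j-th partial derivative, and exchanging the two sums recovers
  the gradient.\<close>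

lemma cyl_rep_data:
  assumes rep: "cyl_rep \<delta> F n f \<phi>"
  shows "\<exists>Ft D S. cylinder_data Ft D S \<and> (\<forall>z\<in>sobolev (- \<delta>). F z = Ft z) \<and>
    (\<forall>z. (\<lambda>x. \<Sum>j<n. partial j f (\<lambda>i. pairing z (\<phi> i)) * \<phi> j x) = (\<lambda>x. \<Sum>k\<in>S. D k z * e k x))"
proof -
  have f: "f \<in> Cb_infinity n" and \<phi>: "\<And>j. j < n \<Longrightarrow> \<phi> j \<in> K_span"
    and Ff: "\<And>z. z \<in> sobolev (- \<delta>) \<Longrightarrow> F z = f (\<lambda>j. pairing z (\<phi> j))"
    using rep by (auto simp: cyl_rep_def)
  have "\<forall>j. \<exists>S c. j < n \<longrightarrow> finite S \<and> \<phi> j = (\<lambda>x. \<Sum>k\<in>S. c k * e k x)"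
    using \<phi> unfolding K_span_def by blast
  then obtain T c where T: "\<And>j. j < n \<Longrightarrow> finite (T j)"
    and \<phi>_eq: "\<And>j. j < n \<Longrightarrow> \<phi> j = (\<lambda>x. \<Sum>k\<in>T j. c j k * e k x)" by metis
  define S where "S = (\<Union>j<n. T j)"
  have S: "finite S" unfolding S_def using T by auto
  define d where "d j k = (if j < n \<and> k \<in> T j then c j k else 0)" for j k
  have d0: "d j k = 0" if "k \<notin> S" for j k using that by (auto simp: d_def S_def)
  have \<phi>S: "\<phi> j = (\<lambda>x. \<Sum>k\<in>S. d j k * e k x)" if j: "j < n" for j
  proof
    fix x
    have "(\<Sum>k\<in>T j. c j k * e k x) = (\<Sum>k\<in>S. d j k * e k x)"
      by (rule sum.mono_neutral_cong_left) (use S j in \<open>auto simp: d_def S_def\<close>)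
    then show "\<phi> j x = (\<Sum>k\<in>S. d j k * e k x)" using \<phi>_eq[OF j] by simp
  qed
  have pair: "pairing z (\<phi> j) = (\<Sum>k\<in>S. z k * d j k)" if "j < n" for j z
    unfolding \<phi>S[OF that] by (rule pairing_span[OF S])
  \<comment> \<open>The finite sums replace the pairings. For indices from n on the two may differ,
    but f depends on the first n entries only.\<close>
  define L where "L z = (\<lambda>j. \<Sum>k\<in>S. z k * d j k)" for z :: "int \<times> int \<Rightarrow> real"
  have [measurable]: "L \<in> borel_measurable seq_borel"
    unfolding L_def by (rule measurable_coordinatewise_then_product) measurable
  define Ft where "Ft z = f (L z)" for z
  define D where "D k z = (\<Sum>j<n. d j k * partial j f (L z))" for k z
  have [measurable]: "f \<in> borel_measurable borel" by (rule borel_measurable_continuous_onI[OF Cb_infinityD(2)[OF f]])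
  have pm: "partial j f \<in> borel_measurable borel" if "j < n" for j
    by (rule borel_measurable_continuous_onI[OF Cb_infinityD(3)[OF f that]])
  define R where "R y k j = (\<Sum>i\<in>S - {k}. y i * d j i)" for y k j
  have line: "L (y(k := t)) = (\<lambda>j. R y k j + t * d j k)" for y k t
  proof
    fix j
    show "L (y(k := t)) j = R y k j + t * d j k"
    proof (cases "k \<in> S")
      case True
      have r: "(\<Sum>i\<in>S - {k}. (y(k := t)) i * d j i) = R y k j" unfolding R_def by (intro sum.cong) auto
      show ?thesis unfolding L_def sum.remove[OF S True] r by simp
    next
      case False
      then show ?thesis unfolding L_def R_def using d0[OF False] by (auto intro!: sum.cong)
    qed
  qed
  have cont_line: "continuous_on UNIV (\<lambda>t. L (y(k := t)))" for y k
    unfolding line by (intro continuous_on_coordinatewise_then_product continuous_intros)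
  have data: "cylinder_data Ft D S"
    unfolding cylinder_data_def
  proof (intro conjI allI impI)
    show "Ft \<in> borel_measurable seq_borel" unfolding Ft_def by measurable
    show "D k \<in> borel_measurable seq_borel" for k
      unfolding D_def by (intro borel_measurable_sum borel_measurable_times measurable_compose[OF _ pm]) auto
    show "((\<lambda>t. Ft (y(k := t))) has_real_derivative D k (y(k := t))) (at t)" for k y t
      unfolding Ft_def D_def line by (rule Cb_infinity_directional_derivative[OF f])
    show "continuous_on UNIV (\<lambda>t. D k (y(k := t)))" for k y
      unfolding D_def
    proof (intro continuous_on_sum continuous_on_mult continuous_on_const)
      fix j assume "j \<in> {..<n}"
      then show "continuous_on UNIV (\<lambda>t. partial j f (L (y(k := t))))"
        using continuous_on_compose2[OF Cb_infinityD(3)[OF f] cont_line[of y k]] by auto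
    qed
    show "\<exists>B. \<forall>z. \<bar>D k z\<bar> \<le> B" for k
    proof -
      have "\<forall>j. \<exists>b. j < n \<longrightarrow> (\<forall>x. \<bar>partial j f x\<bar> \<le> b)"
        using Cb_infinityD(4)[OF f] by (auto simp: bounded_iff)
      then obtain b where b: "\<And>j x. j < n \<Longrightarrow> \<bar>partial j f x\<bar> \<le> b j" by metis
      have "\<bar>D k z\<bar> \<le> (\<Sum>j<n. \<bar>d j k\<bar> * b j)" for z
        unfolding D_def by (rule order_trans[OF sum_abs]) (auto intro!: sum_mono mult_left_mono b simp: abs_mult)
      then show ?thesis by blast
    qed
    show "D k z = 0" if "k \<notin> S" for k z using d0[OF that] by (simp add: D_def)
  qed (rule S)
  have "F z = Ft z" if "z \<in> sobolev (- \<delta>)" for z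
    unfolding Ff[OF that] Ft_def by (rule Cb_infinityD(1)[OF f]) (simp add: pair L_def)
  moreover have "(\<lambda>x. \<Sum>j<n. partial j f (\<lambda>i. pairing z (\<phi> i)) * \<phi> j x) = (\<lambda>x. \<Sum>k\<in>S. D k z * e k x)" for z
  proof
    fix x
    have "(\<Sum>j<n. partial j f (\<lambda>i. pairing z (\<phi> i)) * \<phi> j x) = (\<Sum>j<n. \<Sum>k\<in>S. d j k * partial j f (L z) * e k x)"
    proof (rule sum.cong[OF refl])
      fix j assume "j \<in> {..<n}"
      then have j: "j < n" by simp
      have "partial j f (\<lambda>i. pairing z (\<phi> i)) = partial j f (L z)"
        by (rule partial_independent[OF f _ j]) (simp add: pair L_def)
      then show "partial j f (\<lambda>i. pairing z (\<phi> i)) * \<phi> j x = (\<Sum>k\<in>S. d j k * partial j f (L z) * e k x)"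
        unfolding \<phi>S[OF j] by (simp add: sum_distrib_left ac_simps)
    qed
    also have "\<dots> = (\<Sum>k\<in>S. D k z * e k x)"
      by (subst sum.swap) (simp add: D_def sum_distrib_right)
    finally show "(\<Sum>j<n. partial j f (\<lambda>i. pairing z (\<phi> i)) * \<phi> j x) = (\<Sum>k\<in>S. D k z * e k x)" .
  qed
  ultimately show ?thesis using data by blast
qed

text \<open>Two extensions may differ off the Sobolev space, but a line t \<mapsto>
  \<open>z(k := t)\<close> through one of its points stays inside (\<open>sobolev_update\<close>),
  so the derivatives there coincide.\<close>

lemma cylinder_data_unique:
  assumes "cylinder_data F D S" and "cylinder_data G E T" and z: "z \<in> sobolev s"
    and eq: "\<And>z. z \<in> sobolev s \<Longrightarrow> F z = G z"
  shows "D k z = E k z"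
proof -
  have "((\<lambda>t. F (z(k := t))) has_real_derivative D k (z(k := z k))) (at (z k))"
    "((\<lambda>t. G (z(k := t))) has_real_derivative E k (z(k := z k))) (at (z k))"
    using assms(1,2) unfolding cylinder_data_def by blast+
  moreover have "(\<lambda>t. F (z(k := t))) = (\<lambda>t. G (z(k := t)))" using eq sobolev_update[OF z] by auto
  ultimately show ?thesis by (auto intro: DERIV_unique)
qed

lemma cylinder_sum_cong:
  assumes "cylinder_data F D S" "finite T" "S \<subseteq> T" and "\<And>k. g k 0 = (0::real)"
  shows "(\<Sum>k\<in>S. g k (D k z)) = (\<Sum>k\<in>T. g k (D k z))"
  using assms unfolding cylinder_data_def by (intro sum.mono_neutral_left) auto

lemma cylinder_data_diff:
  assumes F: "cylinder_data F D S" and G: "cylinder_data G E T"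
  shows "cylinder_data (\<lambda>z. F z - G z) (\<lambda>k z. D k z - E k z) (S \<union> T)"
  unfolding cylinder_data_def
proof (intro conjI allI impI)
  show "((\<lambda>t. F (y(k := t)) - G (y(k := t))) has_real_derivative D k (y(k := t)) - E k (y(k := t))) (at t)" for k y t
    using F G unfolding cylinder_data_def by (intro DERIV_diff) blast+
  show "(\<lambda>z. D k z - E k z) \<in> borel_measurable seq_borel" for k
    using F G unfolding cylinder_data_def by (intro borel_measurable_diff) blast+
  show "\<exists>B. \<forall>z. \<bar>D k z - E k z\<bar> \<le> B" for k
  proof -
    obtain A B where "\<And>z. \<bar>D k z\<bar> \<le> A" "\<And>z. \<bar>E k z\<bar> \<le> B" using F G unfolding cylinder_data_def by metis
    then have "\<bar>D k z - E k z\<bar> \<le> A + B" for z by (meson abs_triangle_ineq4 add_mono order_trans)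
    then show ?thesis by blast
  qed
qed (use F G in \<open>auto simp: cylinder_data_def intro!: continuous_on_diff\<close>)

text \<open>This resolves the definite description in \<open>D_H\<close>: every representation
  yields a gradient whose coefficients are the directional derivatives of F, and these are
  determined by F.\<close>

lemma FCb_data:
  assumes "F \<in> FCb \<delta>"
  obtains Ft D S where "cylinder_data Ft D S" "\<And>z. z \<in> sobolev (- \<delta>) \<Longrightarrow> F z = Ft z"
    "\<And>z. z \<in> sobolev (- \<delta>) \<Longrightarrow> D_H \<delta> F z = (\<lambda>x. \<Sum>k\<in>S. D k z * e k x)"
proof -
  obtain n f \<phi> where rep: "cyl_rep \<delta> F n f \<phi>" using assms unfolding FCb_def by blast
  obtain Ft D S where data: "cylinder_data Ft D S" and Ft: "\<And>z. z \<in> sobolev (- \<delta>) \<Longrightarrow> F z = Ft z"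
    and grad: "\<And>z. (\<lambda>x. \<Sum>j<n. partial j f (\<lambda>i. pairing z (\<phi> i)) * \<phi> j x) = (\<lambda>x. \<Sum>k\<in>S. D k z * e k x)"
    using cyl_rep_data[OF rep] by blast
  have "D_H \<delta> F z = (\<lambda>x. \<Sum>k\<in>S. D k z * e k x)" if z: "z \<in> sobolev (- \<delta>)" for z
    unfolding D_H_def
  proof (rule the_equality)
    show "\<exists>n f \<phi>. cyl_rep \<delta> F n f \<phi> \<and> (\<lambda>x. \<Sum>k\<in>S. D k z * e k x) =
        (\<lambda>x. \<Sum>j<n. partial j f (\<lambda>i. pairing z (\<phi> i)) * \<phi> j x)"
      using rep grad[of z] by (intro exI[of _ n] exI[of _ f] exI[of _ \<phi>] conjI) (rule rep, rule sym)
    fix v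
    assume "\<exists>n f \<phi>. cyl_rep \<delta> F n f \<phi> \<and> v = (\<lambda>x. \<Sum>j<n. partial j f (\<lambda>i. pairing z (\<phi> i)) * \<phi> j x)"
    then obtain n' f' \<phi>' where rep': "cyl_rep \<delta> F n' f' \<phi>'"
      and v: "v = (\<lambda>x. \<Sum>j<n'. partial j f' (\<lambda>i. pairing z (\<phi>' i)) * \<phi>' j x)" by blast
    obtain Ft' D' S' where data': "cylinder_data Ft' D' S'" and Ft': "\<And>z. z \<in> sobolev (- \<delta>) \<Longrightarrow> F z = Ft' z"
      and grad': "v = (\<lambda>x. \<Sum>k\<in>S'. D' k z * e k x)"
      using cyl_rep_data[OF rep'] unfolding v by blast
    have D: "D' k z = D k z" for k
      by (rule cylinder_data_unique[OF data' data z]) (use Ft Ft' in auto)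
    have fin: "finite (S \<union> S')" using data data' by (auto simp: cylinder_data_def)
    show "v = (\<lambda>x. \<Sum>k\<in>S. D k z * e k x)"
    proof
      fix x
      have "v x = (\<Sum>k\<in>S \<union> S'. D' k z * e k x)"
        unfolding grad' by (rule cylinder_sum_cong[OF data' fin, where g = "\<lambda>k r. r * e k x"]) auto
      also have "\<dots> = (\<Sum>k\<in>S \<union> S'. D k z * e k x)" by (simp add: D)
      also have "\<dots> = (\<Sum>k\<in>S. D k z * e k x)"
        by (rule cylinder_sum_cong[OF data fin, where g = "\<lambda>k r. r * e k x", symmetric]) auto
      finally show "v x = (\<Sum>k\<in>S. D k z * e k x)" .
    qed
  qed
  with data Ft that show ?thesis by blast
qed

text \<open>Allows data that do not stem from a representation, in particular the differences
  supplied by \<open>cylinder_data_diff\<close>.\<close>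

lemma D_H_cylinder_data:
  assumes "F \<in> FCb \<delta>" and data: "cylinder_data Ft D S"
    and Ft: "\<And>z. z \<in> sobolev (- \<delta>) \<Longrightarrow> F z = Ft z" and z: "z \<in> sobolev (- \<delta>)"
  shows "D_H \<delta> F z = (\<lambda>x. \<Sum>k\<in>S. D k z * e k x)"
proof -
  obtain Ft' D' S' where data': "cylinder_data Ft' D' S'" and Ft': "\<And>z. z \<in> sobolev (- \<delta>) \<Longrightarrow> F z = Ft' z"
    and grad: "\<And>z. z \<in> sobolev (- \<delta>) \<Longrightarrow> D_H \<delta> F z = (\<lambda>x. \<Sum>k\<in>S'. D' k z * e k x)"
    using FCb_data[OF assms(1)] by blast
  have D: "D' k z = D k z" for k
    by (rule cylinder_data_unique[OF data' data z]) (use Ft Ft' in auto)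
  have fin: "finite (S \<union> S')" using data data' by (auto simp: cylinder_data_def)
  show ?thesis
  proof
    fix x
    have "D_H \<delta> F z x = (\<Sum>k\<in>S \<union> S'. D' k z * e k x)"
      unfolding grad[OF z] by (rule cylinder_sum_cong[OF data' fin, where g = "\<lambda>k r. r * e k x"]) auto
    also have "\<dots> = (\<Sum>k\<in>S. D k z * e k x)"
      unfolding D by (rule cylinder_sum_cong[OF data fin, where g = "\<lambda>k r. r * e k x", symmetric]) auto
    finally show "D_H \<delta> F z x = (\<Sum>k\<in>S. D k z * e k x)" .
  qed
qed

text \<open>\<open>A_pow\<close> is diagonal in the basis, so the form splits into a weighted sum of
  gradient forms in single directions. Finiteness of each term comes from boundedness of the
  derivatives.\<close>

lemma pre_form_cylinder_data:
  assumes F: "F \<in> FCb \<delta>" and data: "cylinder_data Ft D S"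
    and Ft: "\<And>z. z \<in> sobolev (- \<delta>) \<Longrightarrow> F z = Ft z"
    and \<mu>: "finite_measure \<mu>" "space \<mu> = sobolev (- \<delta>)" "\<And>k. (\<lambda>z. z k) \<in> borel_measurable \<mu>"
  shows "pre_form \<gamma> \<delta> \<mu> F F = 1 / 2 * (\<Sum>k\<in>S. lam k powr (- \<gamma>) * (\<integral>z. (D k z)\<^sup>2 \<partial>\<mu>))"
    and "integrable \<mu> (\<lambda>z. (D k z)\<^sup>2)"
proof -
  interpret finite_measure \<mu> by (rule \<mu>)
  have S: "finite S" using data by (simp add: cylinder_data_def)
  have id: "(\<lambda>z. z) \<in> \<mu> \<rightarrow>\<^sub>M seq_borel" by (rule measurable_PiM_single') (use \<mu>(3) in auto)
  have D[measurable]: "D k \<in> borel_measurable \<mu>" for k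
  proof -
    have "D k \<in> borel_measurable seq_borel" using data unfolding cylinder_data_def by blast
    from measurable_compose[OF id this] show ?thesis .
  qed
  show int: "integrable \<mu> (\<lambda>z. (D k z)\<^sup>2)" for k
  proof -
    obtain B where B: "\<And>z. \<bar>D k z\<bar> \<le> B" using data unfolding cylinder_data_def by blast
    show ?thesis
    proof (rule integrable_const_bound[where B = "B\<^sup>2"])
      show "AE z in \<mu>. norm ((D k z)\<^sup>2) \<le> B\<^sup>2" using power_mono[OF B abs_ge_zero, where n = 2] by simp
    qed measurable
  qed
  have "(\<integral>z. inner_H (A_pow \<gamma> (D_H \<delta> F z)) (D_H \<delta> F z) \<partial>\<mu>) = (\<integral>z. (\<Sum>k\<in>S. lam k powr (- \<gamma>) * (D k z)\<^sup>2) \<partial>\<mu>)"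
  proof (rule Bochner_Integration.integral_cong[OF refl])
    fix z assume "z \<in> space \<mu>"
    then have z: "z \<in> sobolev (- \<delta>)" by (simp add: \<mu>(2))
    have DH: "D_H \<delta> F z = (\<lambda>x. \<Sum>k\<in>S. D k z * e k x)" using D_H_cylinder_data[OF F data _ z] Ft by blast
    show "inner_H (A_pow \<gamma> (D_H \<delta> F z)) (D_H \<delta> F z) = (\<Sum>k\<in>S. lam k powr (- \<gamma>) * (D k z)\<^sup>2)"
      unfolding DH inner_A_pow_span[OF S] by (simp add: power2_eq_square)
  qed
  also have "\<dots> = (\<Sum>k\<in>S. lam k powr (- \<gamma>) * (\<integral>z. (D k z)\<^sup>2 \<partial>\<mu>))"
    by (subst Bochner_Integration.integral_sum) (auto intro: int)
  finally show "pre_form \<gamma> \<delta> \<mu> F F = 1 / 2 * (\<Sum>k\<in>S. lam k powr (- \<gamma>) * (\<integral>z. (D k z)\<^sup>2 \<partial>\<mu>))"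
    by (simp add: pre_form_def)
qed

section \<open>Closability for Gibbs measures\<close>

lemma in_L2_diff:
  assumes "in_L2 M f" and "in_L2 M g"
  shows "in_L2 M (\<lambda>x. f x - g x)"
proof -
  have [measurable]: "f \<in> borel_measurable M" "g \<in> borel_measurable M"
    and fi: "integrable M (\<lambda>x. (f x)\<^sup>2)" and gi: "integrable M (\<lambda>x. (g x)\<^sup>2)"
    using assms by (auto simp: in_L2_def)
  have "integrable M (\<lambda>x. 2 * (f x)\<^sup>2 + 2 * (g x)\<^sup>2)"
    by (intro Bochner_Integration.integrable_add integrable_mult_right fi gi)
  then have "integrable M (\<lambda>x. (f x - g x)\<^sup>2)"
  proof (rule Bochner_Integration.integrable_bound)
    have "(s - t)\<^sup>2 \<le> 2 * s\<^sup>2 + 2 * t\<^sup>2" for s t :: real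
      using zero_le_power2[of "s + t"] by (simp add: power2_eq_square algebra_simps)
    then show "AE x in M. norm ((f x - g x)\<^sup>2) \<le> norm (2 * (f x)\<^sup>2 + 2 * (g x)\<^sup>2)" by simp
  qed measurable
  then show ?thesis by (simp add: in_L2_def)
qed

lemma L2_tendsto_bounded:
  assumes "L2_tendsto M f g"
  obtains C where "\<And>n. (\<integral>\<^sup>+x. ennreal ((f n x)\<^sup>2) \<partial>M) \<le> ennreal C"
proof -
  have fi: "\<And>n. integrable M (\<lambda>x. (f n x)\<^sup>2)" and gi: "integrable M (\<lambda>x. (g x)\<^sup>2)"
    and di: "\<And>n. integrable M (\<lambda>x. (f n x - g x)\<^sup>2)"
    and lim: "(\<lambda>n. \<integral>x. (f n x - g x)\<^sup>2 \<partial>M) \<longlonglongrightarrow> 0"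
    using assms in_L2_diff by (auto simp: L2_tendsto_def in_L2_def)
  have sq: "s\<^sup>2 \<le> 2 * (s - t)\<^sup>2 + 2 * t\<^sup>2" for s t :: real
    using zero_le_power2[of "s - 2 * t"] by (simp add: power2_eq_square algebra_simps)
  obtain K where K: "\<And>n. \<bar>\<integral>x. (f n x - g x)\<^sup>2 \<partial>M\<bar> \<le> K"
    using convergent_imp_Bseq[of "\<lambda>n. \<integral>x. (f n x - g x)\<^sup>2 \<partial>M"] lim unfolding convergent_def Bseq_def by auto
  have "(\<integral>\<^sup>+x. ennreal ((f n x)\<^sup>2) \<partial>M) \<le> ennreal (2 * K + 2 * (\<integral>x. (g x)\<^sup>2 \<partial>M))" for n
  proof -
    have "(\<integral>x. (f n x)\<^sup>2 \<partial>M) \<le> (\<integral>x. 2 * (f n x - g x)\<^sup>2 + 2 * (g x)\<^sup>2 \<partial>M)"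
      by (intro integral_mono fi Bochner_Integration.integrable_add integrable_mult_right di gi sq)
    also have "\<dots> = 2 * (\<integral>x. (f n x - g x)\<^sup>2 \<partial>M) + 2 * (\<integral>x. (g x)\<^sup>2 \<partial>M)"
      using di gi by (subst Bochner_Integration.integral_add) auto
    also have "\<dots> \<le> 2 * K + 2 * (\<integral>x. (g x)\<^sup>2 \<partial>M)" using K[of n] by auto
    finally show ?thesis
      by (subst nn_integral_eq_integral[OF fi]) (auto intro: ennreal_leI)
  qed
  then show ?thesis by (rule that)
qed

lemma L2_tendsto_AE_subseq:
  assumes "L2_tendsto M f g"
  obtains r where "strict_mono r" "AE x in M. (\<lambda>n. f (r n) x) \<longlonglongrightarrow> g x"
proof -
  have di: "\<And>n. integrable M (\<lambda>x. (f n x - g x)\<^sup>2)"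
    and lim: "(\<lambda>n. \<integral>x. (f n x - g x)\<^sup>2 \<partial>M) \<longlonglongrightarrow> 0"
    using assms in_L2_diff by (auto simp: L2_tendsto_def in_L2_def)
  obtain r where r: "strict_mono r" and AE: "AE x in M. (\<lambda>n. (f (r n) x - g x)\<^sup>2) \<longlonglongrightarrow> 0"
    using tendsto_L1_AE_subseq[of M "\<lambda>n x. (f n x - g x)\<^sup>2"] di lim by auto
  from AE have "AE x in M. (\<lambda>n. f (r n) x) \<longlonglongrightarrow> g x"
  proof eventually_elim
    case (elim x)
    have "(\<lambda>n. sqrt ((f (r n) x - g x)\<^sup>2)) \<longlonglongrightarrow> sqrt 0" by (intro tendsto_real_sqrt elim)
    then have "(\<lambda>n. f (r n) x - g x) \<longlonglongrightarrow> 0" by (simp add: tendsto_rabs_zero_iff)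
    then show ?case by (simp add: LIM_zero_iff)
  qed
  with r that show ?thesis by blast
qed

text \<open>The Bochner integral of a non-integrable function is 0 and division by 0 gives 0. Hence
  a vanishing normalising integral makes \<open>gibbs\<close> the zero measure, and this degenerate
  case is settled here.\<close>

lemma closable_null_density:
  assumes "\<And>z. \<rho> z = 0"
  shows "closable_in_L2 (density M \<rho>) U (pre_form \<gamma> \<delta> (density M \<rho>))"
proof -
  have \<rho>: "\<rho> = (\<lambda>_. 0)" using assms by auto
  have "pre_form \<gamma> \<delta> (density M \<rho>) F G = 0" for F G
    unfolding pre_form_def \<rho> by (subst integral_eq_zero_AE) (auto simp: AE_density)
  then show ?thesis by (simp add: closable_in_L2_def)
qed

text \<open>The constant c is common to all n and k. As the L2 norms of the convergent sequence
  \<open>W n\<close> are bounded, the derivatives are bounded in L2 uniformly in n, which is what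
  local boundedness of the limit on lines requires.\<close>

lemma closable_gibbs:
  assumes ff: "free_field \<delta> \<mu>0"
    and reg: "\<And>n k. \<exists>D. line_regular \<mu>0 c (W n) k D"
    and WV: "L2_tendsto \<mu>0 W V"
  shows "closable_in_L2 (gibbs \<mu>0 V) (FCb \<delta>) (pre_form \<gamma> \<delta> (gibbs \<mu>0 V))"
proof (cases "(\<integral>w. exp (- V w) \<partial>\<mu>0) = 0")
  case True
  then show ?thesis unfolding gibbs_def by (intro closable_null_density) simp
next
  case False
  interpret \<mu>0: prob_space \<mu>0 using ff by (simp add: free_field_def)
  let ?\<nu> = "PiM UNIV free_coordinate_law"
  have s\<nu>[measurable_cong]: "sets ?\<nu> = sets seq_borel"
    by (rule sets_PiM_cong) (simp_all add: free_coordinate_law_def)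
  have id: "(\<lambda>z. z) \<in> \<mu>0 \<rightarrow>\<^sub>M seq_borel"
    by (rule measurable_PiM_single') (use free_field_coordinate[OF ff] in auto)
  have law: "distr \<mu>0 seq_borel (\<lambda>z. z) = ?\<nu>" by (rule free_field_law[OF ff])
  have nn: "(\<integral>\<^sup>+z. h z \<partial>\<mu>0) = (\<integral>\<^sup>+z. h z \<partial>?\<nu>)" if "h \<in> borel_measurable seq_borel" for h
    unfolding law[symmetric] by (rule nn_integral_distr[OF id, symmetric]) (use that in simp)
  have m0: "h \<in> borel_measurable \<mu>0" if "h \<in> borel_measurable seq_borel" for h :: "_ \<Rightarrow> 'c::topological_space"
    using measurable_compose[OF id that] .
  have m\<nu>: "h \<in> borel_measurable ?\<nu>" if "h \<in> borel_measurable seq_borel" for h :: "_ \<Rightarrow> 'c::topological_space"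
    using that measurable_cong_sets[OF s\<nu> refl] by blast
  have Wm[measurable]: "W n \<in> borel_measurable seq_borel" for n
    using reg[of n undefined] by (auto simp: line_regular_def)
  have V[measurable]: "V \<in> borel_measurable \<mu>0" using WV by (simp add: L2_tendsto_def in_L2_def)

  obtain r where r: "strict_mono r" and rV: "AE z in \<mu>0. (\<lambda>n. W (r n) z) \<longlonglongrightarrow> V z"
    by (rule L2_tendsto_AE_subseq[OF WV])
  \<comment> \<open>\<open>V\<close> is given on the Sobolev space and up to null sets. The
    pointwise limit of the cutoffs is a version of it that is defined and measurable on all
    sequences.\<close>
  define V' where "V' z = lim (\<lambda>n. W (r n) z)" for z
  have V'[measurable]: "V' \<in> borel_measurable seq_borel" unfolding V'_def by measurable
  have VV': "AE z in \<mu>0. V z = V' z"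
    using rV by eventually_elim (simp add: V'_def limI)
  have conv: "AE z in ?\<nu>. (\<lambda>n. W (r n) z) \<longlonglongrightarrow> V' z"
  proof -
    have "AE z in \<mu>0. (\<lambda>n. W (r n) z) \<longlonglongrightarrow> V' z" using rV VV' by eventually_elim simp
    then show ?thesis unfolding law[symmetric] by (subst AE_distr_iff[OF id]) measurable
  qed
  obtain C where C: "\<And>n. (\<integral>\<^sup>+z. ennreal ((W n z)\<^sup>2) \<partial>\<mu>0) \<le> ennreal C"
    using L2_tendsto_bounded[OF WV] by blast
  have V'_bounded: "AE y in PiM (UNIV - {k}) free_coordinate_law. \<forall>R. \<exists>B. AE t in lborel. t \<in> {-R..R} \<longrightarrow> \<bar>V' (y(k := t))\<bar> \<le> B" for k
  proof -
    obtain D where D: "\<And>n. line_regular \<mu>0 c (W n) k (D n)" using reg[of _ k] by metis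
    interpret fibred_measure ?\<nu> "PiM (UNIV - {k}) free_coordinate_law" "\<lambda>y t. y(k := t)" "normal_density 0 (1 / sqrt (lam k))"
      by (rule fibred_free_field)
    show ?thesis
    proof (rule limit_locally_bounded_on_fibres[where W = "\<lambda>n. W (r n)" and DW = "\<lambda>n. D (r n)" and C = "ennreal c * ennreal C"])
      fix n
      have Dm: "D (r n) \<in> borel_measurable seq_borel" using D[of "r n"] by (simp add: line_regular_def)
      note [measurable] = Dm
      show "D (r n) \<in> borel_measurable ?\<nu>" by (rule m\<nu>[OF Dm])
      have "(\<integral>\<^sup>+z. ennreal ((D (r n) z)\<^sup>2) \<partial>?\<nu>) = (\<integral>\<^sup>+z. ennreal ((D (r n) z)\<^sup>2) \<partial>\<mu>0)"
        by (intro nn[symmetric]) measurable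
      also have "\<dots> \<le> ennreal c * (\<integral>\<^sup>+z. ennreal ((W (r n) z)\<^sup>2) \<partial>\<mu>0)" using D[of "r n"] by (simp add: line_regular_def)
      also have "\<dots> \<le> ennreal c * ennreal C" by (intro mult_left_mono C) simp
      finally show "(\<integral>\<^sup>+z. ennreal ((D (r n) z)\<^sup>2) \<partial>?\<nu>) \<le> ennreal c * ennreal C" .
      show "((\<lambda>t. W (r n) (y(k := t))) has_real_derivative D (r n) (y(k := t))) (at t)" for y t
        using D[of "r n"] by (simp add: line_regular_def)
      show "continuous_on UNIV (\<lambda>t. D (r n) (y(k := t)))" for y
        using D[of "r n"] by (simp add: line_regular_def)
    qed (auto simp: conv ennreal_mult_less_top)
  qed

  define Z where "Z = (\<integral>w. exp (- V w) \<partial>\<mu>0)"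
  \<comment> \<open>A nonzero Bochner integral certifies integrability.\<close>
  have expV: "integrable \<mu>0 (\<lambda>z. exp (- V z))" using False not_integrable_integral_eq by blast
  have "0 \<le> Z" unfolding Z_def by (rule Bochner_Integration.integral_nonneg) simp
  moreover have "Z \<noteq> 0" unfolding Z_def by (rule False)
  ultimately have Z: "0 < Z" by linarith
  define \<mu> where "\<mu> = gibbs \<mu>0 V"
  have \<mu>_eq: "\<mu> = density \<mu>0 (\<lambda>z. ennreal (1 / Z * exp (- V' z)))"
    unfolding \<mu>_def gibbs_def Z_def[symmetric]
  proof (rule density_cong)
    show "(\<lambda>z. ennreal (1 / Z * exp (- V' z))) \<in> borel_measurable \<mu>0" by (rule m0) measurable
    show "AE z in \<mu>0. ennreal (exp (- V z) / Z) = ennreal (1 / Z * exp (- V' z))"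
      using VV' by eventually_elim simp
  qed measurable
  \<comment> \<open>The copy of \<mu> on the space of all sequences: it has the same integrals of
    product measurable functions and is fibred along lines.\<close>
  define \<kappa> where "\<kappa> = density ?\<nu> (\<lambda>z. ennreal (1 / Z * exp (- V' z)))"
  have \<mu>\<kappa>: "(\<integral>\<^sup>+z. h z \<partial>\<mu>) = (\<integral>\<^sup>+z. h z \<partial>\<kappa>)" if h[measurable]: "h \<in> borel_measurable seq_borel" for h
  proof -
    have "(\<integral>\<^sup>+z. h z \<partial>\<mu>) = (\<integral>\<^sup>+z. ennreal (1 / Z * exp (- V' z)) * h z \<partial>\<mu>0)"
      unfolding \<mu>_eq by (intro nn_integral_density m0) measurable
    also have "\<dots> = (\<integral>\<^sup>+z. ennreal (1 / Z * exp (- V' z)) * h z \<partial>?\<nu>)" by (rule nn) measurable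
    also have "\<dots> = (\<integral>\<^sup>+z. h z \<partial>\<kappa>)" unfolding \<kappa>_def by (intro nn_integral_density[symmetric]) measurable
    finally show ?thesis .
  qed
  have space\<mu>: "space \<mu> = sobolev (- \<delta>)" by (simp add: \<mu>_eq free_field_space[OF ff])
  have coord\<mu>: "(\<lambda>z. z k) \<in> borel_measurable \<mu>" for k
    using free_field_coordinate[OF ff, of k] by (simp add: \<mu>_eq)
  have fin\<mu>: "finite_measure \<mu>"
  proof
    have "emeasure \<mu> (space \<mu>) = (\<integral>\<^sup>+z. ennreal (exp (- V z) / Z) \<partial>\<mu>0)"
      unfolding \<mu>_def gibbs_def Z_def[symmetric] by (subst emeasure_density) (auto intro!: nn_integral_cong)
    also have "\<dots> = ennreal (\<integral>z. exp (- V z) / Z \<partial>\<mu>0)"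
      using expV Z by (intro nn_integral_eq_integral) auto
    finally show "emeasure \<mu> (space \<mu>) \<noteq> \<infinity>" by simp
  qed

  have "closable_in_L2 \<mu> (FCb \<delta>) (pre_form \<gamma> \<delta> \<mu>)"
    unfolding closable_in_L2_def
  proof (intro allI impI)
    let ?Q = "\<lambda>F. pre_form \<gamma> \<delta> \<mu> F F"
    fix F assume F: "\<forall>n. F n \<in> FCb \<delta>" and F0: "L2_tendsto \<mu> F (\<lambda>_. 0)"
      and cauchy: "\<forall>\<epsilon>>0. \<exists>N. \<forall>m\<ge>N. \<forall>n\<ge>N. ?Q (\<lambda>z. F m z - F n z) < \<epsilon>"
    have "\<exists>Ft D S. cylinder_data Ft D S \<and> (\<forall>z\<in>sobolev (- \<delta>). F n z = Ft z)" for n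
      using FCb_data[OF F[rule_format, of n]] by metis
    then obtain Ft D S where data: "\<And>n. cylinder_data (Ft n) (D n) (S n)"
      and Ft: "\<And>n z. z \<in> sobolev (- \<delta>) \<Longrightarrow> F n z = Ft n z" by metis
    have S: "finite (S n)" for n using data[of n] by (simp add: cylinder_data_def)
    have Ftm[measurable]: "Ft n \<in> borel_measurable seq_borel" and Dm[measurable]: "D n k \<in> borel_measurable seq_borel" for n k
      using data[of n] unfolding cylinder_data_def by blast+
    have ddiff: "cylinder_data (\<lambda>z. Ft m z - Ft n z) (\<lambda>k z. D m k z - D n k z) (S m \<union> S n)" for m n
      by (rule cylinder_data_diff[OF data data])
    define w where "w k = lam k powr (- \<gamma>)" for k
    have w: "0 < w k" for k using lam_ge_1[of k] by (simp add: w_def)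
    define q where "q n k = (\<integral>z. (D n k z)\<^sup>2 \<partial>\<mu>)" for n k
    define qd where "qd m n k = (\<integral>z. (D m k z - D n k z)\<^sup>2 \<partial>\<mu>)" for m n k
    have Q: "?Q (F n) = 1 / 2 * (\<Sum>k\<in>S n. w k * q n k)"
      and iD: "integrable \<mu> (\<lambda>z. (D n k z)\<^sup>2)" for n k
      unfolding w_def q_def
      using pre_form_cylinder_data[OF F[rule_format] data _ fin\<mu> space\<mu> coord\<mu>] Ft by blast+
    have Qd: "?Q (\<lambda>z. F m z - F n z) = 1 / 2 * (\<Sum>k\<in>S m \<union> S n. w k * qd m n k)"
      and iDd: "integrable \<mu> (\<lambda>z. (D m k z - D n k z)\<^sup>2)" for m n k
    proof -
      have *: "F m z - F n z = Ft m z - Ft n z" if "z \<in> sobolev (- \<delta>)" for z using Ft that by simp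
      show "?Q (\<lambda>z. F m z - F n z) = 1 / 2 * (\<Sum>k\<in>S m \<union> S n. w k * qd m n k)"
        unfolding w_def qd_def
        by (rule pre_form_cylinder_data(1)[OF FCb_diff[OF F[rule_format] F[rule_format]] ddiff * fin\<mu> space\<mu> coord\<mu>])
      show "integrable \<mu> (\<lambda>z. (D m k z - D n k z)\<^sup>2)"
        by (rule pre_form_cylinder_data(2)[OF FCb_diff[OF F[rule_format] F[rule_format]] ddiff * fin\<mu> space\<mu> coord\<mu>])
    qed
    have q0: "0 \<le> q n k" and qd0: "0 \<le> qd m n k" for m n k
      unfolding q_def qd_def by (auto intro: Bochner_Integration.integral_nonneg)
    have wq0: "0 \<le> w k * q n k" and wqd0: "0 \<le> w k * qd m n k" for m n k
      using mult_nonneg_nonneg[OF less_imp_le[OF w] q0] mult_nonneg_nonneg[OF less_imp_le[OF w] qd0] by auto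
    have nnq: "(\<integral>\<^sup>+z. ennreal ((D n k z)\<^sup>2) \<partial>\<kappa>) = ennreal (q n k)" for n k
      unfolding q_def by (subst \<mu>\<kappa>[symmetric]) (auto intro!: nn_integral_eq_integral iD)
    have nnqd: "(\<integral>\<^sup>+z. ennreal ((D m k z - D n k z)\<^sup>2) \<partial>\<kappa>) = ennreal (qd m n k)" for m n k
      unfolding qd_def by (subst \<mu>\<kappa>[symmetric]) (auto intro!: nn_integral_eq_integral iDd)
    \<comment> \<open>One direction is one term of the form, so the Cauchy property of the form
      passes to each direction, at the price of the factor 2 / w k. Directions outside both supports
      contribute 0.\<close>
    have qd_le: "qd m n k \<le> 2 / w k * ?Q (\<lambda>z. F m z - F n z)" for m n k
    proof (cases "k \<in> S m \<union> S n")
      case True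
      then have "w k * qd m n k \<le> (\<Sum>k\<in>S m \<union> S n. w k * qd m n k)"
        using S by (intro member_le_sum wqd0) auto
      then show ?thesis unfolding Qd using w[of k] by (simp add: field_simps)
    next
      case False
      then have "D m k z - D n k z = 0" for z using ddiff[of m n] unfolding cylinder_data_def by blast
      then have "qd m n k = 0" by (simp add: qd_def)
      moreover have "0 \<le> (\<Sum>k\<in>S m \<union> S n. w k * qd m n k)"
        by (intro sum_nonneg wqd0)
      ultimately show ?thesis unfolding Qd using w[of k] by simp
    qed
    have qlim: "(\<lambda>n. q n k) \<longlonglongrightarrow> 0" for k
    proof -
      interpret fibred_measure ?\<nu> "PiM (UNIV - {k}) free_coordinate_law" "\<lambda>y t. y(k := t)" "normal_density 0 (1 / sqrt (lam k))"
        by (rule fibred_free_field)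
      have "(\<lambda>n. \<integral>\<^sup>+z. ennreal ((D n k z)\<^sup>2) \<partial>\<kappa>) \<longlonglongrightarrow> 0"
      proof (rule derivative_closable[where F = Ft and V = V' and c = "1 / Z", OF _ _ _ _ _ V'_bounded _ \<kappa>_def])
        show "((\<lambda>t. Ft n (y(k := t))) has_real_derivative D n k (y(k := t))) (at t)" for n y t
          using data[of n] unfolding cylinder_data_def by blast
        show "continuous_on UNIV (\<lambda>t. D n k (y(k := t)))" for n y
          using data[of n] unfolding cylinder_data_def by blast
        show "0 < 1 / Z" using Z by simp
        have "(\<integral>\<^sup>+z. ennreal ((Ft n z)\<^sup>2) \<partial>\<kappa>) = ennreal (\<integral>z. (F n z - 0)\<^sup>2 \<partial>\<mu>)" for n
        proof -
          have "(\<integral>\<^sup>+z. ennreal ((Ft n z)\<^sup>2) \<partial>\<kappa>) = (\<integral>\<^sup>+z. ennreal ((Ft n z)\<^sup>2) \<partial>\<mu>)" by (rule \<mu>\<kappa>[symmetric]) measurable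
          also have "\<dots> = (\<integral>\<^sup>+z. ennreal ((F n z)\<^sup>2) \<partial>\<mu>)" by (intro nn_integral_cong) (simp add: space\<mu> Ft)
          also have "\<dots> = ennreal (\<integral>z. (F n z)\<^sup>2 \<partial>\<mu>)"
            using F0 by (intro nn_integral_eq_integral) (auto simp: L2_tendsto_def in_L2_def)
          finally show ?thesis by simp
        qed
        moreover have "(\<lambda>n. ennreal (\<integral>z. (F n z - 0)\<^sup>2 \<partial>\<mu>)) \<longlonglongrightarrow> ennreal 0"
          using F0 by (intro tendsto_ennrealI) (simp add: L2_tendsto_def)
        ultimately show "(\<lambda>n. \<integral>\<^sup>+z. ennreal ((Ft n z)\<^sup>2) \<partial>\<kappa>) \<longlonglongrightarrow> 0" by simp
        fix \<epsilon> :: real assume \<epsilon>: "0 < \<epsilon>"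
        then obtain N where N: "\<And>m n. m \<ge> N \<Longrightarrow> n \<ge> N \<Longrightarrow>
            ?Q (\<lambda>z. F m z - F n z) < w k / 2 * \<epsilon>"
          using cauchy w[of k] by (metis divide_pos_pos mult_pos_pos zero_less_numeral)
        have "qd m n k < \<epsilon>" if "m \<ge> N" "n \<ge> N" for m n
        proof -
          have "2 / w k * ?Q (\<lambda>z. F m z - F n z) < 2 / w k * (w k / 2 * \<epsilon>)"
            using N[OF that] w[of k] by (intro mult_strict_left_mono) auto
          also have "\<dots> = \<epsilon>" using w[of k] by simp
          finally show ?thesis using qd_le[of m n k] by simp
        qed
        then show "\<exists>N. \<forall>m\<ge>N. \<forall>n\<ge>N. (\<integral>\<^sup>+z. ennreal ((D m k z - D n k z)\<^sup>2) \<partial>\<kappa>) < ennreal \<epsilon>"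
          unfolding nnqd using \<epsilon> by (intro exI[of _ N]) (auto intro: ennreal_lessI)
      qed measurable
      then have "(\<lambda>n. ennreal (q n k)) \<longlonglongrightarrow> ennreal 0" unfolding nnq by simp
      then show ?thesis using q0 by (subst (asm) tendsto_ennreal_iff) auto
    qed
    show "(\<lambda>n. ?Q (F n)) \<longlonglongrightarrow> 0"
    proof (rule LIMSEQ_I)
      fix \<epsilon> :: real assume \<epsilon>: "0 < \<epsilon>"
      then obtain N where N: "\<And>m n. m \<ge> N \<Longrightarrow> n \<ge> N \<Longrightarrow>
          ?Q (\<lambda>z. F m z - F n z) < \<epsilon> / 4"
        using cauchy by (metis divide_pos_pos zero_less_numeral)
      have "norm (?Q (F n) - 0) < \<epsilon>" if n: "n \<ge> N" for n
      proof -
        \<comment> \<open>From \<open>q n k\<close> \<le> 2 \<open>qd n m k\<close> + 2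
          \<open>q m k\<close> one gets Q(F n) \<le> 2 Q(F n - F m) plus the sum over S n, and Q(F n
          - F m) is below \<epsilon> / 4. The remaining sum runs over a finite set independent of m,
          so it tends to 0 with m by \<open>qlim\<close>.\<close>
        have "?Q (F n) \<le> \<epsilon> / 2 + (\<Sum>k\<in>S n. w k * q m k)" if m: "m \<ge> N" for m
        proof -
          have "q n k \<le> 2 * qd n m k + 2 * q m k" for k
          proof -
            have "q n k \<le> (\<integral>z. 2 * (D n k z - D m k z)\<^sup>2 + 2 * (D m k z)\<^sup>2 \<partial>\<mu>)"
              unfolding q_def
            proof (rule integral_mono)
              show "(D n k z)\<^sup>2 \<le> 2 * (D n k z - D m k z)\<^sup>2 + 2 * (D m k z)\<^sup>2" for z
                using zero_le_power2[of "D n k z - 2 * D m k z"] by (simp add: power2_eq_square algebra_simps)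
            qed (intro iD iDd Bochner_Integration.integrable_add integrable_mult_right)+
            also have "\<dots> = 2 * qd n m k + 2 * q m k"
              unfolding q_def qd_def by (subst Bochner_Integration.integral_add) (auto intro: iD iDd)
            finally show ?thesis .
          qed
          then have "(\<Sum>k\<in>S n. w k * q n k) \<le> (\<Sum>k\<in>S n. w k * (2 * qd n m k + 2 * q m k))"
            using w by (intro sum_mono mult_left_mono) (auto intro: less_imp_le)
          also have "\<dots> = 2 * (\<Sum>k\<in>S n. w k * qd n m k) + 2 * (\<Sum>k\<in>S n. w k * q m k)"
            by (simp add: sum_distrib_left sum.distrib[symmetric] algebra_simps)
          also have "(\<Sum>k\<in>S n. w k * qd n m k) \<le> (\<Sum>k\<in>S n \<union> S m. w k * qd n m k)"
            using S by (intro sum_mono2 wqd0) auto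
          also have "\<dots> = 2 * ?Q (\<lambda>z. F n z - F m z)" by (simp add: Qd)
          also have "\<dots> \<le> \<epsilon> / 2" using N[OF n m] by simp
          finally show ?thesis unfolding Q by simp
        qed
        then have ev: "\<forall>\<^sub>F m in sequentially. ?Q (F n) \<le> \<epsilon> / 2 + (\<Sum>k\<in>S n. w k * q m k)"
          by (auto simp: eventually_sequentially)
        have "(\<lambda>m. \<epsilon> / 2 + (\<Sum>k\<in>S n. w k * q m k)) \<longlonglongrightarrow> \<epsilon> / 2 + (\<Sum>k\<in>S n. w k * 0)"
          by (intro tendsto_intros qlim)
        from tendsto_lowerbound[OF this ev] have "?Q (F n) \<le> \<epsilon> / 2" by simp
        moreover have "0 \<le> ?Q (F n)"
          unfolding Q by (intro mult_nonneg_nonneg sum_nonneg wq0) simp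
        ultimately show ?thesis using \<epsilon> by simp
      qed
      then show "\<exists>N. \<forall>n\<ge>N. norm (?Q (F n) - 0) < \<epsilon>" by blast
    qed
  qed
  then show ?thesis by (simp add: \<mu>_def)
qed

theorem mainTheorem4:
  fixes \<gamma> \<delta> a :: real and \<Lambda> :: "(real \<times> real) set"
    and \<mu>0 \<mu> :: "(int \<times> int \<Rightarrow> real) measure"
  assumes "0 < \<gamma>" and "\<gamma> \<le> 1" and "0 < \<delta>" and "\<delta> + 2 * \<gamma> > 2"
    and "a \<in> {- sqrt (4 * pi)<..<sqrt (4 * pi)}"
    and "compact \<Lambda>" and "\<Lambda> = uminus ` \<Lambda>" and "0 \<in> interior \<Lambda>"
    and "free_field \<delta> \<mu>0"
    and "(\<exists>W. is_wick_exp \<mu>0 \<Lambda> a (\<lambda>_. 1) W \<and> \<mu> = gibbs \<mu>0 W) \<or>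
         (\<exists>W. is_wick_cos \<mu>0 \<Lambda> a (\<lambda>_. 1) W \<and> \<mu> = gibbs \<mu>0 W)"
  shows "closable_in_L2 \<mu> (FCb \<delta>) (pre_form \<gamma> \<delta> \<mu>)"
  using assms(10)
proof (elim disjE exE conjE)
  fix W assume "is_wick_exp \<mu>0 \<Lambda> a (\<lambda>_. 1) W" "\<mu> = gibbs \<mu>0 W"
  then show ?thesis
    using closable_gibbs[OF assms(9) wick_exp_line_regular[OF assms(9)]] by (simp add: is_wick_exp_def)
next
  fix W assume "is_wick_cos \<mu>0 \<Lambda> a (\<lambda>_. 1) W" "\<mu> = gibbs \<mu>0 W"
  then show ?thesis
    using closable_gibbs[OF assms(9) wick_cos_line_regular[OF assms(9)]] by (simp add: is_wick_cos_def)
qed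

end
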